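(* Let $\mathfrak g=\mathfrak g(A)$ with $A$ a symmetrizable generalized Cartan matrix, and let $\lambda_q$ be an integral weight. The following data attached to a highest weight $U_q(\mathfrak g)$-module $V$ of highest weight $\lambda_q$ are equivalent (each determines the others, among highest weight modules of highest weight $\lambda_q$): (1) $I_V$, the integrability of $V$; (2) $\operatorname{conv}V^1$, the convex hull of the weights of the specialization $V^1$ of $V$; (3) the stabilizer of $\operatorname{ch}V$ in the Weyl group $W$.
   Context: Let $A=(a_{ij})_{i,j\in I}$ be a symmetrizable generalized Cartan matrix, $D=\operatorname{diag}(d_i)$ with $d_i\in\mathbb Z^{>0}$ and $DA$ symmetric, $(\mathfrak h,\{\alpha_i\},\{\check\alpha_i\})$ a realization of $A$, and $\mathfrak g=\mathfrak g(A)$ the Kac--Moody algebra. Fix a lattice $P^\vee\subset\mathfrak h$ with $\mathbb Z$-basis consisting of the $\check\alpha_i$ ($i\in I$) and elements $\check\beta_l$ ($1\le l\le|I|-\operatorname{rk}A$), with $P^\vee\otimes_{\mathbb Z}\mathbb C\simeq\mathfrak h$ and $(\check\beta_l,\alpha_i)\in\mathbb Z$; $P=\{\lambda\in\mathfrak h^*:(P^\vee,\lambda)\subset\mathbb Z\}$. $U_q(\mathfrak g)$ is the $\mathbb C(q)$-algebra ($q$ an indeterminate) generated by $e_i,f_i$ ($i\in I$), $q^h$ ($h\in P^\vee$) with relations $q^0=1$, $q^hq^{h'}=q^{h+h'}$, $q^he_iq^{-h}=q^{(h,\alpha_i)}e_i$, $q^hf_iq^{-h}=q^{-(h,\alpha_i)}f_i$,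 $[e_i,f_j]=\delta_{ij}\frac{K_i-K_i^{-1}}{q_i-q_i^{-1}}$ with $K_i=q^{d_i\check\alpha_i}$, $q_i=q^{d_i}$, and the quantum Serre relations. A weight is a $\mathbb C(q)$-algebra homomorphism $\mu_q:\mathbb C(q)[q^{P^\vee}]\to\mathbb C(q)$; it is integral if it is of the form $q^\mu$, $\mu\in P$, with $q^\mu(q^h)=q^{(h,\mu)}$. $V_{\mu_q}=\{v:q^hv=\mu_q(q^h)v\ \forall h\in P^\vee\}$. A highest weight module of highest weight $\lambda_q$ is generated by a nonzero vector of $V_{\lambda_q}$ killed by all $e_i$. Its integrability is $I_V=\{i\in I:\dim\mathbb C(q)[f_i]V_{\lambda_q}<\infty\}$. For $\lambda_q$ integral, $\operatorname{ch}V=\sum_{\mu\in P}\dim V_{q^\mu}\,q^\mu$, and $W$ acts by $w(q^\mu)=q^{w\mu}$, where $s_i\mu=\mu-(\check\alpha_i,\mu)\alpha_i$. Specialization: let $A_1\subset\mathbb C(q)$ be the local ring of rational functions regular at $q=1$; for $\lambda_q=q^\lambda$, with highest weight vector $v_{\lambda_q}$, $V^1:=V_{A_1}/(q-1)V_{A_1}$, where $V_{A_1}$ is the $A_1$-form of $V$ generated by $v_{\lambda_q}$, i.e. the span over $A_1$ of all $f_{i_1}\cdots f_{i_k}v_{\lambda_q}$; this is a highest weight $U(\mathfrak g)$-module of highest weight $\lambda$ (Lusztig). $\operatorname{conv}V^1$ is the convex hull over $\mathbb R$ in $\mathfrak h^*$ of the set of weights of $V^1$. *)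

theory Defs
  imports
    "HOL-Analysis.Analysis"
    "HOL-Computational_Algebra.Fraction_Field"
    "HOL-Computational_Algebra.Polynomial"
    "HOL-Library.Poly_Mapping"
    "HOL-Library.Function_Algebras"
begin

text \<open>
  The dual space of \<open>\<hh>\<close> consists of functions from \<open>\<hh>\<close> to the complex numbers.  The pointwise
  real vector space structure makes the library's \<^term>\<open>(hull)\<close> and \<^term>\<open>convex\<close> available there.
\<close>

instantiation "fun" :: (type, real_vector) real_vector
begin

definition scaleR_fun :: "real \<Rightarrow> ('a \<Rightarrow> 'b) \<Rightarrow> 'a \<Rightarrow> 'b"
  where "scaleR_fun r f = (\<lambda>x. r *\<^sub>R f x)"

instance
  by standard (simp_all add: scaleR_fun_def fun_eq_iff scaleR_add_right scaleR_add_left)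

end


section \<open>Kac--Moody data\<close>

text \<open>
  The index set \<open>I\<close> is the finite type \<^typ>\<open>'i\<close>, and \<open>\<hh>\<close> is the type \<^typ>\<open>'h\<close> with complex
  scaling \<open>hscale\<close>.  Entry \<open>A $ i $ j\<close> is \<open>a\<^sub>i\<^sub>j\<close>, and \<open>extra_coroot l\<close> is the
  lattice generator \<open>\<beta>\<^sub>l\<close>; only the values for \<open>1 \<le> l \<le> |I| - rk A\<close> are relevant.
\<close>

record ('i::finite, 'h) km_datum =
  cartan :: "int ^ 'i ^ 'i"
  symmetrizer :: "'i \<Rightarrow> int"
  hscale :: "complex \<Rightarrow> 'h \<Rightarrow> 'h"
  root :: "'i \<Rightarrow> 'h \<Rightarrow> complex"
  coroot :: "'i \<Rightarrow> 'h"
  extra_coroot :: "nat \<Rightarrow> 'h"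

definition generalized_cartan_matrix :: "int ^ 'i ^ 'i \<Rightarrow> bool"
  where "generalized_cartan_matrix A \<longleftrightarrow>
    (\<forall>i. A $ i $ i = 2) \<and>
    (\<forall>i j. i \<noteq> j \<longrightarrow> A $ i $ j \<le> 0) \<and>
    (\<forall>i j. A $ i $ j = 0 \<longrightarrow> A $ j $ i = 0)"

definition symmetrized_by :: "int ^ 'i ^ 'i \<Rightarrow> ('i \<Rightarrow> int) \<Rightarrow> bool"
  where "symmetrized_by A d \<longleftrightarrow>
    (\<forall>i. d i > 0) \<and> (\<forall>i j. d i * A $ i $ j = d j * A $ j $ i)"

definition cartan_rank :: "int ^ 'i ^ 'i \<Rightarrow> nat"
  where "cartan_rank A = rank (\<chi> i j. complex_of_int (A $ i $ j))"

definition hdual :: "('i::finite, 'h::ab_group_add) km_datum \<Rightarrow> ('h \<Rightarrow> complex) set"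
  where "hdual D = {\<mu>. Vector_Spaces.linear (hscale D) (*) \<mu>}"

text \<open>
  Realizations in the sense of Kac: roots and coroots are linearly independent families,
  \<open>(coroot i, root j) = a\<^sub>i\<^sub>j\<close>, and \<open>dim \<hh> = 2 |I| - rk A\<close>.
\<close>

definition realization :: "('i::finite, 'h::ab_group_add) km_datum \<Rightarrow> bool"
  where "realization D \<longleftrightarrow>
    vector_space (hscale D) \<and>
    (\<exists>B. finite B \<and> module.span (hscale D) B = UNIV) \<and>
    vector_space.dim (hscale D) UNIV = 2 * CARD('i) - cartan_rank (cartan D) \<and>
    (\<forall>i. root D i \<in> hdual D) \<and>
    (\<forall>c. (\<forall>h. (\<Sum>i\<in>UNIV. c i * root D i h) = 0) \<longrightarrow> (\<forall>i. c i = 0)) \<and>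
    (\<forall>c. (\<Sum>i\<in>UNIV. hscale D (c i) (coroot D i)) = 0 \<longrightarrow> (\<forall>i. c i = 0)) \<and>
    (\<forall>i j. root D j (coroot D i) = of_int (cartan D $ i $ j))"

definition coweight_index :: "('i::finite, 'h) km_datum \<Rightarrow> ('i + nat) set"
  where "coweight_index D = UNIV <+> {1..CARD('i) - cartan_rank (cartan D)}"

definition coweight_basis :: "('i::finite, 'h) km_datum \<Rightarrow> 'i + nat \<Rightarrow> 'h"
  where "coweight_basis D = case_sum (coroot D) (extra_coroot D)"

text \<open>The lattice \<open>P\<^sup>\<or>\<close>.\<close>

definition coweight_lattice :: "('i::finite, 'h::ab_group_add) km_datum \<Rightarrow> 'h set"
  where "coweight_lattice D =
    {h. \<exists>c :: 'i + nat \<Rightarrow> int. h = (\<Sum>k\<in>coweight_index D. hscale D (of_int (c k)) (coweight_basis D k))}"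

text \<open>
  That \<open>P\<^sup>\<or> \<otimes> \<complex> \<simeq> \<hh>\<close>, with \<open>P\<^sup>\<or>\<close> having the listed generators as a \<open>\<int>\<close>-basis, says that these
  generators are a \<open>\<complex>\<close>-basis of \<open>\<hh>\<close>.
\<close>

definition km_datum :: "('i::finite, 'h::ab_group_add) km_datum \<Rightarrow> bool"
  where "km_datum D \<longleftrightarrow>
    generalized_cartan_matrix (cartan D) \<and>
    symmetrized_by (cartan D) (symmetrizer D) \<and>
    realization D \<and>
    inj_on (coweight_basis D) (coweight_index D) \<and>
    \<not> module.dependent (hscale D) (coweight_basis D ` coweight_index D) \<and>
    module.span (hscale D) (coweight_basis D ` coweight_index D) = UNIV \<and>
    (\<forall>l\<in>{1..CARD('i) - cartan_rank (cartan D)}. \<forall>i. root D i (extra_coroot D l) \<in> \<int>)"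

definition weight_lattice :: "('i::finite, 'h::ab_group_add) km_datum \<Rightarrow> ('h \<Rightarrow> complex) set"
  where "weight_lattice D = {\<mu> \<in> hdual D. \<forall>h\<in>coweight_lattice D. \<mu> h \<in> \<int>}"

definition simple_reflection ::
    "('i::finite, 'h) km_datum \<Rightarrow> 'i \<Rightarrow> ('h \<Rightarrow> complex) \<Rightarrow> ('h \<Rightarrow> complex)"
  where "simple_reflection D i \<mu> = (\<lambda>h. \<mu> h - \<mu> (coroot D i) * root D i h)"

text \<open>
  The group generated by the simple reflections; inverses need not be adjoined because the
  generators are involutions.  The formula for \<open>s\<^sub>i\<close> makes sense on all functions on \<open>\<hh>\<close>,
  and an element of the group is determined by its restriction to \<^const>\<open>hdual\<close>.
\<close>

inductive_set weyl_group ::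
    "('i::finite, 'h) km_datum \<Rightarrow> (('h \<Rightarrow> complex) \<Rightarrow> ('h \<Rightarrow> complex)) set"
  for D :: "('i::finite, 'h) km_datum"
  where
    weyl_id: "id \<in> weyl_group D"
  | weyl_step: "w \<in> weyl_group D \<Longrightarrow> simple_reflection D i \<circ> w \<in> weyl_group D"


section \<open>The field \<open>\<complex>(q)\<close>\<close>

type_synonym ratfun = "complex poly fract"

definition ratfun_const :: "complex \<Rightarrow> ratfun"
  where "ratfun_const c = Fract [:c:] 1"

definition qvar :: ratfun
  where "qvar = Fract [:0, 1:] 1"

text \<open>The local ring \<open>A\<^sub>1\<close> of rational functions regular at \<open>q = 1\<close>.\<close>

definition regular_at_1 :: "ratfun set"
  where "regular_at_1 = {Fract a b | a b. poly b 1 \<noteq> 0}"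

text \<open>\<open>q\<^sup>z\<close> for a complex number \<open>z\<close> that happens to be an integer; used only for such \<open>z\<close>.\<close>

definition qpow :: "complex \<Rightarrow> ratfun"
  where "qpow z = qvar powi \<lfloor>Re z\<rfloor>"

definition qint :: "ratfun \<Rightarrow> nat \<Rightarrow> ratfun"
  where "qint t n = (t powi int n - t powi (- int n)) / (t - inverse t)"

definition qfact :: "ratfun \<Rightarrow> nat \<Rightarrow> ratfun"
  where "qfact t n = (\<Prod>k=1..n. qint t k)"

definition qbinom :: "ratfun \<Rightarrow> nat \<Rightarrow> nat \<Rightarrow> ratfun"
  where "qbinom t n k = qfact t n / (qfact t k * qfact t (n - k))"


section \<open>Modules over \<open>U\<^sub>q(\<gg>)\<close>\<close>

text \<open>
  Since \<open>U\<^sub>q(\<gg>)\<close> is given by generators and relations, a module is a vector space over \<open>\<complex>(q)\<close>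
  with endomorphisms \<open>e\<^sub>i\<close>, \<open>f\<^sub>i\<close>, \<open>q\<^sup>h\<close> that satisfy the defining relations.
  The operators \<open>actQ M h\<close> are meaningful only for \<open>h\<close> in the lattice \<open>P\<^sup>\<or>\<close>.
\<close>

record ('i, 'h, 'v) uq_rep =
  vscale :: "ratfun \<Rightarrow> 'v \<Rightarrow> 'v"
  actE :: "'i \<Rightarrow> 'v \<Rightarrow> 'v"
  actF :: "'i \<Rightarrow> 'v \<Rightarrow> 'v"
  actQ :: "'h \<Rightarrow> 'v \<Rightarrow> 'v"

definition q_i :: "('i::finite, 'h) km_datum \<Rightarrow> 'i \<Rightarrow> ratfun"
  where "q_i D i = qvar powi symmetrizer D i"

text \<open>The element \<open>h\<close> of \<open>P\<^sup>\<or>\<close> with \<open>K\<^sub>i = q\<^sup>h\<close>.\<close>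

definition K_exponent :: "('i::finite, 'h) km_datum \<Rightarrow> 'i \<Rightarrow> 'h"
  where "K_exponent D i = hscale D (of_int (symmetrizer D i)) (coroot D i)"

definition quantum_serre ::
    "('i::finite, 'h) km_datum \<Rightarrow> (ratfun \<Rightarrow> 'v::ab_group_add \<Rightarrow> 'v) \<Rightarrow> ('i \<Rightarrow> 'v \<Rightarrow> 'v) \<Rightarrow> bool"
  where "quantum_serre D sc X \<longleftrightarrow>
    (\<forall>i j v. i \<noteq> j \<longrightarrow>
      (let n = nat (1 - cartan D $ i $ j) in
        (\<Sum>r\<le>n. sc ((-1) ^ r * qbinom (q_i D i) n r) ((X i ^^ (n - r)) (X j ((X i ^^ r) v)))) = 0))"

definition uq_module ::
    "('i::finite, 'h::ab_group_add) km_datum \<Rightarrow> ('i::finite, 'h, 'v::ab_group_add) uq_rep \<Rightarrow> bool"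
  where "uq_module D M \<longleftrightarrow>
    vector_space (vscale M) \<and>
    (\<forall>i. Vector_Spaces.linear (vscale M) (vscale M) (actE M i)) \<and>
    (\<forall>i. Vector_Spaces.linear (vscale M) (vscale M) (actF M i)) \<and>
    (\<forall>h\<in>coweight_lattice D. Vector_Spaces.linear (vscale M) (vscale M) (actQ M h)) \<and>
    (\<forall>v. actQ M 0 v = v) \<and>
    (\<forall>h\<in>coweight_lattice D. \<forall>h'\<in>coweight_lattice D. \<forall>v.
      actQ M (h + h') v = actQ M h (actQ M h' v)) \<and>
    (\<forall>h\<in>coweight_lattice D. \<forall>i v.
      actQ M h (actE M i (actQ M (- h) v)) = vscale M (qpow (root D i h)) (actE M i v)) \<and>
    (\<forall>h\<in>coweight_lattice D. \<forall>i v.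
      actQ M h (actF M i (actQ M (- h) v)) = vscale M (qpow (- root D i h)) (actF M i v)) \<and>
    (\<forall>i j v.
      actE M i (actF M j v) - actF M j (actE M i v) =
        (if i = j
         then vscale M (1 / (q_i D i - inverse (q_i D i)))
                (actQ M (K_exponent D i) v - actQ M (- K_exponent D i) v)
         else 0)) \<and>
    quantum_serre D (vscale M) (actE M) \<and>
    quantum_serre D (vscale M) (actF M)"

definition uq_submodule ::
    "('i::finite, 'h::ab_group_add) km_datum \<Rightarrow> ('i::finite, 'h, 'v::ab_group_add) uq_rep \<Rightarrow> 'v set \<Rightarrow> bool"
  where "uq_submodule D M S \<longleftrightarrow>
    module.subspace (vscale M) S \<and>
    (\<forall>i. \<forall>v\<in>S. actE M i v \<in> S \<and> actF M i v \<in> S) \<and>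
    (\<forall>h\<in>coweight_lattice D. \<forall>v\<in>S. actQ M h v \<in> S)"


section \<open>Weights\<close>

text \<open>
  The group algebra \<open>\<complex>(q)[q\<^bsup>P\<^sup>\<or>\<^esup>]\<close> is the subalgebra of \<^typ>\<open>'h \<Rightarrow>\<^sub>0 ratfun\<close>, with its convolution
  product, of elements supported in \<open>P\<^sup>\<or>\<close>; the element \<open>q\<^sup>h\<close> is \<open>Poly_Mapping.single h 1\<close>.
  The values of a weight outside this subalgebra are irrelevant.
\<close>

definition coweight_algebra ::
    "('i::finite, 'h::ab_group_add) km_datum \<Rightarrow> ('h \<Rightarrow>\<^sub>0 ratfun) set"
  where "coweight_algebra D = {x. Poly_Mapping.keys x \<subseteq> coweight_lattice D}"

definition uq_weight ::
    "('i::finite, 'h::ab_group_add) km_datum \<Rightarrow> (('h \<Rightarrow>\<^sub>0 ratfun) \<Rightarrow> ratfun) \<Rightarrow> bool"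
  where "uq_weight D \<phi> \<longleftrightarrow>
    (\<forall>x\<in>coweight_algebra D. \<forall>y\<in>coweight_algebra D.
      \<phi> (x + y) = \<phi> x + \<phi> y \<and> \<phi> (x * y) = \<phi> x * \<phi> y) \<and>
    (\<forall>c. \<phi> (Poly_Mapping.single 0 c) = c)"

text \<open>The weight \<open>q\<^sup>\<mu>\<close> for \<open>\<mu>\<close> in \<open>P\<close>.\<close>

definition q_weight :: "('h \<Rightarrow> complex) \<Rightarrow> ('h \<Rightarrow>\<^sub>0 ratfun) \<Rightarrow> ratfun"
  where "q_weight \<mu> x = (\<Sum>h\<in>Poly_Mapping.keys x. Poly_Mapping.lookup x h * qpow (\<mu> h))"

definition integral_weight ::
    "('i::finite, 'h::ab_group_add) km_datum \<Rightarrow> (('h \<Rightarrow>\<^sub>0 ratfun) \<Rightarrow> ratfun) \<Rightarrow> bool"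
  where "integral_weight D \<phi> \<longleftrightarrow>
    uq_weight D \<phi> \<and> (\<exists>\<mu>\<in>weight_lattice D. \<forall>x\<in>coweight_algebra D. \<phi> x = q_weight \<mu> x)"

definition weight_space ::
    "('i::finite, 'h::ab_group_add) km_datum \<Rightarrow> ('i::finite, 'h, 'v) uq_rep \<Rightarrow>
      (('h \<Rightarrow>\<^sub>0 ratfun) \<Rightarrow> ratfun) \<Rightarrow> 'v set"
  where "weight_space D M \<phi> =
    {v. \<forall>h\<in>coweight_lattice D. actQ M h v = vscale M (\<phi> (Poly_Mapping.single h 1)) v}"

definition highest_weight_vector ::
    "('i::finite, 'h::ab_group_add) km_datum \<Rightarrow> ('i::finite, 'h, 'v::ab_group_add) uq_rep \<Rightarrow>
      (('h \<Rightarrow>\<^sub>0 ratfun) \<Rightarrow> ratfun) \<Rightarrow> 'v \<Rightarrow> bool"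
  where "highest_weight_vector D M \<phi> v \<longleftrightarrow>
    v \<noteq> 0 \<and> v \<in> weight_space D M \<phi> \<and> (\<forall>i. actE M i v = 0) \<and>
    (\<forall>S. uq_submodule D M S \<and> v \<in> S \<longrightarrow> S = UNIV)"

definition highest_weight_module ::
    "('i::finite, 'h::ab_group_add) km_datum \<Rightarrow> ('i::finite, 'h, 'v::ab_group_add) uq_rep \<Rightarrow>
      (('h \<Rightarrow>\<^sub>0 ratfun) \<Rightarrow> ratfun) \<Rightarrow> bool"
  where "highest_weight_module D M \<phi> \<longleftrightarrow>
    uq_module D M \<and> (\<exists>v. highest_weight_vector D M \<phi> v)"


section \<open>The three invariants\<close>

text \<open>
  The set \<open>I\<^sub>V\<close>: the \<open>\<complex>(q)[f\<^sub>i]\<close>-submodule generated by the highest weight space is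
  finite-dimensional.
\<close>

definition integrability ::
    "('i::finite, 'h::ab_group_add) km_datum \<Rightarrow> ('i::finite, 'h, 'v::ab_group_add) uq_rep \<Rightarrow>
      (('h \<Rightarrow>\<^sub>0 ratfun) \<Rightarrow> ratfun) \<Rightarrow> 'i set"
  where "integrability D M \<phi> =
    {i. \<exists>B. finite B \<and>
      module.span (vscale M) {(actF M i ^^ n) v | n v. v \<in> weight_space D M \<phi>}
        = module.span (vscale M) B}"

text \<open>
  The formal character is recorded by its coefficient function on \<open>P\<close>, extended by zero.
  The coefficient of \<open>q\<^sup>\<mu>\<close> in \<open>w (ch V)\<close> is that of \<open>q\<^sup>\<nu>\<close> in \<open>ch V\<close>, with \<open>\<nu>\<close> the
  preimage of \<open>\<mu>\<close> under \<open>w\<close>.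
\<close>

definition character ::
    "('i::finite, 'h::ab_group_add) km_datum \<Rightarrow> ('i::finite, 'h, 'v::ab_group_add) uq_rep \<Rightarrow>
      ('h \<Rightarrow> complex) \<Rightarrow> nat"
  where "character D M \<mu> =
    (if \<mu> \<in> weight_lattice D
     then vector_space.dim (vscale M) (weight_space D M (q_weight \<mu>)) else 0)"

definition char_stabilizer ::
    "('i::finite, 'h::ab_group_add) km_datum \<Rightarrow> ('i::finite, 'h, 'v::ab_group_add) uq_rep \<Rightarrow>
      (('h \<Rightarrow> complex) \<Rightarrow> ('h \<Rightarrow> complex)) set"
  where "char_stabilizer D M = {w \<in> weyl_group D. character D M \<circ> inv w = character D M}"

text \<open>The \<open>A\<^sub>1\<close>-span of all \<open>f\<^sub>i\<^sub>1 \<dots> f\<^sub>i\<^sub>k v\<close>, words being encoded as lists.\<close>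

definition A1_form :: "('i::finite, 'h, 'v::ab_group_add) uq_rep \<Rightarrow> 'v \<Rightarrow> 'v set"
  where "A1_form M v =
    {\<Sum>w\<in>S. vscale M (c w) (foldr (actF M) w v) | S c. finite S \<and> (\<forall>w\<in>S. c w \<in> regular_at_1)}"

text \<open>
  \<open>V\<^sup>1\<close> is the set of congruence classes of the \<open>A\<^sub>1\<close>-form modulo its multiples by \<open>q - 1\<close>.
\<close>

definition spec_rel :: "('i::finite, 'h, 'v::ab_group_add) uq_rep \<Rightarrow> 'v \<Rightarrow> ('v \<times> 'v) set"
  where "spec_rel M v =
    {(x, y). x \<in> A1_form M v \<and> y \<in> A1_form M v \<and> x - y \<in> vscale M (qvar - 1) ` A1_form M v}"

definition specialization :: "('i::finite, 'h, 'v::ab_group_add) uq_rep \<Rightarrow> 'v \<Rightarrow> 'v set set"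
  where "specialization M v = A1_form M v // spec_rel M v"

text \<open>The map induced on \<open>V\<^sup>1\<close> by an \<open>A\<^sub>1\<close>-linear endomorphism of the \<open>A\<^sub>1\<close>-form.\<close>

definition spec_map ::
    "('i::finite, 'h, 'v::ab_group_add) uq_rep \<Rightarrow> 'v \<Rightarrow> ('v \<Rightarrow> 'v) \<Rightarrow> 'v set \<Rightarrow> 'v set"
  where "spec_map M v T X = spec_rel M v `` (T ` X)"

text \<open>
  In the \<open>U(\<gg>)\<close>-module \<open>V\<^sup>1\<close>, a complex number acts as the corresponding constant of \<open>A\<^sub>1\<close>, and
  \<open>h\<close> in \<open>P\<^sup>\<or>\<close> acts as \<open>(q\<^sup>h - 1) / (q - 1)\<close>.  Because \<open>P\<^sup>\<or>\<close> spans \<open>\<hh>\<close>, weight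
  vectors are recognized by the action of \<open>P\<^sup>\<or>\<close>.
\<close>

definition spec_weight_space ::
    "('i::finite, 'h::ab_group_add) km_datum \<Rightarrow> ('i::finite, 'h, 'v::ab_group_add) uq_rep \<Rightarrow> 'v \<Rightarrow>
      ('h \<Rightarrow> complex) \<Rightarrow> 'v set set"
  where "spec_weight_space D M v \<mu> =
    {X \<in> specialization M v. \<forall>h\<in>coweight_lattice D.
      spec_map M v (\<lambda>x. vscale M (1 / (qvar - 1)) (actQ M h x - x)) X =
      spec_map M v (vscale M (ratfun_const (\<mu> h))) X}"

definition spec_weights ::
    "('i::finite, 'h::ab_group_add) km_datum \<Rightarrow> ('i::finite, 'h, 'v::ab_group_add) uq_rep \<Rightarrow> 'v \<Rightarrow>
      ('h \<Rightarrow> complex) set"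
  where "spec_weights D M v =
    {\<mu> \<in> hdual D. \<exists>X\<in>spec_weight_space D M v \<mu>. X \<noteq> spec_rel M v `` {0}}"

end

theory Submission
  imports Defs
begin

text \<open>
  Let \<open>J = I\<^sub>V\<close> and let \<open>Wt\<close> be the set of weights of \<open>V\<close>.  Nakayama's lemma over the local ring at
  \<open>q = 1\<close> shows that \<open>V\<^sup>1\<close> has the same weights.  For \<open>j \<in> J\<close> both \<open>e\<^sub>j\<close> and \<open>f\<^sub>j\<close> are locally nilpotent,
  so powers of them embed the weight spaces of \<open>\<mu>\<close> and \<open>s\<^sub>j \<mu>\<close> into each other and \<open>s\<^sub>j\<close> fixes the
  character; for \<open>i \<notin> J\<close> all \<open>\<lambda> - n \<alpha>\<^sub>i\<close> are weights.  Every convex set that is stable under the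
  \<open>s\<^sub>j\<close>, \<open>j \<in> J\<close>, and contains all \<open>\<lambda> - \<Sum> n\<^sub>i \<alpha>\<^sub>i\<close> with \<open>i \<notin> J\<close> contains \<open>Wt\<close>; since \<open>conv Wt\<close> is such a
  set, it is determined by \<open>J\<close>.  Conversely \<open>J\<close> consists of the \<open>i\<close> for which the ray
  \<open>\<lambda> - n \<alpha>\<^sub>i\<close> leaves \<open>conv Wt\<close>.  Finally, the stabilizer of the character is the parabolic subgroup
  \<open>W\<^sub>J\<close>, as an element outside of it would move some ray \<open>\<lambda> - n \<alpha>\<^sub>i\<close>, \<open>i \<notin> J\<close>, upwards.
\<close>

section \<open>Rational functions regular at \<open>q = 1\<close>\<close>

text \<open>The rank one representation theory over C(q) is reduced to signs: the coefficients that
  decide injectivity are sums of quantum integers, whose value at q = 1 is an ordinary integer of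
  visible sign. This replaces complete reducibility and product formulas for these sums. The
  symmetry of the rescaled Cartan matrix enters in \<open>dominant_in_convex\<close>, where one
  bilinear expression is estimated from both of its arguments. That nothing outside
  \<open>W_J\<close> fixes the character rests on a fact about the Weyl group: an element that does
  not shorten when \<open>srefl i\<close> is appended on the right sends \<open>\<alpha> i\<close>
  to a nonnegative combination of simple roots. The group is given only as maps generated by
  reflections, so this is derived from the Cartan matrix by induction on length, with the dihedral
  groups as rank two input. The two modules to be compared may live on different types. They meet
  only in the dual of the Cartan subalgebra, where independence of the simple roots gives every
  weight unique coordinates below \<open>\<Lambda>\<close>.\<close>

text \<open>A relation instead of a partial evaluation map: one fact carries both regularity at q =
  1 and the value there, and any admissible fraction may witness it.\<close>

definition at1 :: "ratfun \<Rightarrow> complex \<Rightarrow> bool"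
  where "at1 x c \<longleftrightarrow> (\<exists>a b. x = Fract a b \<and> poly b 1 \<noteq> 0 \<and> poly a 1 = c * poly b 1)"

lemma at1_Fract: "poly b 1 \<noteq> 0 \<Longrightarrow> at1 (Fract a b) (poly a 1 / poly b 1)"
  unfolding at1_def by (rule exI[of _ a], rule exI[of _ b]) simp

lemma poly_at_nonzero: "poly b (1::complex) \<noteq> 0 \<Longrightarrow> b \<noteq> 0"
  by auto

lemma at1_unique:
  assumes "at1 x c" "at1 x d"
  shows "c = d"
proof -
  obtain a b where ab: "x = Fract a b" "poly b 1 \<noteq> 0" "poly a 1 = c * poly b 1"
    using assms(1) unfolding at1_def by blast
  obtain a' b' where ab': "x = Fract a' b'" "poly b' 1 \<noteq> 0" "poly a' 1 = d * poly b' 1"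
    using assms(2) unfolding at1_def by blast
  have "a * b' = a' * b"
    using ab(1,2) ab'(1,2) by (metis eq_fract(1) poly_at_nonzero)
  then have "poly a 1 * poly b' 1 = poly a' 1 * poly b 1"
    by (metis poly_mult)
  then show ?thesis using ab ab' by simp
qed

lemma at1_add: "at1 x c \<Longrightarrow> at1 y d \<Longrightarrow> at1 (x + y) (c + d)"
  unfolding at1_def
proof (elim exE conjE)
  fix a b a' b'
  assume *: "x = Fract a b" "poly b 1 \<noteq> 0" "poly a 1 = c * poly b 1"
    "y = Fract a' b'" "poly b' 1 \<noteq> 0" "poly a' 1 = d * poly b' 1"
  have "b \<noteq> 0" "b' \<noteq> 0" using * by auto
  then show "\<exists>a b. x + y = Fract a b \<and> poly b 1 \<noteq> 0 \<and> poly a 1 = (c + d) * poly b 1"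
    using * by (intro exI[of _ "a * b' + a' * b"] exI[of _ "b * b'"]) (simp add: algebra_simps)
qed

lemma at1_mult: "at1 x c \<Longrightarrow> at1 y d \<Longrightarrow> at1 (x * y) (c * d)"
  unfolding at1_def
proof (elim exE conjE)
  fix a b a' b'
  assume *: "x = Fract a b" "poly b 1 \<noteq> 0" "poly a 1 = c * poly b 1"
    "y = Fract a' b'" "poly b' 1 \<noteq> 0" "poly a' 1 = d * poly b' 1"
  then show "\<exists>a b. x * y = Fract a b \<and> poly b 1 \<noteq> 0 \<and> poly a 1 = (c * d) * poly b 1"
    by (intro exI[of _ "a * a'"] exI[of _ "b * b'"]) simp
qed

lemma at1_const: "at1 (ratfun_const c) c"
  unfolding at1_def ratfun_const_def by (intro exI[of _ "[:c:]"] exI[of _ 1]) simp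

lemma at1_one [simp]: "at1 1 1"
  unfolding at1_def by (intro exI[of _ 1] exI[of _ 1]) (simp add: One_fract_def)

lemma at1_zero [simp]: "at1 0 0"
  unfolding at1_def by (intro exI[of _ 0] exI[of _ 1]) (simp add: Zero_fract_def)

lemma at1_qvar: "at1 qvar 1"
  unfolding at1_def qvar_def by (intro exI[of _ "[:0,1:]"] exI[of _ 1]) simp

lemma at1_minus: "at1 x c \<Longrightarrow> at1 (- x) (- c)"
  using at1_mult[of "-1" "-1" x c] at1_const[of "-1"]
  by (metis (no_types, lifting) at1_def minus_fract minus_mult_commute mult_minus_left poly_minus)

lemma at1_diff: "at1 x c \<Longrightarrow> at1 y d \<Longrightarrow> at1 (x - y) (c - d)"
  using at1_add[OF _ at1_minus, of x c y d] by simp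

lemma at1_inverse: "at1 x c \<Longrightarrow> c \<noteq> 0 \<Longrightarrow> at1 (inverse x) (inverse c)"
  unfolding at1_def
proof (elim exE conjE)
  fix a b
  assume *: "c \<noteq> 0" "x = Fract a b" "poly b 1 \<noteq> 0" "poly a 1 = c * poly b 1"
  then show "\<exists>a b. inverse x = Fract a b \<and> poly b 1 \<noteq> 0 \<and> poly a 1 = inverse c * poly b 1"
    by (intro exI[of _ b] exI[of _ a]) simp
qed

lemma at1_sum: "(\<And>l. l \<in> A \<Longrightarrow> at1 (f l) (g l)) \<Longrightarrow> at1 (sum f A) (sum g A)"
  by (induction A rule: infinite_finite_induct) (auto intro: at1_add)

lemma at1_power: "at1 x c \<Longrightarrow> at1 (x ^ n) (c ^ n)"
  by (induction n) (auto intro: at1_mult)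

lemma at1_nonzero: "at1 x c \<Longrightarrow> c \<noteq> 0 \<Longrightarrow> x \<noteq> 0"
  using at1_unique at1_zero by blast

lemma regular_iff: "x \<in> regular_at_1 \<longleftrightarrow> (\<exists>c. at1 x c)"
proof
  assume "x \<in> regular_at_1"
  then obtain a b where "x = Fract a b" "poly b 1 \<noteq> 0" unfolding regular_at_1_def by blast
  then show "\<exists>c. at1 x c" using at1_Fract by blast
qed (auto simp: at1_def regular_at_1_def)

lemma qvar_neq: "qvar \<noteq> 0" "qvar - 1 \<noteq> 0"
  by (auto simp: qvar_def One_fract_def Zero_fract_def eq_fract one_pCons)

lemma qvar_power_neq_1: "n > 0 \<Longrightarrow> qvar ^ n \<noteq> 1"
proof
  assume n: "n > 0" and q: "qvar ^ n = 1"
  have "qvar ^ n = Fract ([:0, 1:] ^ n) 1"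
    unfolding qvar_def by (induction n) (auto simp: One_fract_def)
  then have "[:0, 1:] ^ n = (1 :: complex poly)"
    using q by (simp add: One_fract_def eq_fract)
  then have "poly ([:0, 1:] ^ n) 0 = (1 :: complex)" by simp
  then show False using n by (simp add: poly_power power_0_left)
qed

lemma qvar_powi_eq_1_iff: "qvar powi n = 1 \<longleftrightarrow> n = 0"
proof (cases "n \<ge> 0")
  case True
  then show ?thesis using qvar_power_neq_1[of "nat n"]
    by (cases "n = 0") (auto simp: power_int_def)
next
  case False
  then show ?thesis using qvar_power_neq_1[of "nat (-n)"]
    by (auto simp: power_int_def power_inverse)
qed

lemma qvar_powi_inj: "qvar powi m = qvar powi n \<longleftrightarrow> m = n"
proof -
  have "qvar powi m = qvar powi n \<longleftrightarrow> qvar powi (m - n) = 1"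
    using qvar_neq by (simp add: power_int_diff)
  then show ?thesis by (simp add: qvar_powi_eq_1_iff)
qed

lemma at1_qvar_powi: "at1 (qvar powi n) 1"
proof (cases "n \<ge> 0")
  case True
  then show ?thesis using at1_power[OF at1_qvar, of "nat n"]
    by (auto simp: power_int_def)
next
  case False
  then show ?thesis using at1_power[OF at1_inverse[OF at1_qvar], of "nat (-n)"]
    by (auto simp: power_int_def)
qed

text \<open>The derivative of q^n at q = 1. This is the reason why \<open>q_weight \<nu>\<close>
  specializes to the classical weight \<open>\<nu>\<close>.\<close>

lemma at1_qvar_powi_diff: "at1 ((qvar powi n - 1) / (qvar - 1)) (of_int n)"
proof -
  have nat: "at1 ((qvar ^ n - 1) / (qvar - 1)) (of_nat n)" for n
  proof (induction n)
    case (Suc n)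
    have "(qvar ^ Suc n - 1) / (qvar - 1) = qvar * ((qvar ^ n - 1) / (qvar - 1)) + 1"
      using qvar_neq by (simp add: field_simps)
    then show ?case using at1_add[OF at1_mult[OF at1_qvar Suc] at1_one] by (simp add: add.commute)
  qed simp
  show ?thesis
  proof (cases "n \<ge> 0")
    case True
    then show ?thesis using nat[of "nat n"] by (simp add: power_int_def)
  next
    case False
    have "(qvar powi n - 1) / (qvar - 1) = - (qvar powi n * ((qvar powi (- n) - 1) / (qvar - 1)))"
      using qvar_neq by (simp add: field_simps power_int_minus)
    also have "at1 \<dots> (- (1 * of_nat (nat (- n))))"
      using nat[of "nat (-n)"] False
      by (intro at1_minus at1_mult at1_qvar_powi) (simp add: power_int_def)
    finally show ?thesis using False by simp
  qed
qed

text \<open>A polynomial vanishing at 1 is divisible by q - 1, so the maximal ideal of the local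
  ring is generated by q - 1.\<close>

lemma at1_0_iff: "at1 x 0 \<longleftrightarrow> (\<exists>y\<in>regular_at_1. x = (qvar - 1) * y)"
proof
  assume "at1 x 0"
  then obtain a b where ab: "x = Fract a b" "poly b 1 \<noteq> 0" "poly a 1 = 0"
    unfolding at1_def by auto
  obtain k where "a = [:-1, 1:] * k"
    using ab(3) by (auto simp: poly_eq_0_iff_dvd)
  moreover have "qvar - 1 = Fract [:-1, 1:] 1"
    by (simp add: qvar_def One_fract_def one_pCons)
  ultimately have "x = (qvar - 1) * Fract k b"
    using ab by simp
  then show "\<exists>y\<in>regular_at_1. x = (qvar - 1) * y"
    using ab unfolding regular_at_1_def by blast
next
  assume "\<exists>y\<in>regular_at_1. x = (qvar - 1) * y"
  then obtain y c where "at1 y c" "x = (qvar - 1) * y" by (auto simp: regular_iff)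
  then show "at1 x 0" using at1_mult[OF at1_diff[OF at1_qvar at1_one], of y c] by simp
qed

lemma regular_closed:
  "0 \<in> regular_at_1" "1 \<in> regular_at_1"
  "x \<in> regular_at_1 \<Longrightarrow> y \<in> regular_at_1 \<Longrightarrow> x + y \<in> regular_at_1"
  "x \<in> regular_at_1 \<Longrightarrow> y \<in> regular_at_1 \<Longrightarrow> x * y \<in> regular_at_1"
  "x \<in> regular_at_1 \<Longrightarrow> y \<in> regular_at_1 \<Longrightarrow> x - y \<in> regular_at_1"
  unfolding regular_iff using at1_zero at1_one at1_add at1_mult at1_diff by blast+

text \<open>The quantum integer [n] in the parameter q^d, for negative n as well.\<close>

definition qbracket :: "int \<Rightarrow> int \<Rightarrow> ratfun"
  where "qbracket d n = (qvar powi (d * n) - qvar powi (- (d * n))) / (qvar powi d - qvar powi (- d))"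

text \<open>Numerator and denominator both vanish at q = 1; after division by q - 1 their values are
  2dn and 2d.\<close>

lemma at1_qbracket:
  assumes "d > 0"
  shows "at1 (qbracket d n) (of_int n)"
proof -
  have h: "at1 ((qvar powi m - qvar powi (- m)) / (qvar - 1)) (2 * of_int m)" for m
  proof -
    have "(qvar powi m - qvar powi (- m)) / (qvar - 1)
      = (qvar powi m - 1) / (qvar - 1) - (qvar powi (- m) - 1) / (qvar - 1)"
      by (simp add: diff_divide_distrib)
    then show ?thesis
      using at1_diff[OF at1_qvar_powi_diff[of m] at1_qvar_powi_diff[of "-m"]] by simp
  qed
  have eq: "qbracket d n = (qvar powi (d * n) - qvar powi (- (d * n))) / (qvar - 1)
      * inverse ((qvar powi d - qvar powi (- d)) / (qvar - 1))"
    unfolding qbracket_def using qvar_neq(2)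
    by (simp only: divide_inverse inverse_mult_distrib inverse_inverse_eq) simp
  have "at1 (qbracket d n) (2 * of_int (d * n) * inverse (2 * of_int d))"
    unfolding eq using assms by (intro at1_mult at1_inverse h) simp_all
  then show ?thesis using assms by (simp add: field_simps)
qed

section \<open>Quantum \<open>sl\<^sub>2\<close>\<close>

lemma linear_add: "Vector_Spaces.linear s t f \<Longrightarrow> f (x + y) = f x + f y"
  and linear_scale: "Vector_Spaces.linear s t f \<Longrightarrow> f (s c x) = t c (f x)"
  by (simp_all add: Vector_Spaces.linear_iff)

text \<open>Abstract so that it can be instantiated twice, the second time with \<open>E\<close> and
  \<open>F\<close> exchanged and the grading negated. Of the commutator coefficients only the values
  at q = 1 are recorded.\<close>

locale quantum_sl2 = vector_space scale
  for scale :: "ratfun \<Rightarrow> 'v::ab_group_add \<Rightarrow> 'v" +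
  fixes E F :: "'v \<Rightarrow> 'v" and U :: "int \<Rightarrow> 'v set" and br :: "int \<Rightarrow> ratfun"
  assumes linE: "Vector_Spaces.linear scale scale E"
    and linF: "Vector_Spaces.linear scale scale F"
    and subspaceU: "subspace (U n)"
    and E_in: "x \<in> U n \<Longrightarrow> E x \<in> U (n + 2)"
    and F_in: "x \<in> U n \<Longrightarrow> F x \<in> U (n - 2)"
    and comm: "x \<in> U n \<Longrightarrow> E (F x) = F (E x) + scale (br n) x"
    and at1_br: "at1 (br n) (of_int n)"
begin

lemmas E_simps = linear_add[OF linE] linear_scale[OF linE]
lemmas F_simps = linear_add[OF linF] linear_scale[OF linF]

lemma E_0 [simp]: "E 0 = 0" and F_0 [simp]: "F 0 = 0"
  using linear_scale[OF linE, of 0 0] linear_scale[OF linF, of 0 0] by simp_all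

lemma Epow_0 [simp]: "(E ^^ n) 0 = 0" and Fpow_0 [simp]: "(F ^^ n) 0 = 0"
  by (induction n) simp_all

lemma Fpow_in: "x \<in> U n \<Longrightarrow> (F ^^ r) x \<in> U (n - 2 * int r)"
proof (induction r)
  case (Suc r)
  then show ?case using F_in[of "(F ^^ r) x" "n - 2 * int r"] by (simp add: algebra_simps)
qed simp

lemma Epow_in: "x \<in> U n \<Longrightarrow> (E ^^ r) x \<in> U (n + 2 * int r)"
proof (induction r)
  case (Suc r)
  then show ?case using E_in[of "(E ^^ r) x" "n + 2 * int r"] by (simp add: algebra_simps)
qed simp

text \<open>Each time \<open>E\<close> passes a factor \<open>F\<close>, the bracket of the current
  degree is added. The sum is not condensed into a product of quantum integers, because only its
  value at q = 1 is used.\<close>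

lemma E_Fpow_Suc:
  "x \<in> U m \<Longrightarrow> E ((F ^^ Suc r) x) = (F ^^ Suc r) (E x) + scale (\<Sum>l\<le>r. br (m - 2 * int l)) ((F ^^ r) x)"
proof (induction r)
  case 0
  then show ?case using comm by simp
next
  case (Suc r)
  have "E ((F ^^ Suc (Suc r)) x) = E (F ((F ^^ Suc r) x))" by simp
  also have "\<dots> = F (E ((F ^^ Suc r) x)) + scale (br (m - 2 * int (Suc r))) ((F ^^ Suc r) x)"
    using comm Fpow_in[OF Suc.prems] by blast
  also have "\<dots> = (F ^^ Suc (Suc r)) (E x) + scale (\<Sum>l\<le>Suc r. br (m - 2 * int l)) ((F ^^ Suc r) x)"
    using Suc.IH[OF Suc.prems] by (simp add: F_simps scale_left_distrib)
  finally show ?case .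
qed

text \<open>The classical sl2 coefficient: its sign for r < m and its zero at r = m drive the
  arguments below.\<close>

lemma at1_Fsum: "at1 (\<Sum>l\<le>r. br (m - 2 * int l)) (of_int ((int r + 1) * (m - int r)))"
proof (induction r)
  case 0
  then show ?case using at1_br[of m] by simp
next
  case (Suc r)
  have eq: "(int r + 1) * (m - int r) + (m - 2 * int (Suc r)) = (int (Suc r) + 1) * (m - int (Suc r))"
    by (simp add: algebra_simps)
  show ?case
    using at1_add[OF Suc at1_br[of "m - 2 * int (Suc r)"]] unfolding of_int_add[symmetric] eq by simp
qed

text \<open>If \<open>y\<close> is an eigenvector of \<open>F E\<close>, then so is
  \<open>E y\<close>, by the commutation rule in the degree of \<open>E y\<close>; the eigenvalue
  drops by the bracket of that degree.\<close>

lemma FE_Epow: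
  assumes "x \<in> U m" "F (E x) = scale c x"
  shows "F (E ((E ^^ k) x)) = scale (c - (\<Sum>l\<in>{1..k}. br (m + 2 * int l))) ((E ^^ k) x)"
proof (induction k)
  case 0
  then show ?case using assms by simp
next
  case (Suc k)
  let ?y = "(E ^^ k) x"
  have "E (F (E ?y)) = F (E (E ?y)) + scale (br (m + 2 * int (Suc k))) (E ?y)"
    using comm[of "E ?y" "m + 2 * int (Suc k)"] Epow_in[OF assms(1), of "Suc k"] by simp
  then have "F (E (E ?y)) = E (F (E ?y)) - scale (br (m + 2 * int (Suc k))) (E ?y)"
    by simp
  also have "\<dots> = scale (c - (\<Sum>l\<in>{1..Suc k}. br (m + 2 * int l))) (E ?y)"
    unfolding Suc E_simps by (simp add: scale_left_diff_distrib scale_left_distrib)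
  finally show ?case by simp
qed

text \<open>The last nonzero \<open>(E ^^ j) x\<close> is killed by \<open>E\<close>, so its
  \<open>F E\<close>-eigenvalue must be 0; but by \<open>FE_Epow\<close> this eigenvalue is negative
  at q = 1.\<close>

lemma FE_eigen_zero:
  assumes x: "x \<in> U m" "F (E x) = scale (- d) x" and m: "m \<ge> 0"
    and d: "at1 d (of_int r)" "r > 0" and nil: "(E ^^ p) x = 0"
  shows "x = 0"
proof (rule ccontr)
  assume "x \<noteq> 0"
  define k where "k = (LEAST p. (E ^^ p) x = 0)"
  have k: "(E ^^ k) x = 0" unfolding k_def using nil by (rule LeastI)
  with \<open>x \<noteq> 0\<close> obtain j where j: "k = Suc j" by (cases k) auto
  have nz: "(E ^^ j) x \<noteq> 0"
    using not_less_Least[of j "\<lambda>p. (E ^^ p) x = 0"] j unfolding k_def by auto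
  have "scale (- d - (\<Sum>l\<in>{1..j}. br (m + 2 * int l))) ((E ^^ j) x) = 0"
    using FE_Epow[OF x, of j] k j by simp
  then have "- d - (\<Sum>l\<in>{1..j}. br (m + 2 * int l)) = 0" using nz by simp
  moreover have "at1 (- d - (\<Sum>l\<in>{1..j}. br (m + 2 * int l)))
      (- of_int r - (\<Sum>l\<in>{1..j}. of_int (m + 2 * int l)))"
    using d by (intro at1_diff at1_minus at1_sum at1_br)
  ultimately have "(- of_int r - (\<Sum>l\<in>{1..j}. of_int (m + 2 * int l))) = (0::complex)"
    using at1_unique[OF _ at1_zero] by metis
  then have "of_int (r + (\<Sum>l\<in>{1..j}. m + 2 * int l)) = (0::complex)"
    by (simp del: neg_equal_iff_equal add: diff_eq_eq neg_eq_iff_add_eq_0)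
  then have "r + (\<Sum>l\<in>{1..j}. m + 2 * int l) = 0" by (simp only: of_int_eq_0_iff)
  moreover have "(\<Sum>l\<in>{1..j}. m + 2 * int l) \<ge> 0" using m by (intro sum_nonneg) simp
  ultimately show False using d by simp
qed

text \<open>By induction on \<open>r\<close>, a vector killed by \<open>F ^ (r + 1)\<close> is an eigenvector of \<open>F E\<close> for an
  eigenvalue whose value at \<open>q = 1\<close> has the wrong sign.\<close>

lemma Fpow_inj:
  assumes nil: "\<And>y. y \<in> U m \<Longrightarrow> \<exists>p. (E ^^ p) y = 0"
  shows "x \<in> U m \<Longrightarrow> int r \<le> m \<Longrightarrow> (F ^^ r) x = 0 \<Longrightarrow> x = 0"
proof (induction r arbitrary: x)
  case (Suc r)
  let ?S = "\<Sum>l\<le>r. br (m - 2 * int l)"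
  \<comment> \<open>Applying \<open>E\<close> to \<open>(F ^^ Suc r) x = 0\<close> leaves
    \<open>F ^^ r\<close> of this vector, which is again in \<open>U m\<close>, so the induction
    hypothesis makes it vanish.\<close>
  have mem: "F (E x) + scale ?S x \<in> U m"
    using E_in[OF Suc.prems(1)] F_in[of "E x" "m + 2"] Suc.prems(1) subspaceU[of m]
    by (auto intro: subspace_add subspace_scale)
  have "(F ^^ r) (F (E x) + scale ?S x) = E ((F ^^ Suc r) x)"
  proof -
    have "(F ^^ r) (y + scale c z) = (F ^^ r) y + scale c ((F ^^ r) z)" for y z c
      by (induction r) (simp_all add: F_simps)
    then show ?thesis using E_Fpow_Suc[OF Suc.prems(1), of r] by (simp add: funpow_swap1)
  qed
  then have "F (E x) + scale ?S x = 0" using Suc.IH[OF mem] Suc.prems by simp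
  then have eig: "F (E x) = scale (- ?S) x" by (simp add: eq_neg_iff_add_eq_0)
  obtain p where p: "(E ^^ p) x = 0" using nil Suc.prems(1) by blast
  have pos: "(int r + 1) * (m - int r) > 0" using Suc.prems(2) by simp
  show ?case
    by (rule FE_eigen_zero[OF Suc.prems(1) eig _ at1_Fsum pos p]) (use Suc.prems(2) in simp)
qed simp

text \<open>Let \<open>(F ^^ j) x\<close> be the last nonzero power. Applying \<open>E\<close> to
  the next one shows that the coefficient with value (j + 1)(m - j) at q = 1 vanishes, hence m =
  j.\<close>

lemma highest_weight_nilpotent:
  assumes x: "x \<in> U m" "x \<noteq> 0" "E x = 0" and nil: "(F ^^ N) x = 0"
  shows "m \<ge> 0 \<and> (F ^^ nat (m + 1)) x = 0"
proof -
  define k where "k = (LEAST p. (F ^^ p) x = 0)"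
  have k: "(F ^^ k) x = 0" unfolding k_def using nil by (rule LeastI)
  with x obtain j where j: "k = Suc j" by (cases k) auto
  have nz: "(F ^^ j) x \<noteq> 0"
    using not_less_Least[of j "\<lambda>p. (F ^^ p) x = 0"] j unfolding k_def by auto
  let ?S = "\<Sum>l\<le>j. br (m - 2 * int l)"
  have "scale ?S ((F ^^ j) x) = E ((F ^^ Suc j) x)"
    using E_Fpow_Suc[OF x(1), of j] x(3) by simp
  then have "?S = 0" using nz k j by simp
  then have "of_int ((int j + 1) * (m - int j)) = (0::complex)"
    using at1_Fsum[where m=m and r=j] at1_unique at1_zero by metis
  then have "(int j + 1) * (m - int j) = 0" by (simp only: of_int_eq_0_iff)
  then have "m = int j" by auto
  then show ?thesis using k j by (simp add: nat_add_distrib)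
qed

end

section \<open>Positivity of roots\<close>

locale kac_moody_datum =
  fixes D :: "('i::finite, 'h::ab_group_add) km_datum"
  assumes datum: "km_datum D"
begin

abbreviation "srefl \<equiv> simple_reflection D"
abbreviation "\<alpha> \<equiv> root D"
abbreviation "a i j \<equiv> cartan D $ i $ j"
abbreviation "\<alpha>v \<equiv> coroot D"

lemma gcm: "generalized_cartan_matrix (cartan D)"
  and symmetrized: "symmetrized_by (cartan D) (symmetrizer D)"
  and realization: "realization D"
  using datum by (simp_all add: km_datum_def)

sublocale hs: vector_space "hscale D"
  using realization by (simp add: realization_def)

lemma cartan_diag [simp]: "a i i = 2"
  and cartan_offdiag: "i \<noteq> j \<Longrightarrow> a i j \<le> 0"
  and cartan_zero: "a i j = 0 \<Longrightarrow> a j i = 0"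
  using gcm by (simp_all add: generalized_cartan_matrix_def)

lemma symm_pos: "symmetrizer D i > 0"
  and symm: "symmetrizer D i * a i j = symmetrizer D j * a j i"
  using symmetrized by (simp_all add: symmetrized_by_def)

lemma root_coroot [simp]: "\<alpha> j (\<alpha>v i) = of_int (a i j)"
  using realization by (simp add: realization_def)

lemma root_hdual: "\<alpha> i \<in> hdual D"
  using realization by (simp add: realization_def)

lemma root_indep: "(\<And>h. (\<Sum>i\<in>UNIV. c i * \<alpha> i h) = 0) \<Longrightarrow> c i = 0"
  using realization unfolding realization_def by (elim conjE) blast

text \<open>Real coefficients serve both the natural coordinates of weights and their convex
  combinations.\<close>

definition rsum :: "('i \<Rightarrow> real) \<Rightarrow> 'h \<Rightarrow> complex"
  where "rsum x = (\<lambda>h. \<Sum>i\<in>UNIV. of_real (x i) * \<alpha> i h)"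

lemma rsum_inj: "rsum x = rsum y \<longleftrightarrow> x = y"
proof
  assume eq: "rsum x = rsum y"
  have "(\<Sum>i\<in>UNIV. of_real (x i - y i) * \<alpha> i h) = 0" for h
    using fun_cong[OF eq, of h] unfolding rsum_def by (simp add: left_diff_distrib sum_subtractf)
  then have "of_real (x i - y i) = (0::complex)" for i
    using root_indep[of "\<lambda>i. of_real (x i - y i)" i] by blast
  then show "x = y" by (simp add: fun_eq_iff)
qed simp

lemma rsum_simps:
  "rsum (\<lambda>i. x i + y i) h = rsum x h + rsum y h"
  "rsum (\<lambda>i. x i - y i) h = rsum x h - rsum y h"
  "rsum (\<lambda>i. c * x i) h = of_real c * rsum x h"
  "rsum (\<lambda>i. 0) h = 0"
  by (simp_all add: rsum_def algebra_simps sum.distrib sum_subtractf sum_distrib_left)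

lemma rsum_unit: "rsum (\<lambda>k. if k = i then c else 0) h = of_real c * \<alpha> i h"
proof -
  have "of_real (if k = i then c else 0) * \<alpha> k h = (if k = i then of_real c * \<alpha> i h else 0)" for k
    by simp
  then show ?thesis unfolding rsum_def by simp
qed

lemma rsum_coroot: "rsum x (\<alpha>v i) = of_real (\<Sum>j\<in>UNIV. x j * of_int (a i j))"
  by (simp add: rsum_def)

section \<open>Words of simple reflections\<close>

definition refl_word :: "'i list \<Rightarrow> ('h \<Rightarrow> complex) \<Rightarrow> 'h \<Rightarrow> complex"
  where "refl_word xs = foldr (\<lambda>i w. srefl i \<circ> w) xs id"

lemma refl_word_simps [simp]: "refl_word [] = id" "refl_word (i # xs) = srefl i \<circ> refl_word xs"
  by (simp_all add: refl_word_def)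

lemma refl_word_append: "refl_word (xs @ ys) = refl_word xs \<circ> refl_word ys"
  by (induction xs) (simp_all add: comp_assoc)

lemma refl_refl [simp]: "srefl i (srefl i \<mu>) = \<mu>"
  by (simp add: simple_reflection_def fun_eq_iff)

lemma refl_comp_refl [simp]: "srefl i \<circ> srefl i = id"
  by (simp add: fun_eq_iff)

lemma refl_comp_refl_comp [simp]: "srefl i \<circ> (srefl i \<circ> f) = f"
  by (simp add: fun_eq_iff)

lemma refl_word_rev: "refl_word xs \<circ> refl_word (rev xs) = id"
proof (induction xs)
  case (Cons i xs)
  have "refl_word (i # xs) \<circ> refl_word (rev (i # xs)) = srefl i \<circ> (refl_word xs \<circ> refl_word (rev xs)) \<circ> srefl i"
    by (simp add: refl_word_append comp_assoc)
  also have "\<dots> = id" by (simp only: Cons comp_id refl_comp_refl)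
  finally show ?case .
qed simp

lemma refl_word_rev': "refl_word (rev xs) \<circ> refl_word xs = id"
  using refl_word_rev[of "rev xs"] by simp

lemma bij_refl_word: "bij (refl_word xs)"
  using o_bij[OF refl_word_rev' refl_word_rev] .

lemma weyl_group_refl_word: "w \<in> weyl_group D \<longleftrightarrow> (\<exists>xs. w = refl_word xs)"
proof
  assume "w \<in> weyl_group D"
  then show "\<exists>xs. w = refl_word xs"
  proof induction
    case weyl_id
    then show ?case by (intro exI[of _ "[]"]) simp
  next
    case (weyl_step w i)
    then show ?case by (metis refl_word_simps(2))
  qed
next
  have "refl_word xs \<in> weyl_group D" for xs
    by (induction xs) (auto intro: weyl_group.intros simp del: o_apply simp: id_def[symmetric])
  then show "\<exists>xs. w = refl_word xs \<Longrightarrow> w \<in> weyl_group D" by blast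
qed

lemma refl_diff: "srefl i (\<lambda>h. \<mu> h - c * \<nu> h) = (\<lambda>h. srefl i \<mu> h - c * srefl i \<nu> h)"
  by (simp add: simple_reflection_def fun_eq_iff algebra_simps)

lemma refl_word_diff: "refl_word xs (\<lambda>h. \<mu> h - c * \<nu> h) = (\<lambda>h. refl_word xs \<mu> h - c * refl_word xs \<nu> h)"
  by (induction xs) (simp_all add: refl_diff)

lemma refl_root [simp]: "srefl i (\<alpha> i) = (\<lambda>h. - \<alpha> i h)"
  by (simp add: simple_reflection_def fun_eq_iff)

section \<open>Rank two: alternating words and braid relations\<close>

text \<open>For k > 0 the last letter, which acts first, is \<open>t\<close>. Words grow at the
  front, so shorter alternating words are suffixes of longer ones.\<close>

fun alt :: "'i \<Rightarrow> 'i \<Rightarrow> nat \<Rightarrow> 'i list"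
  where "alt s t 0 = []"
  | "alt s t (Suc k) = (if even k then t else s) # alt s t k"

lemma length_alt [simp]: "length (alt s t k) = k"
  by (induction k) auto

lemma alt_suffix: "j \<le> k \<Longrightarrow> \<exists>pre. alt s t k = pre @ alt s t j \<and> length pre = k - j"
proof (induction k)
  case (Suc k)
  show ?case
  proof (cases "j = Suc k")
    case False
    then obtain pre where "alt s t k = pre @ alt s t j" "length pre = k - j" using Suc by auto
    then show ?thesis using Suc.prems False
      by (intro exI[of _ "(if even k then t else s) # pre"]) auto
  qed simp
qed simp

text \<open>Coordinates along \<open>\<alpha> s\<close> and \<open>\<alpha> t\<close> over an
  arbitrary base point. With base point 0 they follow roots; with arbitrary \<open>\<mu>\<close>
  they decide equality of two words as maps.\<close>

definition comb :: "'i \<Rightarrow> 'i \<Rightarrow> ('h \<Rightarrow> complex) \<Rightarrow> complex \<Rightarrow> complex \<Rightarrow> 'h \<Rightarrow> complex"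
  where "comb s t \<mu> X Y = (\<lambda>h. \<mu> h - X * \<alpha> s h - Y * \<alpha> t h)"

lemma refl_comb:
  "srefl s (comb s t \<mu> X Y) = comb s t \<mu> (\<mu> (\<alpha>v s) - X - of_int (a s t) * Y) Y"
  "srefl t (comb s t \<mu> X Y) = comb s t \<mu> X (\<mu> (\<alpha>v t) - Y - of_int (a t s) * X)"
  by (simp_all add: comb_def simple_reflection_def fun_eq_iff algebra_simps)

text \<open>Coordinates of the image of \<open>\<alpha> s\<close> under alternating words, where p
  and r are the negated off-diagonal Cartan entries.\<close>

fun alt_coeff :: "int \<Rightarrow> int \<Rightarrow> nat \<Rightarrow> int \<times> int"
  where "alt_coeff p r 0 = (1, 0)"
  | "alt_coeff p r (Suc k) = (let (x, y) = alt_coeff p r k in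
      if even k then (x, r * x - y) else (p * y - x, y))"

lemma refl_word_alt_root:
  "refl_word (alt s t k) (\<alpha> s) = (\<lambda>h. of_int (fst (alt_coeff (- a s t) (- a t s) k)) * \<alpha> s h
     + of_int (snd (alt_coeff (- a s t) (- a t s) k)) * \<alpha> t h)"
proof -
  have "refl_word (alt s t k) (\<alpha> s) = comb s t (\<lambda>_. 0)
      (- of_int (fst (alt_coeff (- a s t) (- a t s) k))) (- of_int (snd (alt_coeff (- a s t) (- a t s) k)))"
  proof (induction k)
    case 0
    then show ?case by (simp add: comb_def)
  next
    case (Suc k)
    obtain x y where xy: "alt_coeff (- a s t) (- a t s) k = (x, y)" by fastforce
    have IH: "refl_word (alt s t k) (\<alpha> s) = comb s t (\<lambda>_. 0) (- of_int x) (- of_int y)"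
      using Suc xy by simp
    show ?case
    proof (cases "even k")
      case True
      then show ?thesis by (simp add: xy IH refl_comb)
    next
      case False
      then show ?thesis by (simp add: xy IH refl_comb)
    qed
  qed
  then show ?thesis by (simp add: comb_def fun_eq_iff)
qed

text \<open>Nonnegativity alone is not inductive. The stronger invariant says that the root pairs
  nonnegatively with the coroot of the reflection applied last (of \<open>s\<close> for k = 0);
  \<open>p * r \<ge> 4\<close> carries it over to the next step.\<close>

lemma alt_coeff_nonneg_infinite:
  assumes "p \<ge> 0" "r \<ge> 0" "p * r \<ge> 4"
  shows "(if even k then fst (alt_coeff p r k) * 2 \<ge> p * snd (alt_coeff p r k) \<and> snd (alt_coeff p r k) \<ge> 0
     else snd (alt_coeff p r k) * 2 \<ge> r * fst (alt_coeff p r k) \<and> fst (alt_coeff p r k) \<ge> 0)"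
proof (induction k)
  case (Suc k)
  obtain x y where xy: "alt_coeff p r k = (x, y)" by fastforce
  show ?case
  proof (cases "even k")
    case True
    then have *: "x * 2 \<ge> p * y" "y \<ge> 0" using Suc xy by simp_all
    have "p * y \<ge> 0" using * assms by simp
    then have x: "x \<ge> 0" using * by simp
    have "r * (x * 2) \<ge> r * (p * y)" using * assms by (intro mult_left_mono)
    moreover have "(p * r) * y \<ge> 4 * y" using * assms by (intro mult_right_mono)
    ultimately have "r * x \<ge> 2 * y" by (simp add: algebra_simps)
    then show ?thesis using True xy x by (simp add: algebra_simps)
  next
    case False
    then have *: "y * 2 \<ge> r * x" "x \<ge> 0" using Suc xy by simp_all
    have "r * x \<ge> 0" using * assms by simp
    then have y: "y \<ge> 0" using * by simp
    have "p * (y * 2) \<ge> p * (r * x)" using * assms by (intro mult_left_mono)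
    moreover have "(p * r) * x \<ge> 4 * x" using * assms by (intro mult_right_mono)
    ultimately have "p * y \<ge> 2 * x" by (simp add: algebra_simps)
    then show ?thesis using False xy y by (simp add: algebra_simps)
  qed
qed simp

text \<open>The rank two Cartan matrices of finite type: A1 x A1, A2, B2 and G2.\<close>

lemma rank_two_cases:
  fixes p r :: int
  assumes "p \<ge> 0" "r \<ge> 0" "p = 0 \<longleftrightarrow> r = 0" "\<not> p * r \<ge> 4"
  shows "(p, r) \<in> {(0,0), (1,1), (1,2), (2,1), (1,3), (3,1)}"
proof (cases "p = 0")
  case False
  then have "p \<ge> 1" "r \<ge> 1" using assms by auto
  then have "r \<le> p * r" "p \<le> p * r"
    using mult_right_mono[of 1 p r] mult_left_mono[of 1 r p] by simp_all
  then have "p \<le> 3" "r \<le> 3" using assms(4) by linarith+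
  then have "p = 1 \<or> p = 2 \<or> p = 3" "r = 1 \<or> r = 2 \<or> r = 3"
    using \<open>p \<ge> 1\<close> \<open>r \<ge> 1\<close> by linarith+
  then show ?thesis using assms by auto
qed (use assms in auto)

lemma comb_0: "comb s t \<mu> 0 0 = \<mu>"
  by (simp add: comb_def)

text \<open>Inserting zero coordinates lets \<open>refl_comb\<close> evaluate both words on an
  arbitrary function, after which equality is plain algebra.\<close>

lemma refl_word_eq_comb: "(\<And>\<mu>. refl_word xs (comb s t \<mu> 0 0) = refl_word ys (comb s t \<mu> 0 0)) \<Longrightarrow> refl_word xs = refl_word ys"
  unfolding comb_0 by blast

text \<open>Either the reflections generate an infinite dihedral group and signs never change, or a
  braid relation holds and signs are right for all shorter words.\<close>

lemma dihedral:
  assumes "s \<noteq> t"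
  defines "c \<equiv> alt_coeff (- a s t) (- a t s)"
  shows "(\<forall>k. fst (c k) \<ge> 0 \<and> snd (c k) \<ge> 0) \<or>
    (\<exists>m\<ge>1. refl_word (alt s t m) = refl_word (alt t s m) \<and> (\<forall>k<m. fst (c k) \<ge> 0 \<and> snd (c k) \<ge> 0))"
proof (cases "(- a s t) * (- a t s) \<ge> 4")
  case True
  have nn: "- a s t \<ge> 0" "- a t s \<ge> 0" using assms cartan_offdiag by auto
  have "fst (c k) \<ge> 0 \<and> snd (c k) \<ge> 0" for k
  proof (cases "even k")
    case e: True
    then have *: "fst (c k) * 2 \<ge> (- a s t) * snd (c k)" "snd (c k) \<ge> 0"
      using alt_coeff_nonneg_infinite[OF nn True, of k] unfolding c_def by auto
    moreover have "(- a s t) * snd (c k) \<ge> 0" using * nn by (intro mult_nonneg_nonneg)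
    ultimately show ?thesis by linarith
  next
    case e: False
    then have *: "snd (c k) * 2 \<ge> (- a t s) * fst (c k)" "fst (c k) \<ge> 0"
      using alt_coeff_nonneg_infinite[OF nn True, of k] unfolding c_def by auto
    moreover have "(- a t s) * fst (c k) \<ge> 0" using * nn by (intro mult_nonneg_nonneg)
    ultimately show ?thesis by linarith
  qed
  then show ?thesis by blast
next
  case False
  have nn: "- a s t \<ge> 0" "- a t s \<ge> 0" using assms cartan_offdiag by auto
  have "- a s t = 0 \<longleftrightarrow> - a t s = 0" using cartan_zero[of s t] cartan_zero[of t s] by auto
  then have "(- a s t, - a t s) \<in> {(0,0), (1,1), (1,2), (2,1), (1,3), (3,1)}"
    by (rule rank_two_cases[OF nn _ False])
  then have "\<exists>m\<ge>1. refl_word (alt s t m) = refl_word (alt t s m) \<and> (\<forall>k<m. fst (c k) \<ge> 0 \<and> snd (c k) \<ge> 0)"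
  proof (elim insertE emptyE)
    \<comment> \<open>The lengths 2, 3, 4 and 6 of the braid relations are written in unary so that
      \<open>alt\<close> and \<open>alt_coeff\<close> unfold.\<close>
    assume "(- a s t, - a t s) = (0, 0)"
    then have [simp]: "a s t = 0" "a t s = 0" by auto
    have "refl_word (alt s t (Suc (Suc 0))) = refl_word (alt t s (Suc (Suc 0)))"
      by (rule refl_word_eq_comb[of _ s t]) (simp add: refl_comb algebra_simps)
    moreover have "\<forall>k<Suc (Suc 0). fst (c k) \<ge> 0 \<and> snd (c k) \<ge> 0"
      by (simp add: less_Suc_eq c_def)
    ultimately show ?thesis by (intro exI conjI) auto
  next
    assume "(- a s t, - a t s) = (1, 1)"
    then have [simp]: "a s t = - 1" "a t s = - 1" by auto
    have "refl_word (alt s t (Suc (Suc (Suc 0)))) = refl_word (alt t s (Suc (Suc (Suc 0))))"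
      by (rule refl_word_eq_comb[of _ s t]) (simp add: refl_comb algebra_simps)
    moreover have "\<forall>k<Suc (Suc (Suc 0)). fst (c k) \<ge> 0 \<and> snd (c k) \<ge> 0"
      by (simp add: less_Suc_eq c_def)
    ultimately show ?thesis by (intro exI conjI) auto
  next
    assume "(- a s t, - a t s) = (1, 2)"
    then have [simp]: "a s t = - 1" "a t s = - 2" by auto
    have "refl_word (alt s t (Suc (Suc (Suc (Suc 0))))) = refl_word (alt t s (Suc (Suc (Suc (Suc 0)))))"
      by (rule refl_word_eq_comb[of _ s t]) (simp add: refl_comb algebra_simps)
    moreover have "\<forall>k<Suc (Suc (Suc (Suc 0))). fst (c k) \<ge> 0 \<and> snd (c k) \<ge> 0"
      by (simp add: less_Suc_eq c_def)
    ultimately show ?thesis by (intro exI conjI) auto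
  next
    assume "(- a s t, - a t s) = (2, 1)"
    then have [simp]: "a s t = - 2" "a t s = - 1" by auto
    have "refl_word (alt s t (Suc (Suc (Suc (Suc 0))))) = refl_word (alt t s (Suc (Suc (Suc (Suc 0)))))"
      by (rule refl_word_eq_comb[of _ s t]) (simp add: refl_comb algebra_simps)
    moreover have "\<forall>k<Suc (Suc (Suc (Suc 0))). fst (c k) \<ge> 0 \<and> snd (c k) \<ge> 0"
      by (simp add: less_Suc_eq c_def)
    ultimately show ?thesis by (intro exI conjI) auto
  next
    assume "(- a s t, - a t s) = (1, 3)"
    then have [simp]: "a s t = - 1" "a t s = - 3" by auto
    have "refl_word (alt s t (Suc (Suc (Suc (Suc (Suc (Suc 0))))))) = refl_word (alt t s (Suc (Suc (Suc (Suc (Suc (Suc 0)))))))"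
      by (rule refl_word_eq_comb[of _ s t]) (simp add: refl_comb algebra_simps)
    moreover have "\<forall>k<Suc (Suc (Suc (Suc (Suc (Suc 0))))). fst (c k) \<ge> 0 \<and> snd (c k) \<ge> 0"
      by (simp add: less_Suc_eq c_def)
    ultimately show ?thesis by (intro exI conjI) auto
  next
    assume "(- a s t, - a t s) = (3, 1)"
    then have [simp]: "a s t = - 3" "a t s = - 1" by auto
    have "refl_word (alt s t (Suc (Suc (Suc (Suc (Suc (Suc 0))))))) = refl_word (alt t s (Suc (Suc (Suc (Suc (Suc (Suc 0)))))))"
      by (rule refl_word_eq_comb[of _ s t]) (simp add: refl_comb algebra_simps)
    moreover have "\<forall>k<Suc (Suc (Suc (Suc (Suc (Suc 0))))). fst (c k) \<ge> 0 \<and> snd (c k) \<ge> 0"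
      by (simp add: less_Suc_eq c_def)
    ultimately show ?thesis by (intro exI conjI) auto
  qed
  then show ?thesis by force
qed

section \<open>Length and positivity\<close>

definition weyl_length :: "(('h \<Rightarrow> complex) \<Rightarrow> 'h \<Rightarrow> complex) \<Rightarrow> nat"
  where "weyl_length w = (LEAST n. \<exists>xs. length xs = n \<and> w = refl_word xs)"

lemma weyl_length_le: "weyl_length (refl_word xs) \<le> length xs"
  unfolding weyl_length_def by (rule Least_le) blast

lemma weyl_length_ex: "\<exists>ys. length ys = weyl_length (refl_word xs) \<and> refl_word xs = refl_word ys"
  unfolding weyl_length_def by (rule LeastI_ex) blast

definition nonneg :: "('h \<Rightarrow> complex) \<Rightarrow> bool"
  where "nonneg \<mu> \<longleftrightarrow> (\<exists>x. (\<forall>k. x k \<ge> 0) \<and> \<mu> = rsum x)"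

lemma nonneg_comb:
  assumes "nonneg \<mu>" "nonneg \<nu>" "x \<ge> 0" "y \<ge> 0"
  shows "nonneg (\<lambda>h. of_int x * \<mu> h + of_int y * \<nu> h)"
proof -
  obtain f g where "\<forall>k. f k \<ge> 0" "\<mu> = rsum f" "\<forall>k. g k \<ge> 0" "\<nu> = rsum g"
    using assms unfolding nonneg_def by blast
  then show ?thesis unfolding nonneg_def using assms(3,4)
    by (intro exI[of _ "\<lambda>k. of_int x * f k + of_int y * g k"])
      (simp add: fun_eq_iff rsum_simps)
qed

text \<open>Write \<open>w = u u'\<close> with lengths adding up and \<open>u'\<close> the longest possible alternating word in \<open>s\<close>
  and a descent \<open>t\<close> of \<open>w\<close>.  Then \<open>u\<close> sends \<open>\<alpha> s\<close> and \<open>\<alpha> t\<close> to positive combinations by induction, and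
  \<open>u' (\<alpha> s)\<close> is a rank two computation.\<close>

theorem nonneg_root:
  "weyl_length (refl_word xs) \<le> weyl_length (refl_word (xs @ [s])) \<Longrightarrow> nonneg (refl_word xs (\<alpha> s))"
proof (induction "weyl_length (refl_word xs)" arbitrary: xs s rule: less_induct)
  case less
  define n where "n = weyl_length (refl_word xs)"
  show ?case
  proof (cases "n = 0")
    case True
    then have "refl_word xs = id" using weyl_length_ex[of xs] unfolding n_def by auto
    moreover have "nonneg (\<alpha> s)" unfolding nonneg_def
      by (intro exI[of _ "\<lambda>k. if k = s then 1 else 0"]) (auto simp: fun_eq_iff rsum_unit)
    ultimately show ?thesis by simp
  next
    case False
    obtain zs where zs: "length zs = n" "refl_word xs = refl_word zs" using weyl_length_ex[of xs] unfolding n_def by auto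
    then obtain ys t where yt: "zs = ys @ [t]" using False by (cases zs rule: rev_cases) auto
    have "s \<noteq> t"
    proof
      assume "s = t"
      then have "refl_word (xs @ [s]) = refl_word ys"
        using zs yt by (simp add: refl_word_append comp_assoc)
      then show False using weyl_length_le[of ys] less.prems zs yt unfolding n_def by simp
    qed
    define P where "P k \<longleftrightarrow> (\<exists>ys. length ys + k = n \<and> refl_word xs = refl_word (ys @ alt s t k))" for k
    have P1: "P 1" unfolding P_def using zs yt by auto
    have bound: "P k \<Longrightarrow> k \<le> n" for k unfolding P_def by auto
    define K where "K = (GREATEST k. P k)"
    have PK: "P K" unfolding K_def using GreatestI_nat[of P, OF P1] bound by blast
    have maxK: "P k \<Longrightarrow> k \<le> K" for k unfolding K_def using Greatest_le_nat[of P] bound by blast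
    have K1: "K \<ge> 1" using maxK[OF P1] .
    then obtain K' where K': "K = Suc K'" by (cases K) auto
    obtain us where us: "length us + K = n" "refl_word xs = refl_word (us @ alt s t K)"
      using PK unfolding P_def by blast
    have lenu: "weyl_length (refl_word us) \<le> n - K" using weyl_length_le[of us] us by simp
    \<comment> \<open>\<open>p\<close> is the first letter of the alternating part and
      \<open>r\<close> the other one. If \<open>p\<close> shortened \<open>us\<close>, then
      \<open>xs\<close> would have a word of length below n; if \<open>r\<close> did, the
      alternating part could be made longer.\<close>
    define p where "p = (if even K' then t else s)"
    define r where "r = (if even K' then s else t)"
    have "weyl_length (refl_word us) \<le> weyl_length (refl_word (us @ [p]))"
    proof -
      obtain ws where ws: "length ws = weyl_length (refl_word (us @ [p]))" "refl_word (us @ [p]) = refl_word ws"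
        using weyl_length_ex by blast
      have "refl_word xs = refl_word (us @ [p]) \<circ> refl_word (alt s t K')"
        using us K' unfolding p_def by (simp add: refl_word_append comp_assoc)
      then have "refl_word xs = refl_word (ws @ alt s t K')" using ws by (simp add: refl_word_append)
      then have "n \<le> length ws + K'" using weyl_length_le[of "ws @ alt s t K'"] unfolding n_def by simp
      then show ?thesis using ws lenu K' by simp
    qed
    then have p: "nonneg (refl_word us (\<alpha> p))"
      using less.hyps[of us p] lenu K1 False unfolding n_def by simp
    have "weyl_length (refl_word us) \<le> weyl_length (refl_word (us @ [r]))"
    proof (rule ccontr)
      assume *: "\<not> ?thesis"
      obtain ws where ws: "length ws = weyl_length (refl_word (us @ [r]))" "refl_word (us @ [r]) = refl_word ws"
        using weyl_length_ex by blast
      have r: "alt s t (Suc K) = r # alt s t K" using K' unfolding r_def by simp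
      have "refl_word (ws @ alt s t (Suc K)) = refl_word us \<circ> (srefl r \<circ> srefl r) \<circ> refl_word (alt s t K)"
        unfolding r refl_word_append ws(2)[symmetric] by (simp add: comp_assoc refl_word_append)
      then have eq: "refl_word xs = refl_word (ws @ alt s t (Suc K))" using us by (simp add: refl_word_append)
      then have "n \<le> length ws + Suc K" using weyl_length_le[of "ws @ alt s t (Suc K)"] unfolding n_def by simp
      moreover have "length ws + Suc K \<le> n" using * ws lenu us by simp
      ultimately have "P (Suc K)" unfolding P_def using eq by (intro exI[of _ ws]) simp
      then show False using maxK by fastforce
    qed
    then have r: "nonneg (refl_word us (\<alpha> r))"
      using less.hyps[of us r] lenu K1 False unfolding n_def by simp
    have st: "nonneg (refl_word us (\<alpha> s))" "nonneg (refl_word us (\<alpha> t))"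
      using p r unfolding p_def r_def by (auto split: if_splits)
    define c where "c = alt_coeff (- a s t) (- a t s)"
    have "fst (c K) \<ge> 0 \<and> snd (c K) \<ge> 0"
    proof (rule ccontr)
      assume "\<not> ?thesis"
      \<comment> \<open>The braid relation turns the final m letters into a word ending in
        \<open>s\<close>, which cancels against the appended \<open>s\<close>. The resulting word
        for \<open>xs @ [s]\<close> is too short.\<close>
      then obtain m where m: "m \<ge> 1" "refl_word (alt s t m) = refl_word (alt t s m)" "m \<le> K"
        using dihedral[OF \<open>s \<noteq> t\<close>] unfolding c_def by (meson not_less)
      obtain pre where pre: "alt s t K = pre @ alt s t m" "length pre = K - m"
        using alt_suffix[OF m(3)] by blast
      obtain pre' where pre': "alt t s m = pre' @ alt t s 1" "length pre' = m - 1"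
        using alt_suffix[OF m(1)] by blast
      have "refl_word (xs @ [s]) = refl_word us \<circ> refl_word pre \<circ> refl_word (alt t s m) \<circ> srefl s"
        using us pre m by (simp add: refl_word_append comp_assoc)
      also have "\<dots> = refl_word (us @ pre @ pre') \<circ> (srefl s \<circ> srefl s)"
        using pre' by (simp add: refl_word_append comp_assoc del: refl_comp_refl)
      finally have "refl_word (xs @ [s]) = refl_word (us @ pre @ pre')" by simp
      then have "weyl_length (refl_word (xs @ [s])) \<le> length us + (K - m) + (m - 1)"
        using weyl_length_le[of "us @ pre @ pre'"] pre pre' by simp
      then show False using less.prems us m unfolding n_def by simp
    qed
    moreover have "refl_word xs (\<alpha> s) = (\<lambda>h. of_int (fst (c K)) * refl_word us (\<alpha> s) h + of_int (snd (c K)) * refl_word us (\<alpha> t) h)"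
    proof -
      have "refl_word xs (\<alpha> s) = refl_word us (\<lambda>h. of_int (fst (c K)) * \<alpha> s h + of_int (snd (c K)) * \<alpha> t h)"
        using us refl_word_alt_root[of s t K] unfolding c_def by (simp add: refl_word_append)
      \<comment> \<open>The sum is written as two nested differences to fit
        \<open>refl_word_diff\<close>, the form in which linearity is available.\<close>
      also have "\<dots> = refl_word us (\<lambda>h. (\<lambda>h. 0 - (- of_int (fst (c K))) * \<alpha> s h) h - (- of_int (snd (c K))) * \<alpha> t h)"
        by simp
      also have "\<dots> = (\<lambda>h. (refl_word us (\<lambda>_. 0) h - (- of_int (fst (c K))) * refl_word us (\<alpha> s) h)
          - (- of_int (snd (c K))) * refl_word us (\<alpha> t) h)"
        by (simp only: refl_word_diff)
      also have "refl_word us (\<lambda>_. 0) = (\<lambda>_. 0)"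
        using refl_word_diff[of us "\<lambda>_. 0" 1 "\<lambda>_. 0"] by simp
      finally show ?thesis by simp
    qed
    ultimately show ?thesis using nonneg_comb[OF st] by auto
  qed
qed

end

section \<open>Weight spaces of highest weight modules\<close>

lemma funpow_linear:
  "vector_space s \<Longrightarrow> Vector_Spaces.linear s s f \<Longrightarrow> Vector_Spaces.linear s s (f ^^ n)"
  by (induction n) (auto simp: Vector_Spaces.linear_iff)

lemma linear_0: "Vector_Spaces.linear s t f \<Longrightarrow> f 0 = 0"
  using module_hom.zero[of s t f] by (simp add: Vector_Spaces.linear_def)

lemma linear_diff: "Vector_Spaces.linear s t f \<Longrightarrow> f (x - y) = f x - f y"
  using module_hom.diff[of s t f] by (simp add: Vector_Spaces.linear_def)

lemma linear_sum: "Vector_Spaces.linear s t f \<Longrightarrow> f (\<Sum>i\<in>A. g i) = (\<Sum>i\<in>A. f (g i))"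
  using module_hom.sum[of s t f] by (simp add: Vector_Spaces.linear_def)

section \<open>Linear algebra: nilpotence, dimension, indexed spans\<close>

context vector_space
begin

lemma subspace_locally_nilpotent:
  assumes "Vector_Spaces.linear scale scale f"
  shows "subspace {x. \<exists>p. (f ^^ p) x = 0}"
proof (rule subspaceI)
  have lin: "Vector_Spaces.linear scale scale (f ^^ n)" for n
    using funpow_linear[OF vector_space_axioms assms] .
  show "0 \<in> {x. \<exists>p. (f ^^ p) x = 0}" using linear_0[OF lin] by blast
  fix x y
  assume "x \<in> {x. \<exists>p. (f ^^ p) x = 0}" "y \<in> {x. \<exists>p. (f ^^ p) x = 0}"
  then obtain p r where pr: "(f ^^ p) x = 0" "(f ^^ r) y = 0" by blast
  have "(f ^^ (p + r)) (x + y) = (f ^^ (r + p)) x + (f ^^ (p + r)) y"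
    by (simp add: linear_add[OF lin] add.commute)
  also have "\<dots> = 0" using pr by (simp add: funpow_add linear_0[OF lin])
  finally show "x + y \<in> {x. \<exists>p. (f ^^ p) x = 0}" by blast
next
  have lin: "Vector_Spaces.linear scale scale (f ^^ n)" for n
    using funpow_linear[OF vector_space_axioms assms] .
  fix c x
  assume "x \<in> {x. \<exists>p. (f ^^ p) x = 0}"
  then show "scale c x \<in> {x. \<exists>p. (f ^^ p) x = 0}"
    by (auto simp: linear_scale[OF lin])
qed

text \<open>\<open>dim\<close> is 0 on infinite-dimensional spaces, hence the finite spanning set
  demanded of the target.\<close>

lemma dim_le_injective:
  assumes f: "Vector_Spaces.linear scale scale f" "f ` A \<subseteq> W" "\<And>x. x \<in> A \<Longrightarrow> f x = 0 \<Longrightarrow> x = 0"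
    and A: "subspace A" and W: "W \<subseteq> span T" "finite T"
  shows "dim A \<le> dim W"
proof -
  interpret module_hom scale scale f using f(1) by (simp add: Vector_Spaces.linear_def)
  obtain B where B: "B \<subseteq> A" "independent B" "A \<subseteq> span B" "card B = dim A"
    using basis_exists by blast
  have sB: "span B = A" using B A span_minimal by blast
  have inj: "inj_on f A"
    using inj_on_iff_eq_0[OF A] f(3) by blast
  have ind: "independent (f ` B)"
    using independent_injective_image[OF B(2)] inj sB by simp
  obtain C where C: "C \<subseteq> W" "independent C" "W \<subseteq> span C" "card C = dim W"
    using basis_exists by blast
  have "finite C" using independent_span_bound[OF W(2) C(2)] C(1) W(1) by blast
  then have "card (f ` B) \<le> card C"
    using independent_span_bound[OF _ ind, of C] B(1) C(3) f(2) by blast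
  moreover have "card (f ` B) = card B" using inj_on_subset[OF inj B(1)] card_image by blast
  ultimately show ?thesis using B C by simp
qed

lemma dim_eq_0_iff_trivial:
  assumes A: "subspace A" "A \<subseteq> span T" "finite T"
  shows "dim A = 0 \<longleftrightarrow> A = {0}"
proof -
  obtain B where B: "B \<subseteq> A" "independent B" "A \<subseteq> span B" "card B = dim A"
    using basis_exists by blast
  have "finite B" using independent_span_bound[OF A(3) B(2)] B(1) A(2) by blast
  then have "dim A = 0 \<longleftrightarrow> B = {}" using B by auto
  also have "\<dots> \<longleftrightarrow> A = {0}"
  proof
    assume "B = {}"
    then show "A = {0}" using B(3) subspace_0[OF A(1)] by auto
  next
    assume "A = {0}"
    then show "B = {}" using B(1,2) dependent_zero by (metis subset_singletonD insertI1)
  qed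
  finally show ?thesis .
qed

text \<open>Passes from sums over vectors to sums over indices by choosing one preimage for each
  vector. For words this keeps a weight attached to each term.\<close>

lemma span_range_explicit:
  assumes "x \<in> span (range g)"
  shows "\<exists>S c. finite S \<and> x = (\<Sum>w\<in>S. scale (c w) (g w))"
proof -
  obtain t r where t: "finite t" "t \<subseteq> range g" "x = (\<Sum>a\<in>t. scale (r a) a)"
    using assms unfolding span_explicit by blast
  have gi: "g (inv g a) = a" if "a \<in> t" for a using t(2) that by (meson f_inv_into_f subsetD)
  then have "inj_on (inv g) t" by (metis inj_onI)
  then have "x = (\<Sum>w\<in>inv g ` t. scale (r (g w)) (g w))"
    using t(3) gi by (simp add: sum.reindex)
  then show ?thesis using t(1)
    by (intro exI[of _ "inv g ` t"] exI[of _ "\<lambda>w. r (g w)"]) simp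
qed

end

lemma qpow_of_int [simp]: "qpow (of_int n) = qvar powi n"
  by (simp add: qpow_def)

lemma qpow_add: "y \<in> \<int> \<Longrightarrow> z \<in> \<int> \<Longrightarrow> qpow (y + z) = qpow y * qpow z"
  by (auto elim!: Ints_cases simp: qvar_neq power_int_add simp flip: of_int_add)

lemma qpow_inj: "y \<in> \<int> \<Longrightarrow> z \<in> \<int> \<Longrightarrow> qpow y = qpow z \<longleftrightarrow> y = z"
  by (auto elim!: Ints_cases simp: qvar_powi_inj)

context kac_moody_datum
begin

section \<open>The coweight lattice and integral weights\<close>

abbreviation "L \<equiv> coweight_lattice D"
abbreviation "P \<equiv> weight_lattice D"

lemma finite_coweight_index [simp]: "finite (coweight_index D)"
  by (simp add: coweight_index_def)

lemma L_I: "(\<Sum>k\<in>coweight_index D. hscale D (of_int (c k)) (coweight_basis D k)) \<in> L"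
  unfolding coweight_lattice_def by (rule CollectI, rule exI[of _ c], rule refl)

lemma L_E:
  assumes "h \<in> L"
  obtains c where "h = (\<Sum>k\<in>coweight_index D. hscale D (of_int (c k)) (coweight_basis D k))"
  using assms unfolding coweight_lattice_def mem_Collect_eq by (elim exE)

lemma coroot_multiple_in_L: "hscale D (of_int n) (\<alpha>v i) \<in> L"
proof -
  have "(\<Sum>k\<in>coweight_index D. hscale D (of_int (if k = Inl i then n else 0)) (coweight_basis D k))
      = (\<Sum>k\<in>coweight_index D. if k = Inl i then hscale D (of_int n) (\<alpha>v i) else 0)"
    by (intro sum.cong) (auto simp: coweight_basis_def)
  also have "\<dots> = hscale D (of_int n) (\<alpha>v i)"
    by (simp add: coweight_index_def sum.delta InlI)
  finally show ?thesis using L_I[of "\<lambda>k. if k = Inl i then n else 0"] by simp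
qed

lemma coroot_in_L: "\<alpha>v i \<in> L"
  using coroot_multiple_in_L[of 1 i] by simp

lemma K_in_L: "K_exponent D i \<in> L" "- K_exponent D i \<in> L"
  using coroot_multiple_in_L[of "symmetrizer D i" i] coroot_multiple_in_L[of "- symmetrizer D i" i]
  by (simp_all add: K_exponent_def)

lemma L_uminus: "h \<in> L \<Longrightarrow> - h \<in> L"
proof -
  assume "h \<in> L"
  then obtain c where "h = (\<Sum>k\<in>coweight_index D. hscale D (of_int (c k)) (coweight_basis D k))"
    by (rule L_E)
  then have "- h = (\<Sum>k\<in>coweight_index D. hscale D (of_int (- c k)) (coweight_basis D k))"
    by (simp add: sum_negf)
  then show "- h \<in> L" using L_I[of "\<lambda>k. - c k"] by simp
qed

lemma hdual_simps:
  assumes "\<mu> \<in> hdual D"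
  shows "\<mu> (x + y) = \<mu> x + \<mu> y" "\<mu> (hscale D c x) = c * \<mu> x" "\<mu> 0 = 0" "\<mu> (- x) = - \<mu> x"
    "\<mu> (\<Sum>i\<in>A. f i) = (\<Sum>i\<in>A. \<mu> (f i))"
proof -
  have lin: "Vector_Spaces.linear (hscale D) (*) \<mu>" using assms by (simp add: hdual_def)
  show "\<mu> (x + y) = \<mu> x + \<mu> y" "\<mu> (hscale D c x) = c * \<mu> x" "\<mu> 0 = 0"
    "\<mu> (\<Sum>i\<in>A. f i) = (\<Sum>i\<in>A. \<mu> (f i))"
    using linear_add[OF lin] linear_scale[OF lin] linear_0[OF lin] linear_sum[OF lin] by blast+
  show "\<mu> (- x) = - \<mu> x" using linear_diff[OF lin, of 0 x] linear_0[OF lin] by simp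
qed

lemma hdual_iff: "\<mu> \<in> hdual D \<longleftrightarrow> (\<forall>x y. \<mu> (x + y) = \<mu> x + \<mu> y) \<and> (\<forall>c x. \<mu> (hscale D c x) = c * \<mu> x)"
proof -
  have "vector_space ((*) :: complex \<Rightarrow> _)" by unfold_locales (simp_all add: algebra_simps)
  then show ?thesis unfolding hdual_def using hs.vector_space_axioms
    by (simp add: Vector_Spaces.linear_iff)
qed

lemma hdual_diff: "\<mu> \<in> hdual D \<Longrightarrow> \<nu> \<in> hdual D \<Longrightarrow> (\<lambda>h. \<mu> h - c * \<nu> h) \<in> hdual D"
  by (simp add: hdual_iff algebra_simps)

lemma root_in_P: "\<alpha> i \<in> P"
proof -
  have "\<alpha> i h \<in> \<int>" if hL: "h \<in> L" for h
  proof -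
    obtain c where h: "h = (\<Sum>k\<in>coweight_index D. hscale D (of_int (c k)) (coweight_basis D k))"
      using hL by (rule L_E)
    have "\<alpha> i (coweight_basis D k) \<in> \<int>" if "k \<in> coweight_index D" for k
      using that datum unfolding km_datum_def coweight_index_def coweight_basis_def
      by (auto split: sum.split)
    then show ?thesis unfolding h by (simp add: hdual_simps[OF root_hdual] Ints_sum Ints_mult)
  qed
  then show ?thesis using root_hdual by (simp add: weight_lattice_def)
qed

lemma P_hdual: "\<mu> \<in> P \<Longrightarrow> \<mu> \<in> hdual D"
  and P_int: "\<mu> \<in> P \<Longrightarrow> h \<in> L \<Longrightarrow> \<mu> h \<in> \<int>"
  by (auto simp: weight_lattice_def)

lemma P_diff: "\<mu> \<in> P \<Longrightarrow> \<nu> \<in> P \<Longrightarrow> (\<lambda>h. \<mu> h - of_int c * \<nu> h) \<in> P"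
  using hdual_diff[of \<mu> \<nu> "of_int c"] by (auto simp: weight_lattice_def Ints_mult)

lemma P_pairing: "\<mu> \<in> P \<Longrightarrow> \<exists>m::int. \<mu> (\<alpha>v i) = of_int m"
  using P_int[OF _ coroot_in_L, of \<mu> i] by (auto elim: Ints_cases)

lemma refl_P: "\<mu> \<in> P \<Longrightarrow> srefl i \<mu> \<in> P"
proof -
  assume mu: "\<mu> \<in> P"
  then obtain m :: int where "\<mu> (\<alpha>v i) = of_int m" using P_pairing by blast
  then have "srefl i \<mu> = (\<lambda>h. \<mu> h - of_int m * \<alpha> i h)" by (simp add: simple_reflection_def)
  then show ?thesis using P_diff[OF mu root_in_P] by metis
qed

lemma refl_P_iff: "srefl i \<mu> \<in> P \<longleftrightarrow> \<mu> \<in> P"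
  using refl_P[of \<mu> i] refl_P[of "srefl i \<mu>" i] by auto

lemma hdual_eqI:
  assumes "\<mu> \<in> hdual D" "\<nu> \<in> hdual D" "\<And>h. h \<in> L \<Longrightarrow> \<mu> h = \<nu> h"
  shows "\<mu> = \<nu>"
proof
  fix h
  have span: "h \<in> hs.span (coweight_basis D ` coweight_index D)"
    using datum unfolding km_datum_def by simp
  have basis: "coweight_basis D k \<in> L" if k: "k \<in> coweight_index D" for k
  proof -
    have "(\<Sum>j\<in>coweight_index D. hscale D (of_int (if j = k then 1 else 0)) (coweight_basis D j))
      = (\<Sum>j\<in>coweight_index D. if j = k then coweight_basis D k else 0)"
      by (intro sum.cong) auto
    also have "\<dots> = coweight_basis D k" using k by (simp add: sum.delta)
    finally show ?thesis using L_I[of "\<lambda>j. if j = k then 1 else 0"] by simp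
  qed
  show "\<mu> h = \<nu> h"
    using span
  proof (induction rule: hs.span_induct_alt)
    case base
    then show ?case by (simp add: hdual_simps[OF assms(1)] hdual_simps[OF assms(2)])
  next
    case (step c x y)
    then show ?case using assms(3) basis
      by (auto simp: hdual_simps[OF assms(1)] hdual_simps[OF assms(2)])
  qed
qed

lemma P_separated:
  assumes "\<mu> \<in> P" "\<nu> \<in> P" "\<mu> \<noteq> \<nu>"
  shows "\<exists>h\<in>L. \<mu> h \<noteq> \<nu> h"
  using hdual_eqI[OF P_hdual[OF assms(1)] P_hdual[OF assms(2)]] assms(3) by blast

lemma rsum_P:
  assumes "\<mu> \<in> P"
  shows "(\<lambda>h. \<mu> h - rsum (\<lambda>i. real (n i)) h) \<in> P"
proof -
  have "finite A \<Longrightarrow> (\<lambda>h. \<mu> h - (\<Sum>i\<in>A. of_nat (n i) * \<alpha> i h)) \<in> P" for A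
  proof (induction A rule: finite_induct)
    case empty
    then show ?case using assms by simp
  next
    case (insert i A)
    then have "(\<lambda>h. \<mu> h - (\<Sum>i\<in>insert i A. of_nat (n i) * \<alpha> i h)) =
      (\<lambda>h. (\<mu> h - (\<Sum>i\<in>A. of_nat (n i) * \<alpha> i h)) - of_int (int (n i)) * \<alpha> i h)"
      by (simp add: fun_eq_iff)
    then show ?case using P_diff[OF insert.IH root_in_P, of "int (n i)" i] by simp
  qed
  from this[of UNIV] show ?thesis by (simp add: rsum_def)
qed

end

text \<open>The weight is given by the functional \<open>\<Lambda>\<close>, and \<open>v\<close> is
  fixed because \<open>A1_form\<close> is built from a chosen highest weight vector.\<close>

locale highest_weight_rep = kac_moody_datum D for D :: "('i::finite, 'h::ab_group_add) km_datum" +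
  fixes M :: "('i, 'h, 'v::ab_group_add) uq_rep" and \<Lambda> :: "'h \<Rightarrow> complex" and v :: 'v
  assumes uq: "uq_module D M" and Lam: "\<Lambda> \<in> weight_lattice D"
    and hwv: "highest_weight_vector D M (q_weight \<Lambda>) v"
begin

abbreviation "sc \<equiv> vscale M"
abbreviation "E \<equiv> actE M"
abbreviation "F \<equiv> actF M"
abbreviation "Q \<equiv> actQ M"

sublocale vs: vector_space sc
  using uq by (simp add: uq_module_def)

lemma linE: "Vector_Spaces.linear sc sc (E i)"
  and linF: "Vector_Spaces.linear sc sc (F i)"
  and linQ: "h \<in> L \<Longrightarrow> Vector_Spaces.linear sc sc (Q h)"
  and Q_0: "Q 0 x = x"
  and Q_add: "h \<in> L \<Longrightarrow> h' \<in> L \<Longrightarrow> Q (h + h') x = Q h (Q h' x)"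
  using uq by (simp_all add: uq_module_def)

lemma QEQ: "h \<in> L \<Longrightarrow> Q h (E i (Q (- h) x)) = sc (qpow (\<alpha> i h)) (E i x)"
  and QFQ: "h \<in> L \<Longrightarrow> Q h (F i (Q (- h) x)) = sc (qpow (- \<alpha> i h)) (F i x)"
  using uq by (simp_all add: uq_module_def)

lemma EF: "E i (F j x) - F j (E i x) =
  (if i = j then sc (1 / (q_i D i - inverse (q_i D i))) (Q (K_exponent D i) x - Q (- K_exponent D i) x) else 0)"
  using uq unfolding uq_module_def by (elim conjE) simp

lemma serreF: "i \<noteq> j \<Longrightarrow> n = nat (1 - a i j) \<Longrightarrow>
  (\<Sum>r\<le>n. sc ((-1) ^ r * qbinom (q_i D i) n r) ((F i ^^ (n - r)) (F j ((F i ^^ r) x)))) = 0"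
  using uq unfolding uq_module_def quantum_serre_def by (elim conjE) (simp add: Let_def)

lemma v_neq_0: "v \<noteq> 0" and E_v: "E i v = 0"
  and v_gen: "uq_submodule D M S \<Longrightarrow> v \<in> S \<Longrightarrow> S = UNIV"
  using hwv by (simp_all add: highest_weight_vector_def)

section \<open>Weight spaces and their spanning words\<close>

definition W :: "('h \<Rightarrow> complex) \<Rightarrow> 'v set"
  where "W \<mu> = {x. \<forall>h\<in>L. Q h x = sc (qpow (\<mu> h)) x}"

lemma weight_space_W: "weight_space D M (q_weight \<mu>) = W \<mu>"
  by (simp add: weight_space_def W_def q_weight_def)

lemma v_in_W: "v \<in> W \<Lambda>"
  using hwv by (simp add: highest_weight_vector_def weight_space_W)

lemma W_D: "x \<in> W \<mu> \<Longrightarrow> h \<in> L \<Longrightarrow> Q h x = sc (qpow (\<mu> h)) x"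
  by (simp add: W_def)

lemma W_subspace: "vs.subspace (W \<mu>)"
  unfolding W_def
  by (rule vs.subspaceI)
    (simp_all add: linear_0[OF linQ] linear_add[OF linQ] linear_scale[OF linQ] vs.scale_right_distrib mult.commute)

lemma Q_inv: "h \<in> L \<Longrightarrow> Q (- h) (Q h x) = x"
  using Q_add[of "- h" h x] by (simp add: L_uminus Q_0)

lemma QE: "h \<in> L \<Longrightarrow> Q h (E i x) = sc (qpow (\<alpha> i h)) (E i (Q h x))"
  and QF: "h \<in> L \<Longrightarrow> Q h (F i x) = sc (qpow (- \<alpha> i h)) (F i (Q h x))"
  using QEQ[of h i "Q h x"] QFQ[of h i "Q h x"] by (simp_all add: Q_inv)

lemma E_W: "\<mu> \<in> P \<Longrightarrow> x \<in> W \<mu> \<Longrightarrow> E i x \<in> W (\<lambda>h. \<mu> h + \<alpha> i h)"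
  by (simp add: W_def QE linear_scale[OF linE] qpow_add P_int root_in_P mult.commute)

lemma F_W: "\<mu> \<in> P \<Longrightarrow> x \<in> W \<mu> \<Longrightarrow> F i x \<in> W (\<lambda>h. \<mu> h - \<alpha> i h)"
proof -
  assume *: "\<mu> \<in> P" "x \<in> W \<mu>"
  have "qpow (\<mu> h - \<alpha> i h) = qpow (- \<alpha> i h) * qpow (\<mu> h)" if "h \<in> L" for h
    using qpow_add[of "- \<alpha> i h" "\<mu> h"] P_int[OF *(1) that] P_int[OF root_in_P that, of i] by simp
  then show ?thesis using *
    by (simp add: W_def QF linear_scale[OF linF])
qed

lemma Epow_W: "\<mu> \<in> P \<Longrightarrow> x \<in> W \<mu> \<Longrightarrow> (E i ^^ n) x \<in> W (\<lambda>h. \<mu> h + of_nat n * \<alpha> i h)"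
proof (induction n)
  case (Suc n)
  have P: "(\<lambda>h. \<mu> h + of_nat n * \<alpha> i h) \<in> P"
    using P_diff[OF Suc.prems(1) root_in_P, of "- int n"] by simp
  show ?case using E_W[OF P Suc.IH[OF Suc.prems], of i] by (simp add: algebra_simps)
qed simp

lemma Fpow_W: "\<mu> \<in> P \<Longrightarrow> x \<in> W \<mu> \<Longrightarrow> (F i ^^ n) x \<in> W (\<lambda>h. \<mu> h - of_nat n * \<alpha> i h)"
proof (induction n)
  case (Suc n)
  have P: "(\<lambda>h. \<mu> h - of_nat n * \<alpha> i h) \<in> P"
    using P_diff[OF Suc.prems(1) root_in_P, of "int n"] by simp
  show ?case using F_W[OF P Suc.IH[OF Suc.prems], of i] by (simp add: algebra_simps)
qed simp

text \<open>Independence of eigenvectors: \<open>Q h\<close> minus its eigenvalue on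
  \<open>W \<nu>\<close> removes the term of \<open>\<nu>\<close>. The separating h is chosen anew
  for each remaining weight.\<close>

lemma weight_independent:
  assumes "finite N" "N \<subseteq> P" "\<And>\<mu>. \<mu> \<in> N \<Longrightarrow> x \<mu> \<in> W \<mu>" "(\<Sum>\<mu>\<in>N. x \<mu>) = 0"
  shows "\<forall>\<mu>\<in>N. x \<mu> = 0"
  using assms
proof (induction N arbitrary: x rule: finite_induct)
  case (insert \<nu> N)
  have xN: "x \<mu> = 0" if \<mu>: "\<mu> \<in> N" for \<mu>
  proof -
    have "\<mu> \<noteq> \<nu>" using \<mu> insert.hyps by blast
    then obtain h where h: "h \<in> L" "\<mu> h \<noteq> \<nu> h" using P_separated[of \<mu> \<nu>] insert.prems(1) \<mu> by auto
    define y where "y \<kappa> = sc (qpow (\<kappa> h) - qpow (\<nu> h)) (x \<kappa>)" for \<kappa>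
    have "(\<Sum>\<kappa>\<in>insert \<nu> N. y \<kappa>) = (\<Sum>\<kappa>\<in>insert \<nu> N. Q h (x \<kappa>)) - sc (qpow (\<nu> h)) (\<Sum>\<kappa>\<in>insert \<nu> N. x \<kappa>)"
      unfolding y_def vs.scale_sum_right sum_subtractf[symmetric]
      by (intro sum.cong) (auto simp: vs.scale_left_diff_distrib W_D[OF insert.prems(2) h(1)])
    also have "\<dots> = Q h (\<Sum>\<kappa>\<in>insert \<nu> N. x \<kappa>) - sc (qpow (\<nu> h)) (\<Sum>\<kappa>\<in>insert \<nu> N. x \<kappa>)"
      by (simp only: linear_sum[OF linQ[OF h(1)]])
    also have "\<dots> = 0" unfolding insert.prems(3) by (simp add: linear_0[OF linQ[OF h(1)]])
    finally have "(\<Sum>\<kappa>\<in>insert \<nu> N. y \<kappa>) = 0" .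
    moreover have "y \<nu> = 0" by (simp add: y_def)
    ultimately have sum0: "(\<Sum>\<kappa>\<in>N. y \<kappa>) = 0" using insert.hyps by simp
    have "y \<mu> = 0"
    proof -
      have "\<And>\<kappa>. \<kappa> \<in> N \<Longrightarrow> y \<kappa> \<in> W \<kappa>"
        unfolding y_def using insert.prems(2) vs.subspace_scale[OF W_subspace] by blast
      then show ?thesis using insert.IH[of y] insert.prems(1) sum0 \<mu> by blast
    qed
    moreover have "qpow (\<mu> h) - qpow (\<nu> h) \<noteq> 0"
      using h qpow_inj[of "\<mu> h" "\<nu> h"] insert.prems(1) \<mu> P_int by auto
    ultimately show ?thesis unfolding y_def by simp
  qed
  then have "(\<Sum>\<mu>\<in>N. x \<mu>) = 0" by simp
  then show ?case using xN insert by simp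
qed simp

definition word_vec :: "'i list \<Rightarrow> 'v"
  where "word_vec w = foldr F w v"

lemma word_vec_simps [simp]: "word_vec [] = v" "word_vec (i # w) = F i (word_vec w)"
  by (simp_all add: word_vec_def)

text \<open>Coordinates for weights below \<open>\<Lambda>\<close>; \<open>low_inj\<close> turns
  equations between functionals into equations between natural numbers.\<close>

definition low :: "('i \<Rightarrow> nat) \<Rightarrow> 'h \<Rightarrow> complex"
  where "low n = (\<lambda>h. \<Lambda> h - rsum (\<lambda>i. real (n i)) h)"

definition word_weight :: "'i list \<Rightarrow> 'h \<Rightarrow> complex"
  where "word_weight w = low (count_list w)"

lemma low_P: "low n \<in> P"
  unfolding low_def by (rule rsum_P[OF Lam])

lemma word_weight_P: "word_weight w \<in> P"
  by (simp add: word_weight_def low_P)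

lemma low_inj: "low m = low n \<longleftrightarrow> m = n"
proof
  assume "low m = low n"
  then have "rsum (\<lambda>i. real (m i)) = rsum (\<lambda>i. real (n i))"
    by (simp add: low_def fun_eq_iff)
  then show "m = n" unfolding rsum_inj by (simp add: fun_eq_iff)
qed simp

lemma low_0: "low (\<lambda>_. 0) = \<Lambda>"
  by (simp add: low_def rsum_simps)

lemma low_add: "low (\<lambda>k. n k + (if k = i then m else 0)) = (\<lambda>h. low n h - of_nat m * \<alpha> i h)"
proof
  fix h
  have eq: "(\<lambda>k. real (n k + (if k = i then m else 0))) = (\<lambda>k. real (n k) + (if k = i then real m else 0))"
    by auto
  show "low (\<lambda>k. n k + (if k = i then m else 0)) h = low n h - of_nat m * \<alpha> i h"
    unfolding low_def eq rsum_simps rsum_unit by simp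
qed

lemma word_weight_Nil: "word_weight [] = \<Lambda>"
proof -
  have "count_list [] = (\<lambda>_::'i. 0)" by auto
  then show ?thesis unfolding word_weight_def by (simp only: low_0)
qed

lemma word_weight_Cons: "word_weight (i # w) = (\<lambda>h. word_weight w h - \<alpha> i h)"
proof -
  have "count_list (i # w) = (\<lambda>k. count_list w k + (if k = i then 1 else 0))" by auto
  then show ?thesis unfolding word_weight_def by (simp only: low_add) simp
qed

lemma word_vec_W: "word_vec w \<in> W (word_weight w)"
  by (induction w) (simp_all add: v_in_W word_weight_Nil word_weight_Cons F_W word_weight_P)

lemma span_closed:
  assumes f: "Vector_Spaces.linear sc sc f" and g: "\<And>w. f (word_vec w) \<in> vs.span (range word_vec)"
    and x: "x \<in> vs.span (range word_vec)"
  shows "f x \<in> vs.span (range word_vec)"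
  using x
proof (induction rule: vs.span_induct_alt)
  case base
  then show ?case by (simp add: linear_0[OF f] vs.span_zero)
next
  case (step c y z)
  then show ?case using g
    by (auto simp: linear_add[OF f] linear_scale[OF f] intro!: vs.span_add vs.span_scale)
qed

lemma F_word_vec_span: "x \<in> vs.span (range word_vec) \<Longrightarrow> F i x \<in> vs.span (range word_vec)"
  by (rule span_closed[OF linF]) (auto intro!: vs.span_base simp flip: word_vec_simps(2))

lemma E_word_vec: "E i (word_vec w) \<in> vs.span (range word_vec)"
proof (induction w)
  case Nil
  then show ?case by (simp add: E_v vs.span_zero)
next
  case (Cons j w)
  have b: "word_vec w \<in> vs.span (range word_vec)" by (intro vs.span_base) simp
  have "E i (word_vec (j # w)) = F j (E i (word_vec w)) + (E i (F j (word_vec w)) - F j (E i (word_vec w)))" by simp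
  also have "\<dots> \<in> vs.span (range word_vec)"
    unfolding EF using F_word_vec_span[OF Cons.IH] b
    by (auto simp: W_D[OF word_vec_W] K_in_L intro!: vs.span_add vs.span_scale vs.span_diff vs.span_zero)
  finally show ?case .
qed

text \<open>Plays the role of the triangular decomposition: the span of the \<open>F\<close>-words
  is stable under all generators and contains \<open>v\<close>.\<close>

lemma span_word_vec: "vs.span (range word_vec) = UNIV"
proof (rule v_gen)
  have "v \<in> range word_vec" using word_vec_simps(1) by (metis rangeI)
  then show "v \<in> vs.span (range word_vec)" by (rule vs.span_base)
  have "Q h x \<in> vs.span (range word_vec)" if "h \<in> L" "x \<in> vs.span (range word_vec)" for h x
    using span_closed[OF linQ[OF that(1)] _ that(2)]
    by (simp add: W_D[OF word_vec_W that(1)] vs.span_scale vs.span_base)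
  then show "uq_submodule D M (vs.span (range word_vec))"
    unfolding uq_submodule_def
    using span_closed[OF linE] E_word_vec F_word_vec_span vs.subspace_span by blast
qed

lemma explicit: "\<exists>S c. finite S \<and> x = (\<Sum>w\<in>S. sc (c w) (word_vec w))"
  by (rule vs.span_range_explicit) (simp add: span_word_vec)

text \<open>Grouping the words by weight on the union of all weights involved reduces this to
  independence. The coefficients c survive unchanged, so regularity or vanishing at q = 1 passes to
  the components.\<close>

lemma components:
  assumes "finite N" "N \<subseteq> P" "\<And>\<mu>. \<mu> \<in> N \<Longrightarrow> x \<mu> \<in> W \<mu>"
    and S: "finite S" "(\<Sum>\<mu>\<in>N. x \<mu>) = (\<Sum>w\<in>S. sc (c w) (word_vec w))" and \<mu>: "\<mu> \<in> N"
  shows "x \<mu> = (\<Sum>w | w \<in> S \<and> word_weight w = \<mu>. sc (c w) (word_vec w))"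
proof -
  define N' where "N' = N \<union> word_weight ` S"
  define y where "y \<nu> = (if \<nu> \<in> N then x \<nu> else 0) - (\<Sum>w | w \<in> S \<and> word_weight w = \<nu>. sc (c w) (word_vec w))" for \<nu>
  have "y \<nu> \<in> W \<nu>" for \<nu>
    unfolding y_def
  proof (intro vs.subspace_diff[OF W_subspace] vs.subspace_sum[OF W_subspace] vs.subspace_scale[OF W_subspace])
    show "(if \<nu> \<in> N then x \<nu> else 0) \<in> W \<nu>" using assms(3) vs.subspace_0[OF W_subspace] by simp
    show "word_vec w \<in> W \<nu>" if "w \<in> {w \<in> S. word_weight w = \<nu>}" for w using that word_vec_W[of w] by auto
  qed
  moreover have "(\<Sum>\<nu>\<in>N'. y \<nu>) = 0"
  proof -
    have "(\<Sum>\<nu>\<in>N'. if \<nu> \<in> N then x \<nu> else 0) = (\<Sum>\<nu>\<in>N. x \<nu>)"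
      using assms(1) S(1) unfolding N'_def by (simp add: sum.If_cases Int_absorb1)
    moreover have "(\<Sum>\<nu>\<in>N'. \<Sum>w | w \<in> S \<and> word_weight w = \<nu>. sc (c w) (word_vec w)) = (\<Sum>w\<in>S. sc (c w) (word_vec w))"
      using sum.group[of S N' word_weight "\<lambda>w. sc (c w) (word_vec w)"] assms(1) S(1) unfolding N'_def by simp
    ultimately show ?thesis unfolding y_def sum_subtractf using S(2) by simp
  qed
  ultimately have "y \<mu> = 0"
    using weight_independent[of N' y] assms(1,2) S(1) \<mu> word_weight_P unfolding N'_def by blast
  then show ?thesis using \<mu> unfolding y_def by simp
qed

lemma W_explicit:
  assumes "\<mu> \<in> P" "x \<in> W \<mu>"
  shows "\<exists>S c. finite S \<and> (\<forall>w\<in>S. word_weight w = \<mu>) \<and> x = (\<Sum>w\<in>S. sc (c w) (word_vec w))"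
proof -
  obtain S c where S: "finite S" "x = (\<Sum>w\<in>S. sc (c w) (word_vec w))" using explicit by blast
  have "x = (\<Sum>w | w \<in> S \<and> word_weight w = \<mu>. sc (c w) (word_vec w))"
    using components[of "{\<mu>}" "\<lambda>_. x" S c \<mu>] S assms by simp
  then show ?thesis using S(1)
    by (intro exI[of _ "{w\<in>S. word_weight w = \<mu>}"] exI[of _ c]) simp
qed

lemma W_span: "\<mu> \<in> P \<Longrightarrow> W \<mu> = vs.span (word_vec ` {w. word_weight w = \<mu>})"
proof (intro equalityI subsetI)
  fix x assume "\<mu> \<in> P" "x \<in> W \<mu>"
  then obtain S c where "finite S" "\<forall>w\<in>S. word_weight w = \<mu>" "x = (\<Sum>w\<in>S. sc (c w) (word_vec w))"
    using W_explicit by blast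
  then show "x \<in> vs.span (word_vec ` {w. word_weight w = \<mu>})"
    by simp (intro vs.span_sum vs.span_scale vs.span_base, auto)
next
  fix x assume "x \<in> vs.span (word_vec ` {w. word_weight w = \<mu>})"
  then show "x \<in> W \<mu>"
    using vs.span_minimal[OF _ W_subspace, of "word_vec ` {w. word_weight w = \<mu>}" \<mu>] word_vec_W by blast
qed

text \<open>A weight fixes the number of occurrences of each letter, hence the length of the word
  over a finite alphabet.\<close>

lemma finite_word_weight: "finite {w. word_weight w = \<mu>}"
proof (cases "{w. word_weight w = \<mu>} = {}")
  case False
  then obtain u where u: "word_weight u = \<mu>" by blast
  have "length w = length u" if "word_weight w = \<mu>" for w
    using that u sum_count_set[of w UNIV] sum_count_set[of u UNIV]
    unfolding word_weight_def by (metis low_inj finite subset_UNIV)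
  then have "{w. word_weight w = \<mu>} \<subseteq> {w. set w \<subseteq> UNIV \<and> length w = length u}" by auto
  then show ?thesis by (rule finite_subset) (rule finite_lists_length_eq, simp)
qed simp

definition Wt :: "('h \<Rightarrow> complex) set"
  where "Wt = {\<mu> \<in> P. W \<mu> \<noteq> {0}}"

lemma Wt_I: "\<mu> \<in> P \<Longrightarrow> x \<in> W \<mu> \<Longrightarrow> x \<noteq> 0 \<Longrightarrow> \<mu> \<in> Wt"
  by (auto simp: Wt_def)

lemma Wt_word: "\<mu> \<in> Wt \<Longrightarrow> \<exists>w. word_vec w \<noteq> 0 \<and> word_weight w = \<mu>"
proof -
  assume mu: "\<mu> \<in> Wt"
  then obtain x where x: "x \<in> W \<mu>" "x \<noteq> 0" "\<mu> \<in> P"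
    using vs.subspace_0[OF W_subspace] unfolding Wt_def by blast
  obtain S c where S: "\<forall>w\<in>S. word_weight w = \<mu>" "x = (\<Sum>w\<in>S. sc (c w) (word_vec w))"
    using W_explicit[OF x(3,1)] by blast
  have "(\<Sum>w\<in>S. sc (c w) (word_vec w)) \<noteq> 0" using x(2) S(2) by simp
  then obtain w where "w \<in> S" "sc (c w) (word_vec w) \<noteq> 0"
    by (rule sum.not_neutral_contains_not_neutral)
  then show ?thesis using S(1) by auto
qed

lemma word_Wt: "word_vec w \<noteq> 0 \<Longrightarrow> word_weight w \<in> Wt"
  using Wt_I[OF word_weight_P word_vec_W] .

lemma Lam_Wt: "\<Lambda> \<in> Wt"
  using word_Wt[of "[]"] by (simp add: v_neq_0 word_weight_Nil)

lemma Wt_low: "\<mu> \<in> Wt \<Longrightarrow> \<exists>n. \<mu> = low n"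
  using Wt_word unfolding word_weight_def by blast

lemma W_zero: "\<mu> \<in> P \<Longrightarrow> \<mu> \<notin> Wt \<Longrightarrow> x \<in> W \<mu> \<Longrightarrow> x = 0"
  by (auto simp: Wt_def)

lemma character_W: "\<mu> \<in> P \<Longrightarrow> character D M \<mu> = vs.dim (W \<mu>)"
  by (simp add: character_def weight_space_W)

lemma character_Wt: "character D M \<mu> \<noteq> 0 \<longleftrightarrow> \<mu> \<in> Wt"
proof (cases "\<mu> \<in> P")
  case True
  have "vs.dim (W \<mu>) = 0 \<longleftrightarrow> W \<mu> = {0}"
    by (rule vs.dim_eq_0_iff_trivial[OF W_subspace, of _ "word_vec ` {w. word_weight w = \<mu>}"])
      (use True W_span finite_word_weight in auto)
  then show ?thesis using True by (simp add: character_W Wt_def)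
qed (simp add: character_def Wt_def)

section \<open>The quantum sl2 attached to a simple root\<close>

text \<open>Eigenspaces of \<open>K_i\<close> alone, with eigenvalue \<open>q_i\<close> to the power
  n; coarser than weight spaces, but all that the rank one arguments see.\<close>

definition U :: "'i \<Rightarrow> int \<Rightarrow> 'v set"
  where "U i n = {x. Q (K_exponent D i) x = sc (qvar powi (symmetrizer D i * n)) x}"

lemma hdual_K: "\<mu> \<in> hdual D \<Longrightarrow> \<mu> (\<alpha>v i) = of_int m \<Longrightarrow> \<mu> (K_exponent D i) = of_int (symmetrizer D i * m)"
  by (simp add: K_exponent_def hdual_simps)

lemma W_U: "\<mu> \<in> P \<Longrightarrow> \<mu> (\<alpha>v i) = of_int m \<Longrightarrow> x \<in> W \<mu> \<Longrightarrow> x \<in> U i m"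
  using hdual_K[OF P_hdual, of \<mu> i m] W_D[OF _ K_in_L(1), of x \<mu> i] unfolding U_def
  by (simp only: qpow_of_int mem_Collect_eq)

lemma U_minus_K:
  assumes "x \<in> U i n"
  shows "Q (- K_exponent D i) x = sc (qvar powi (- (symmetrizer D i * n))) x"
proof -
  let ?c = "qvar powi (symmetrizer D i * n)"
  have "x = Q (- K_exponent D i) (Q (K_exponent D i) x)" using Q_inv[OF K_in_L(1)] by simp
  also have "\<dots> = sc ?c (Q (- K_exponent D i) x)"
    using assms linear_scale[OF linQ[OF K_in_L(2)]] unfolding U_def by simp
  finally have "sc (inverse ?c) x = sc (inverse ?c * ?c) (Q (- K_exponent D i) x)"
    by (metis vs.scale_scale)
  then show ?thesis using qvar_neq by (simp add: power_int_minus)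
qed

lemma U_subspace: "vs.subspace (U i n)"
  unfolding U_def
  by (rule vs.subspaceI)
    (simp_all add: linear_0[OF linQ] linear_add[OF linQ] linear_scale[OF linQ] K_in_L
      vs.scale_right_distrib mult.commute)

lemma E_U: "x \<in> U i n \<Longrightarrow> E i x \<in> U i (n + 2)"
proof -
  assume x: "x \<in> U i n"
  have "qpow (\<alpha> i (K_exponent D i)) = qvar powi (symmetrizer D i * 2)"
    using hdual_K[OF root_hdual, of i i 2] by (simp only: qpow_of_int root_coroot cartan_diag)
  then have "Q (K_exponent D i) (E i x) = sc (qvar powi (symmetrizer D i * 2)) (E i (Q (K_exponent D i) x))"
    using QE[OF K_in_L(1)] by simp
  also have "\<dots> = sc (qvar powi (symmetrizer D i * 2) * qvar powi (symmetrizer D i * n)) (E i x)"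
    using x unfolding U_def by (simp add: linear_scale[OF linE])
  also have "qvar powi (symmetrizer D i * 2) * qvar powi (symmetrizer D i * n)
      = qvar powi (symmetrizer D i * (n + 2))"
    using qvar_neq by (simp add: distrib_left add.commute flip: power_int_add)
  finally show ?thesis by (simp add: U_def)
qed

lemma F_U: "x \<in> U i n \<Longrightarrow> F i x \<in> U i (n - 2)"
proof -
  assume x: "x \<in> U i n"
  have "qpow (- \<alpha> i (K_exponent D i)) = qvar powi (symmetrizer D i * (-2))"
    using hdual_K[OF root_hdual, of i i 2] by (simp only: qpow_of_int root_coroot cartan_diag flip: of_int_minus) simp
  then have "Q (K_exponent D i) (F i x) = sc (qvar powi (symmetrizer D i * (-2))) (F i (Q (K_exponent D i) x))"
    using QF[OF K_in_L(1)] by simp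
  also have "\<dots> = sc (qvar powi (symmetrizer D i * (-2)) * qvar powi (symmetrizer D i * n)) (F i x)"
    using x unfolding U_def by (simp add: linear_scale[OF linF])
  also have "qvar powi (symmetrizer D i * (-2)) * qvar powi (symmetrizer D i * n)
      = qvar powi (symmetrizer D i * (n - 2))"
    using qvar_neq by (simp add: right_diff_distrib add.commute flip: power_int_add)
  finally show ?thesis by (simp add: U_def)
qed

lemma EF_U: "x \<in> U i n \<Longrightarrow> E i (F i x) = F i (E i x) + sc (qbracket (symmetrizer D i) n) x"
proof -
  assume x: "x \<in> U i n"
  have "E i (F i x) - F i (E i x) = sc (qbracket (symmetrizer D i) n) x"
    unfolding EF U_minus_K[OF x] using x
    by (simp add: U_def qbracket_def q_i_def power_int_minus flip: vs.scale_left_diff_distrib)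
  then show ?thesis by (simp add: algebra_simps)
qed

lemma sl2: "quantum_sl2 sc (E i) (F i) (U i) (qbracket (symmetrizer D i))"
  by unfold_locales (simp_all add: linE linF U_subspace E_U F_U EF_U at1_qbracket symm_pos
      linear_add[OF linE] linear_scale[OF linE] linear_add[OF linF] linear_scale[OF linF])

text \<open>Exchanging \<open>E\<close> and \<open>F\<close> reverses the commutator, and [-n] =
  -[n] restores its sign in the negated grading.\<close>

lemma sl2_opposite: "quantum_sl2 sc (F i) (E i) (\<lambda>n. U i (- n)) (qbracket (symmetrizer D i))"
proof unfold_locales
  fix x n assume x: "x \<in> U i (- n)"
  have "qbracket (symmetrizer D i) (- n) = - qbracket (symmetrizer D i) n"
    by (simp add: qbracket_def minus_divide_left)
  then show "F i (E i x) = E i (F i x) + sc (qbracket (symmetrizer D i) n) x"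
    using EF_U[OF x] by simp
  show "E i x \<in> U i (- (n - 2))" "F i x \<in> U i (- (n + 2))"
    using E_U[OF x] F_U[OF x] by (simp_all add: algebra_simps)
qed (simp_all add: linE linF U_subspace at1_qbracket symm_pos
    linear_add[OF linE] linear_scale[OF linE] linear_add[OF linF] linear_scale[OF linF])

lemma locally_nilpotentI:
  assumes f: "Vector_Spaces.linear sc sc f" and g: "\<And>w. \<exists>p. (f ^^ p) (word_vec w) = 0"
  shows "\<exists>p. (f ^^ p) x = 0"
proof -
  have "vs.span (range word_vec) \<subseteq> {x. \<exists>p. (f ^^ p) x = 0}"
    using g by (intro vs.span_minimal vs.subspace_locally_nilpotent[OF f]) auto
  then show ?thesis using span_word_vec by auto
qed

text \<open>Raising a word by \<open>\<alpha> i\<close> more often than the letter i occurs in it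
  would make a coordinate below \<open>\<Lambda>\<close> negative.\<close>

lemma E_nilpotent: "\<exists>p. (E i ^^ p) x = 0"
proof (rule locally_nilpotentI[OF linE])
  fix w
  define p where "p = Suc (count_list w i)"
  let ?\<mu> = "\<lambda>h. word_weight w h + of_nat p * \<alpha> i h"
  have P: "?\<mu> \<in> P" using P_diff[OF word_weight_P root_in_P, of w "- int p" i] by simp
  have "?\<mu> \<notin> Wt"
  proof
    assume "?\<mu> \<in> Wt"
    then obtain n where n: "?\<mu> = low n" using Wt_low by blast
    then have "low (count_list w) = (\<lambda>h. low n h - of_nat p * \<alpha> i h)"
      unfolding word_weight_def by (simp add: fun_eq_iff algebra_simps)
    then have "count_list w = (\<lambda>k. n k + (if k = i then p else 0))"
      unfolding low_add[symmetric] low_inj .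
    then have "count_list w i = n i + p" by simp
    then show False by (simp add: p_def)
  qed
  then have "(E i ^^ p) (word_vec w) = 0" using W_zero[OF P] Epow_W[OF word_weight_P word_vec_W] by blast
  then show "\<exists>p. (E i ^^ p) (word_vec w) = 0" by blast
qed

section \<open>Integrability\<close>

text \<open>A condition on the single vector \<open>v\<close>; \<open>F_nilpotent\<close> extends it
  to the whole module and \<open>integrability_J\<close> identifies it with
  \<open>integrability\<close>.\<close>

definition J :: "'i set"
  where "J = {i. \<exists>N. (F i ^^ N) v = 0}"

lemmas linE_pow = funpow_linear[OF vs.vector_space_axioms linE]
lemmas linF_pow = funpow_linear[OF vs.vector_space_axioms linF]

text \<open>Each factor [k] has the nonzero value k at q = 1.\<close>

lemma qfact_neq_0: "qfact (q_i D i) n \<noteq> 0"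
proof -
  have "qint (q_i D i) k \<noteq> 0" if "k \<ge> 1" for k
  proof -
    have "qint (q_i D i) k = qbracket (symmetrizer D i) (int k)"
      by (simp only: qint_def qbracket_def q_i_def power_int_minus power_int_mult)
    then show ?thesis using at1_nonzero[OF at1_qbracket[OF symm_pos, of i "int k"]] that by simp
  qed
  then show ?thesis by (simp add: qfact_def)
qed

text \<open>The Serre relation solved for its term r = 0, whose quantum binomial coefficient is
  1.\<close>

lemma serre_rewrite:
  assumes "i \<noteq> j" "n = nat (1 - a i j)"
  shows "(F i ^^ n) (F j y) = (\<Sum>r\<in>{1..n}.
    sc (- ((-1) ^ r * qbinom (q_i D i) n r)) ((F i ^^ (n - r)) (F j ((F i ^^ r) y))))"
proof -
  let ?t = "\<lambda>r. sc ((-1) ^ r * qbinom (q_i D i) n r) ((F i ^^ (n - r)) (F j ((F i ^^ r) y)))"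
  have "{..n} = insert 0 {1..n}" by auto
  then have "(\<Sum>r\<le>n. ?t r) = ?t 0 + (\<Sum>r\<in>{1..n}. ?t r)" by simp
  moreover have "?t 0 = (F i ^^ n) (F j y)"
    using qfact_neq_0[of i n] by (simp add: qbinom_def qfact_def)
  ultimately have "(F i ^^ n) (F j y) = - (\<Sum>r\<in>{1..n}. ?t r)"
    using serreF[OF assms, of y] by (simp add: eq_neg_iff_add_eq_0)
  then show ?thesis by (simp only: sum_negf[symmetric] vs.scale_minus_left)
qed

lemma F_commute:
  assumes "i \<noteq> j" "a i j = 0"
  shows "F i (F j y) = F j (F i y)"
proof -
  have "qbinom (q_i D i) 1 1 = 1"
    using qfact_neq_0[of i 1] by (simp add: qbinom_def qfact_def)
  then show ?thesis using serre_rewrite[OF assms(1), of 1 y] assms(2) by simp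
qed

text \<open>The Serre relation trades powers of \<open>F i\<close> on the left of \<open>F j\<close> for powers on its right.\<close>

lemma nilpotent_F:
  assumes nil: "(F i ^^ N) x = 0"
  shows "\<exists>p. (F i ^^ p) (F j x) = 0"
proof (cases "i = j")
  case True
  have "(F i ^^ Suc N) x = 0" using nil linear_0[OF linF] by simp
  then have "(F i ^^ N) (F i x) = 0" by (simp add: funpow_swap1)
  then show ?thesis using True by blast
next
  case False
  define n where "n = nat (1 - a i j)"
  \<comment> \<open>A rewriting step lowers p by some r from 1 to n and raises b by the same r, so
    the bound on p + b persists. It is applicable because b < N forces p > n.\<close>
  have "(F i ^^ p) (F j ((F i ^^ b) x)) = 0" if "p + b \<ge> N + n" for p b
    using that
  proof (induction p arbitrary: b rule: less_induct)
    case (less p)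
    show ?case
    proof (cases "b \<ge> N")
      case True
      then have "(F i ^^ b) x = (F i ^^ (b - N)) ((F i ^^ N) x)"
        by (metis comp_apply funpow_add le_add_diff_inverse2)
      then show ?thesis using nil by (simp add: linear_0[OF linF] linear_0[OF linF_pow])
    next
      case b: False
      then have p: "p = (p - n) + n" using less.prems by simp
      have "(F i ^^ p) (F j ((F i ^^ b) x)) = (F i ^^ (p - n)) ((F i ^^ n) (F j ((F i ^^ b) x)))"
        by (subst p) (simp add: funpow_add)
      also have "\<dots> = (\<Sum>r\<in>{1..n}. sc (- ((-1) ^ r * qbinom (q_i D i) n r))
          ((F i ^^ (p - n)) ((F i ^^ (n - r)) (F j ((F i ^^ r) ((F i ^^ b) x))))))"
        unfolding serre_rewrite[OF False n_def] linear_sum[OF linF_pow] linear_scale[OF linF_pow] ..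
      also have "\<dots> = (\<Sum>r\<in>{1..n}. 0)"
      proof (intro sum.cong refl)
        fix r assume r: "r \<in> {1..n}"
        have eq: "(F i ^^ (p - n)) ((F i ^^ (n - r)) (F j ((F i ^^ r) ((F i ^^ b) x))))
            = (F i ^^ ((p - n) + (n - r))) (F j ((F i ^^ (r + b)) x))"
          by (simp add: funpow_add)
        have "(F i ^^ ((p - n) + (n - r))) (F j ((F i ^^ (r + b)) x)) = 0"
          using r p less.prems by (intro less.IH) auto
        then show "sc (- ((-1) ^ r * qbinom (q_i D i) n r))
          ((F i ^^ (p - n)) ((F i ^^ (n - r)) (F j ((F i ^^ r) ((F i ^^ b) x))))) = 0"
          unfolding eq by simp
      qed
      finally show ?thesis by simp
    qed
  qed
  from this[of "N + n" 0] show ?thesis by auto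
qed

lemma F_nilpotent: "i \<in> J \<Longrightarrow> \<exists>p. (F i ^^ p) x = 0"
proof (rule locally_nilpotentI[OF linF])
  fix w assume i: "i \<in> J"
  show "\<exists>p. (F i ^^ p) (word_vec w) = 0"
  proof (induction w)
    case Nil
    then show ?case using i by (simp add: J_def)
  next
    case (Cons j w)
    then show ?case using nilpotent_F by auto
  qed
qed

lemma J_pairing:
  assumes "i \<in> J"
  shows "\<exists>m::nat. \<Lambda> (\<alpha>v i) = of_nat m \<and> (F i ^^ (m + 1)) v = 0"
proof -
  obtain m :: int where m: "\<Lambda> (\<alpha>v i) = of_int m" using P_pairing[OF Lam] by blast
  obtain N where N: "(F i ^^ N) v = 0" using assms by (auto simp: J_def)
  have "m \<ge> 0 \<and> (F i ^^ nat (m + 1)) v = 0"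
    by (rule quantum_sl2.highest_weight_nilpotent[OF sl2 W_U[OF Lam m v_in_W] v_neq_0 E_v N])
  then show ?thesis using m by (intro exI[of _ "nat m"]) (auto simp: nat_add_distrib)
qed

text \<open>For m >= 0, injectivity of \<open>F i ^^ nat m\<close> uses nilpotence of
  \<open>E i\<close>, which always holds. For m < 0 the opposite triple needs nilpotence of
  \<open>F i\<close>, and this is where \<open>i \<in> J\<close> enters.\<close>

lemma refl_dim_le:
  assumes i: "i \<in> J" and mu: "\<mu> \<in> P"
  shows "vs.dim (W \<mu>) \<le> vs.dim (W (srefl i \<mu>))"
proof -
  obtain m :: int where m: "\<mu> (\<alpha>v i) = of_int m" using P_pairing[OF mu] by blast
  have smu: "srefl i \<mu> \<in> P" using refl_P[OF mu] .
  note fin = W_span[OF smu, THEN equalityD1] finite_imageI[OF finite_word_weight]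
  show ?thesis
  proof (cases "m \<ge> 0")
    case True
    have eq: "srefl i \<mu> = (\<lambda>h. \<mu> h - of_nat (nat m) * \<alpha> i h)"
      using m True by (simp add: simple_reflection_def)
    show ?thesis
    proof (rule vs.dim_le_injective[OF linF_pow _ _ W_subspace fin])
      show "(F i ^^ nat m) ` W \<mu> \<subseteq> W (srefl i \<mu>)"
        unfolding eq using Fpow_W[OF mu] by blast
      show "x = 0" if "x \<in> W \<mu>" "(F i ^^ nat m) x = 0" for x
        by (rule quantum_sl2.Fpow_inj[OF sl2 E_nilpotent W_U[OF mu m that(1)] _ that(2)]) (use True in simp)
    qed
  next
    case False
    have eq: "srefl i \<mu> = (\<lambda>h. \<mu> h + of_nat (nat (- m)) * \<alpha> i h)"
      using m False by (simp add: simple_reflection_def)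
    show ?thesis
    proof (rule vs.dim_le_injective[OF linE_pow _ _ W_subspace fin])
      show "(E i ^^ nat (- m)) ` W \<mu> \<subseteq> W (srefl i \<mu>)"
        unfolding eq using Epow_W[OF mu] by blast
      fix x assume x: "x \<in> W \<mu>" "(E i ^^ nat (- m)) x = 0"
      have "x \<in> U i (- (- m))" using W_U[OF mu m x(1)] by simp
      then show "x = 0"
        by (rule quantum_sl2.Fpow_inj[OF sl2_opposite F_nilpotent[OF i] _ _ x(2)]) (use False in simp)
    qed
  qed
qed

lemma character_refl:
  assumes "i \<in> J"
  shows "character D M (srefl i \<mu>) = character D M \<mu>"
proof (cases "\<mu> \<in> P")
  case True
  have "vs.dim (W \<mu>) = vs.dim (W (srefl i \<mu>))"
    using refl_dim_le[OF assms True] refl_dim_le[OF assms refl_P[OF True, of i]] by simp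
  then show ?thesis using True refl_P by (simp add: character_W)
next
  case False
  then show ?thesis using refl_P_iff by (simp add: character_def)
qed

lemma refl_Wt: "i \<in> J \<Longrightarrow> srefl i \<mu> \<in> Wt \<longleftrightarrow> \<mu> \<in> Wt"
  using character_refl[of i \<mu>] by (simp flip: character_Wt)

lemma not_J_Wt: "i \<notin> J \<Longrightarrow> (\<lambda>h. \<Lambda> h - of_nat n * \<alpha> i h) \<in> Wt"
  using Fpow_W[OF Lam v_in_W, where i = i and n = n] P_diff[OF Lam root_in_P, of "int n" i]
  by (intro Wt_I[of _ "(F i ^^ n) v"]) (auto simp: J_def)

lemma commuting_word_zero:
  assumes "F k v = 0" "\<And>l. l \<in> set w \<Longrightarrow> l \<noteq> k \<and> a k l = 0"
  shows "F k (word_vec w) = 0"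
  using assms(2)
proof (induction w)
  case (Cons l w)
  then have kl: "k \<noteq> l" "a k l = 0" using Cons.prems[of l] by auto
  show ?case using F_commute[OF kl, of "word_vec w"] Cons linear_0[OF linF] by simp
qed (simp add: assms(1))

text \<open>The letters in \<open>T\<close> commute with the others and can be moved next to \<open>v\<close>.\<close>

lemma nondegenerate:
  assumes "T \<subseteq> J" "\<And>j. j \<in> T \<Longrightarrow> \<Lambda> (\<alpha>v j) = 0"
    and "set w \<inter> T \<noteq> {}" "\<And>j k. j \<in> T \<Longrightarrow> k \<in> set w - T \<Longrightarrow> a j k = 0"
  shows "word_vec w = 0"
  using assms(3,4)
proof (induction w)
  case (Cons k w)
  show ?case
  proof (cases "set w \<inter> T = {}")
    case False
    then show ?thesis using Cons linear_0[OF linF] by simp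
  next
    case True
    then have k: "k \<in> T" using Cons.prems by auto
    \<comment> \<open>\<open>J_pairing\<close> with pairing 0 already kills the first power.\<close>
    have "F k v = 0" using J_pairing[of k] assms(1,2) k by auto
    moreover have "l \<noteq> k \<and> a k l = 0" if "l \<in> set w" for l
      using Cons.prems(2)[of k l] k that True by auto
    ultimately show ?thesis using commuting_word_zero by simp
  qed
qed simp

text \<open>If no power of \<open>F i\<close> kills \<open>v\<close>, these powers give nonzero
  vectors of distinct weights, hence an infinite independent set. Conversely, the empty word is the
  only one of weight \<open>\<Lambda>\<close>, so \<open>W \<Lambda>\<close> is the line through
  \<open>v\<close>.\<close>

lemma integrability_J: "integrability D M (q_weight \<Lambda>) = J"
proof (intro equalityI subsetI)
  fix i assume "i \<in> integrability D M (q_weight \<Lambda>)"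
  then obtain B where B: "finite B"
    "vs.span {(F i ^^ n) x | n x. x \<in> W \<Lambda>} = vs.span B"
    unfolding integrability_def weight_space_W by blast
  show "i \<in> J"
  proof (rule ccontr)
    assume "i \<notin> J"
    then have nz: "(F i ^^ n) v \<noteq> 0" for n by (simp add: J_def)
    define \<mu> where "\<mu> n = (\<lambda>h. \<Lambda> h - of_nat n * \<alpha> i h)" for n :: nat
    have mu_low: "\<mu> n = low (\<lambda>k. 0 + (if k = i then n else 0))" for n
      unfolding \<mu>_def low_add low_0 ..
    have mu_inj: "\<mu> m = \<mu> n \<Longrightarrow> m = n" for m n
      unfolding mu_low low_inj by (drule fun_cong[of _ _ i]) simp
    have muP: "\<mu> n \<in> P" for n unfolding mu_low by (rule low_P)
    have inW: "(F i ^^ n) v \<in> W (\<mu> n)" for n unfolding \<mu>_def by (rule Fpow_W[OF Lam v_in_W])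
    have ind: "N = {}" if N: "finite N" and c: "(\<Sum>n\<in>N. sc (c n) ((F i ^^ n) v)) = 0" and cn: "\<forall>n\<in>N. c n \<noteq> 0" for N c
    proof -
      \<comment> \<open>\<open>weight_independent\<close> sums over a set of weights, so the
        exponent is recovered from its weight by \<open>the_inv_into\<close>.\<close>
      have "(\<Sum>\<nu>\<in>\<mu> ` N. sc (c (the_inv_into N \<mu> \<nu>)) ((F i ^^ the_inv_into N \<mu> \<nu>) v)) = 0"
      proof -
        have inj: "inj_on \<mu> N" using mu_inj by (auto intro: inj_onI)
        then show ?thesis using c by (simp add: sum.reindex the_inv_into_f_f)
      qed
      moreover have inj: "inj_on \<mu> N" using mu_inj by (auto intro: inj_onI)
      moreover have "\<forall>\<nu>\<in>\<mu> ` N. sc (c (the_inv_into N \<mu> \<nu>)) ((F i ^^ the_inv_into N \<mu> \<nu>) v) \<in> W \<nu>"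
        using inj inW by (auto simp: the_inv_into_f_f intro!: vs.subspace_scale[OF W_subspace])
      ultimately have "\<forall>\<nu>\<in>\<mu> ` N. sc (c (the_inv_into N \<mu> \<nu>)) ((F i ^^ the_inv_into N \<mu> \<nu>) v) = 0"
        using N muP by (intro weight_independent) auto
      then have "\<forall>n\<in>N. sc (c n) ((F i ^^ n) v) = 0" using inj by (simp add: the_inv_into_f_f)
      then show ?thesis using cn nz by auto
    qed
    have inj: "inj (\<lambda>n. (F i ^^ n) v)"
    proof (rule injI)
      fix m n assume eq: "(F i ^^ m) v = (F i ^^ n) v"
      show "m = n"
      proof (rule ccontr)
        assume "m \<noteq> n"
        then have "{m, n} = {}"
          using eq by (intro ind[of "{m, n}" "\<lambda>k. if k = m then 1 else -1"]) auto
        then show False by simp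
      qed
    qed
    have "vs.independent (range (\<lambda>n. (F i ^^ n) v))"
      unfolding vs.independent_explicit_module
    proof (intro allI impI)
      fix t u x
      assume t: "finite t" "t \<subseteq> range (\<lambda>n. (F i ^^ n) v)" "(\<Sum>x\<in>t. sc (u x) x) = 0" "x \<in> t"
      define N where "N = {n. (F i ^^ n) v \<in> t}"
      have tN: "t = (\<lambda>n. (F i ^^ n) v) ` N" using t(2) unfolding N_def by auto
      then have finN: "finite N" using t(1) finite_imageD[OF _ inj_on_subset[OF inj subset_UNIV], of N] by simp
      let ?N = "{n\<in>N. u ((F i ^^ n) v) \<noteq> 0}"
      have "(\<Sum>n\<in>N. sc (u ((F i ^^ n) v)) ((F i ^^ n) v)) = 0"
        using t(3) unfolding tN by (subst (asm) sum.reindex) (auto intro: inj_on_subset[OF inj])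
      moreover have "(\<Sum>n\<in>?N. sc (u ((F i ^^ n) v)) ((F i ^^ n) v)) = (\<Sum>n\<in>N. sc (u ((F i ^^ n) v)) ((F i ^^ n) v))"
        using finN by (intro sum.mono_neutral_left) auto
      ultimately have "?N = {}" using finN by (intro ind[of ?N "\<lambda>n. u ((F i ^^ n) v)"]) auto
      then show "u x = 0" using t(4) unfolding tN by blast
    qed
    moreover have "range (\<lambda>n. (F i ^^ n) v) \<subseteq> vs.span B"
      unfolding B(2)[symmetric] using v_in_W by (auto intro!: vs.span_base)
    ultimately have "finite (range (\<lambda>n. (F i ^^ n) v))"
      using vs.independent_span_bound[OF B(1)] by blast
    then show False using finite_imageD[OF _ inj] by simp
  qed
next
  fix i assume "i \<in> J"
  then obtain N where N: "(F i ^^ N) v = 0" by (auto simp: J_def)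
  let ?S = "{(F i ^^ n) x | n x. x \<in> W \<Lambda>}"
  let ?B = "(\<lambda>n. (F i ^^ n) v) ` {..<N}"
  have WL: "W \<Lambda> = vs.span {v}"
  proof -
    have "{w. word_weight w = \<Lambda>} = {[]}"
    proof (intro equalityI subsetI)
      fix w assume "w \<in> {w. word_weight w = \<Lambda>}"
      then have "count_list w = (\<lambda>_. 0)" using low_inj low_0 unfolding word_weight_def by (metis mem_Collect_eq)
      then show "w \<in> {[]}" by (cases w) (auto simp: fun_eq_iff split: if_splits)
    qed (simp add: word_weight_Nil)
    then show ?thesis using W_span[OF Lam] by simp
  qed
  have "(F i ^^ n) v \<in> vs.span ?B" for n
  proof (cases "n < N")
    case True
    then show ?thesis by (intro vs.span_base) auto
  next
    case False
    then have "(F i ^^ n) v = (F i ^^ (n - N)) ((F i ^^ N) v)"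
      by (metis comp_apply funpow_add le_add_diff_inverse2 not_less)
    then show ?thesis using N by (simp add: linear_0[OF linF_pow] vs.span_zero)
  qed
  then have "?S \<subseteq> vs.span ?B"
    unfolding WL vs.span_singleton by (auto simp: linear_scale[OF linF_pow] intro!: vs.span_scale)
  moreover have "?B \<subseteq> ?S" using v_in_W by blast
  ultimately have "vs.span ?S = vs.span ?B"
    using vs.span_mono vs.span_minimal[OF _ vs.subspace_span] by (intro equalityI) blast+
  then show "i \<in> integrability D M (q_weight \<Lambda>)"
    unfolding integrability_def weight_space_W mem_Collect_eq by (intro exI[of _ ?B]) simp
qed

end

section \<open>Weights of the specialization\<close>

text \<open>Gaussian elimination on the index set: \<open>1 - c s\<close> has value 1 at q = 1, so
  \<open>g s\<close> can be eliminated with a regular inverse and the new coefficients still vanish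
  at q = 1.\<close>

lemma nakayama:
  fixes scale :: "ratfun \<Rightarrow> 'v::ab_group_add \<Rightarrow> 'v"
  assumes "vector_space scale" and "finite T"
    and "\<And>w. w \<in> T \<Longrightarrow> \<exists>c. (\<forall>u\<in>T. at1 (c u) 0) \<and> g w = (\<Sum>u\<in>T. scale (c u) (g u))"
  shows "\<forall>w\<in>T. g w = 0"
  using assms(2,3)
proof (induction T rule: finite_induct)
  case (insert s T)
  interpret vector_space scale by fact
  obtain c where c: "\<forall>u\<in>insert s T. at1 (c u) 0" "g s = (\<Sum>u\<in>insert s T. scale (c u) (g u))"
    using insert.prems[of s] by blast
  have unit: "at1 (1 - c s) 1" using at1_diff[OF at1_one, of "c s" 0] c(1) by simp
  define d where "d u = inverse (1 - c s) * c u" for u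
  have d: "at1 (d u) 0" if "u \<in> T" for u
    using at1_mult[OF at1_inverse[OF unit], of "c u" 0] c(1) that unfolding d_def by simp
  have "g s = scale (c s) (g s) + (\<Sum>u\<in>T. scale (c u) (g u))"
    using c(2) insert.hyps by simp
  moreover have "x - y = z" if "x = y + z" for x y z :: 'v using that by simp
  ultimately have "scale (1 - c s) (g s) = (\<Sum>u\<in>T. scale (c u) (g u))"
    unfolding scale_left_diff_distrib scale_one by blast
  then have "scale (inverse (1 - c s)) (scale (1 - c s) (g s)) = (\<Sum>u\<in>T. scale (d u) (g u))"
    unfolding d_def by (simp add: scale_sum_right)
  then have gs: "g s = (\<Sum>u\<in>T. scale (d u) (g u))"
    using at1_nonzero[OF unit] by simp
  have T0: "\<forall>w\<in>T. g w = 0"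
  proof (rule insert.IH)
    fix w assume w: "w \<in> T"
    obtain e where e: "\<forall>u\<in>insert s T. at1 (e u) 0" "g w = (\<Sum>u\<in>insert s T. scale (e u) (g u))"
      using insert.prems[of w] w by blast
    have "g w = scale (e s) (\<Sum>u\<in>T. scale (d u) (g u)) + (\<Sum>u\<in>T. scale (e u) (g u))"
      using e(2) insert.hyps gs by simp
    also have "\<dots> = (\<Sum>u\<in>T. scale (e s * d u + e u) (g u))"
      by (simp add: scale_sum_right scale_left_distrib sum.distrib)
    finally have "g w = (\<Sum>u\<in>T. scale (e s * d u + e u) (g u))" .
    moreover have "at1 (e s * d u + e u) 0" if "u \<in> T" for u
      using at1_add[OF at1_mult[of "e s" 0 "d u" 0], of "e u" 0] e(1) d[OF that] that by simp
    ultimately show "\<exists>c. (\<forall>u\<in>T. at1 (c u) 0) \<and> g w = (\<Sum>u\<in>T. scale (c u) (g u))"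
      by (intro exI[of _ "\<lambda>u. e s * d u + e u"]) simp
  qed
  then show ?case using gs by simp
qed simp

context highest_weight_rep
begin

section \<open>The form over the local ring and its quotient at q = 1\<close>

abbreviation "A \<equiv> A1_form M v"

definition A_max :: "'v set"
  where "A_max = sc (qvar - 1) ` A"

lemma A_iff: "x \<in> A \<longleftrightarrow> (\<exists>S c. finite S \<and> (\<forall>w\<in>S. c w \<in> regular_at_1) \<and> x = (\<Sum>w\<in>S. sc (c w) (word_vec w)))"
  unfolding A1_form_def word_vec_def by auto

text \<open>By \<open>at1_0_iff\<close> the factor q - 1 can be moved into the coefficients; in this
  shape membership can be split by weight through \<open>components\<close>.\<close>

lemma A_max_iff: "x \<in> A_max \<longleftrightarrow> (\<exists>S c. finite S \<and> (\<forall>w\<in>S. at1 (c w) 0) \<and> x = (\<Sum>w\<in>S. sc (c w) (word_vec w)))"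
proof
  assume "x \<in> A_max"
  then obtain y where y: "y \<in> A" "x = sc (qvar - 1) y" unfolding A_max_def by blast
  then obtain S c where "finite S" "\<forall>w\<in>S. c w \<in> regular_at_1" "y = (\<Sum>w\<in>S. sc (c w) (word_vec w))"
    unfolding A_iff by blast
  with y(2) have S: "finite S" "\<forall>w\<in>S. c w \<in> regular_at_1"
    "x = sc (qvar - 1) (\<Sum>w\<in>S. sc (c w) (word_vec w))"
    by simp_all
  then show "\<exists>S c. finite S \<and> (\<forall>w\<in>S. at1 (c w) 0) \<and> x = (\<Sum>w\<in>S. sc (c w) (word_vec w))"
    by (intro exI[of _ S] exI[of _ "\<lambda>w. (qvar - 1) * c w"]) (auto simp: at1_0_iff vs.scale_sum_right)
next
  assume "\<exists>S c. finite S \<and> (\<forall>w\<in>S. at1 (c w) 0) \<and> x = (\<Sum>w\<in>S. sc (c w) (word_vec w))"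
  then obtain S c where S: "finite S" "\<forall>w\<in>S. at1 (c w) 0" "x = (\<Sum>w\<in>S. sc (c w) (word_vec w))"
    by blast
  have "\<forall>w\<in>S. \<exists>y\<in>regular_at_1. c w = (qvar - 1) * y" using S(2) unfolding at1_0_iff .
  then obtain y where y: "\<forall>w\<in>S. y w \<in> regular_at_1 \<and> c w = (qvar - 1) * y w" by metis
  have "x = sc (qvar - 1) (\<Sum>w\<in>S. sc (y w) (word_vec w))"
    unfolding S(3) vs.scale_sum_right using y by (intro sum.cong) auto
  moreover have "(\<Sum>w\<in>S. sc (y w) (word_vec w)) \<in> A" unfolding A_iff using S(1) y by blast
  ultimately show "x \<in> A_max" unfolding A_max_def by blast
qed

lemma A_0: "0 \<in> A"
  unfolding A_iff by (intro exI[of _ "{}"]) simp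

lemma word_vec_A: "word_vec w \<in> A"
  unfolding A_iff by (intro exI[of _ "{w}"] exI[of _ "\<lambda>_. 1"]) (simp add: regular_closed)

lemma A_add: "x \<in> A \<Longrightarrow> y \<in> A \<Longrightarrow> x + y \<in> A"
proof -
  assume "x \<in> A" "y \<in> A"
  then obtain S c T d where S: "finite S" "\<forall>w\<in>S. c w \<in> regular_at_1" "x = (\<Sum>w\<in>S. sc (c w) (word_vec w))"
    and T: "finite T" "\<forall>w\<in>T. d w \<in> regular_at_1" "y = (\<Sum>w\<in>T. sc (d w) (word_vec w))"
    unfolding A_iff by blast
  let ?c = "\<lambda>w. if w \<in> S then c w else 0" and ?d = "\<lambda>w. if w \<in> T then d w else 0"
  have "x = (\<Sum>w\<in>S \<union> T. sc (?c w) (word_vec w))"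
    unfolding S(3) using S(1) T(1) by (intro sum.mono_neutral_cong_left) auto
  moreover have "y = (\<Sum>w\<in>S \<union> T. sc (?d w) (word_vec w))"
    unfolding T(3) using S(1) T(1) by (intro sum.mono_neutral_cong_left) auto
  ultimately have "x + y = (\<Sum>w\<in>S \<union> T. sc (?c w + ?d w) (word_vec w))"
    by (simp only: vs.scale_left_distrib sum.distrib)
  moreover have "\<forall>w\<in>S \<union> T. ?c w + ?d w \<in> regular_at_1"
    using S(2) T(2) by (auto intro!: regular_closed)
  ultimately show "x + y \<in> A"
    unfolding A_iff using S(1) T(1) by (intro exI[of _ "S \<union> T"] exI[of _ "\<lambda>w. ?c w + ?d w"]) blast
qed

lemma A_scale: "r \<in> regular_at_1 \<Longrightarrow> x \<in> A \<Longrightarrow> sc r x \<in> A"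
proof -
  assume r: "r \<in> regular_at_1" and "x \<in> A"
  then obtain S c where S: "finite S" "\<forall>w\<in>S. c w \<in> regular_at_1" "x = (\<Sum>w\<in>S. sc (c w) (word_vec w))"
    unfolding A_iff by blast
  then show "sc r x \<in> A" unfolding A_iff using r
    by (intro exI[of _ S] exI[of _ "\<lambda>w. r * c w"]) (auto simp: vs.scale_sum_right regular_closed)
qed

lemma A_sum: "(\<And>l. l \<in> B \<Longrightarrow> f l \<in> A) \<Longrightarrow> sum f B \<in> A"
  by (induction B rule: infinite_finite_induct) (auto intro: A_add A_0)

lemma minus_one_regular: "- 1 \<in> regular_at_1"
  using regular_closed(5)[OF regular_closed(1,2)] by simp

lemma A_max_add: "x \<in> A_max \<Longrightarrow> y \<in> A_max \<Longrightarrow> x + y \<in> A_max"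
  unfolding A_max_def using A_add by (auto simp flip: vs.scale_right_distrib)

lemma A_max_scale: "r \<in> regular_at_1 \<Longrightarrow> x \<in> A_max \<Longrightarrow> sc r x \<in> A_max"
proof -
  assume r: "r \<in> regular_at_1" and "x \<in> A_max"
  then obtain y where y: "y \<in> A" "x = sc (qvar - 1) y" unfolding A_max_def by blast
  have "sc r x = sc (qvar - 1) (sc r y)" unfolding y(2) vs.scale_scale by (simp only: mult.commute)
  then show "sc r x \<in> A_max" unfolding A_max_def using A_scale[OF r y(1)] by blast
qed

lemma A_max_0: "0 \<in> A_max"
  unfolding A_max_def using A_0 by force

lemma A_max_diff: "x \<in> A_max \<Longrightarrow> y \<in> A_max \<Longrightarrow> x - y \<in> A_max"
  using A_max_add[OF _ A_max_scale[OF minus_one_regular], of x y] by simp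

lemma A_max_sum: "(\<And>l. l \<in> B \<Longrightarrow> f l \<in> A_max) \<Longrightarrow> sum f B \<in> A_max"
  by (induction B rule: infinite_finite_induct) (auto intro: A_max_add A_max_0)

lemma scale_A_max: "at1 r 0 \<Longrightarrow> x \<in> A \<Longrightarrow> sc r x \<in> A_max"
proof -
  assume "at1 r 0" and x: "x \<in> A"
  then obtain y where y: "y \<in> regular_at_1" "r = (qvar - 1) * y" unfolding at1_0_iff by blast
  have "sc r x = sc (qvar - 1) (sc y x)" unfolding y(2) vs.scale_scale ..
  then show "sc r x \<in> A_max" unfolding A_max_def using A_scale[OF y(1) x] by blast
qed

lemma spec_rel_iff: "(x, y) \<in> spec_rel M v \<longleftrightarrow> x \<in> A \<and> y \<in> A \<and> x - y \<in> A_max"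
  by (simp add: spec_rel_def A_max_def)

definition residue_class :: "'v \<Rightarrow> 'v set"
  where "residue_class x = spec_rel M v `` {x}"

lemma residue_class_mem: "x \<in> A \<Longrightarrow> y \<in> residue_class x \<longleftrightarrow> y \<in> A \<and> x - y \<in> A_max"
  by (auto simp: residue_class_def spec_rel_iff)

lemma residue_class_eq: "x \<in> A \<Longrightarrow> y \<in> A \<Longrightarrow> residue_class x = residue_class y \<longleftrightarrow> x - y \<in> A_max"
proof
  assume x: "x \<in> A" and y: "y \<in> A" and eq: "residue_class x = residue_class y"
  have "y \<in> residue_class y" using y A_max_0 by (simp add: residue_class_mem)
  then show "x - y \<in> A_max" using eq x residue_class_mem by blast
next
  assume x: "x \<in> A" and y: "y \<in> A" and d: "x - y \<in> A_max"
  have "x - z \<in> A_max \<longleftrightarrow> y - z \<in> A_max" for z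
    using A_max_add[OF d, of "y - z"] A_max_diff[OF _ d, of "x - z"] by auto
  then show "residue_class x = residue_class y" using x y by (auto simp: residue_class_mem)
qed

text \<open>\<open>T\<close> commutes with multiplication by q - 1, so preserving \<open>A\<close>
  implies preserving \<open>A_max\<close>.\<close>

lemma spec_map_residue_class:
  assumes T: "Vector_Spaces.linear sc sc T" "\<And>x. x \<in> A \<Longrightarrow> T x \<in> A" and x: "x \<in> A"
  shows "spec_map M v T (residue_class x) = residue_class (T x)"
proof -
  have eq: "residue_class (T y) = residue_class (T x)" if "y \<in> residue_class x" for y
  proof -
    have y: "y \<in> A" "x - y \<in> A_max" using that x by (auto simp: residue_class_mem)
    then obtain z where z: "z \<in> A" "x - y = sc (qvar - 1) z" unfolding A_max_def by blast
    have "T x - T y = sc (qvar - 1) (T z)"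
      using linear_diff[OF T(1), of x y] z linear_scale[OF T(1)] by simp
    then have "T x - T y \<in> A_max" using T(2) z unfolding A_max_def by blast
    then show ?thesis using residue_class_eq T(2) x y by metis
  qed
  have "spec_map M v T (residue_class x) = (\<Union>y\<in>residue_class x. residue_class (T y))"
    unfolding spec_map_def residue_class_def by blast
  also have "\<dots> = (\<Union>y\<in>residue_class x. residue_class (T x))"
    by (intro SUP_cong HOL.refl eq)
  also have "\<dots> = residue_class (T x)"
    using residue_class_mem[OF x, of x] x A_max_0 by (intro cSUP_const) auto
  finally show ?thesis .
qed

definition hop :: "'h \<Rightarrow> 'v \<Rightarrow> 'v"
  where "hop h x = sc (1 / (qvar - 1)) (Q h x - x)"

text \<open>The eigenvalue of \<open>hop h\<close> on \<open>W \<nu>\<close> for z =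
  \<open>\<nu> h\<close>; its value at q = 1 is z itself.\<close>

definition hval :: "complex \<Rightarrow> ratfun"
  where "hval z = (qpow z - 1) / (qvar - 1)"

lemma at1_hval: "z \<in> \<int> \<Longrightarrow> at1 (hval z) z"
  unfolding hval_def using at1_qvar_powi_diff by (auto elim!: Ints_cases)

lemma hop_linear: "h \<in> L \<Longrightarrow> Vector_Spaces.linear sc sc (hop h)"
  using vs.vector_space_axioms
  by (auto simp: Vector_Spaces.linear_iff hop_def linear_add[OF linQ] linear_scale[OF linQ]
      vs.scale_right_distrib vs.scale_right_diff_distrib algebra_simps)

lemma hop_W: "h \<in> L \<Longrightarrow> x \<in> W \<nu> \<Longrightarrow> hop h x = sc (hval (\<nu> h)) x"
proof -
  assume "h \<in> L" "x \<in> W \<nu>"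
  then have "Q h x - x = sc (qpow (\<nu> h) - 1) x" by (simp add: W_D vs.scale_left_diff_distrib)
  then show ?thesis by (simp add: hop_def hval_def)
qed

lemma hop_A: "h \<in> L \<Longrightarrow> x \<in> A \<Longrightarrow> hop h x \<in> A"
proof -
  assume h: "h \<in> L" and "x \<in> A"
  then obtain S c where S: "\<forall>w\<in>S. c w \<in> regular_at_1" "x = (\<Sum>w\<in>S. sc (c w) (word_vec w))"
    unfolding A_iff by blast
  have "hval (word_weight w h) \<in> regular_at_1" for w
    using at1_hval P_int[OF word_weight_P h] unfolding regular_iff by blast
  then show "hop h x \<in> A" unfolding S(2) using S(1)
    by (auto simp: linear_sum[OF hop_linear[OF h]] linear_scale[OF hop_linear[OF h]]
        hop_W[OF h word_vec_W] intro!: A_sum A_scale word_vec_A regular_closed)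
qed

lemma const_regular: "ratfun_const c \<in> regular_at_1"
  using at1_const regular_iff by blast

lemma scale_linear: "Vector_Spaces.linear sc sc (sc r)"
  using vs.vector_space_axioms
  by (auto simp: Vector_Spaces.linear_iff vs.scale_right_distrib mult.commute)

text \<open>Replaces classes in the quotient by representatives and congruences modulo
  \<open>A_max\<close>.\<close>

lemma spec_weights_iff:
  "\<mu> \<in> spec_weights D M v \<longleftrightarrow>
    \<mu> \<in> hdual D \<and> (\<exists>x\<in>A. x \<notin> A_max \<and> (\<forall>h\<in>L. hop h x - sc (ratfun_const (\<mu> h)) x \<in> A_max))"
proof -
  have spec: "specialization M v = residue_class ` A"
    unfolding specialization_def quotient_def residue_class_def by auto
  have map1: "spec_map M v (\<lambda>x. sc (1 / (qvar - 1)) (Q h x - x)) (residue_class x) = residue_class (hop h x)"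
    if "h \<in> L" "x \<in> A" for h x
    using spec_map_residue_class[OF hop_linear[OF that(1)] hop_A[OF that(1)] that(2)]
    unfolding hop_def[abs_def] .
  have map2: "spec_map M v (sc (ratfun_const c)) (residue_class x) = residue_class (sc (ratfun_const c) x)"
    if "x \<in> A" for c x
    using spec_map_residue_class[OF scale_linear A_scale[OF const_regular] that] .
  have eq: "residue_class (hop h x) = residue_class (sc (ratfun_const c) x) \<longleftrightarrow> hop h x - sc (ratfun_const c) x \<in> A_max"
    if "h \<in> L" "x \<in> A" for h x c
    using residue_class_eq[OF hop_A[OF that] A_scale[OF const_regular that(2)]] .
  have nz: "residue_class x \<noteq> spec_rel M v `` {0} \<longleftrightarrow> x \<notin> A_max" if "x \<in> A" for x
    using residue_class_eq[OF that A_0] unfolding residue_class_def by simp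
  show ?thesis
    unfolding spec_weights_def spec_weight_space_def spec mem_Collect_eq
    by (auto simp: map1 map2 eq nz)
qed

text \<open>Otherwise \<open>components\<close> writes each word of weight \<open>\<mu>\<close> as a
  combination of the finitely many such words with coefficients vanishing at q = 1, and
  \<open>nakayama\<close> makes all of them zero.\<close>

lemma word_not_A_max:
  assumes "\<mu> \<in> Wt"
  shows "\<exists>w. word_weight w = \<mu> \<and> word_vec w \<notin> A_max"
proof (rule ccontr)
  assume no: "\<not> ?thesis"
  have "\<forall>w\<in>{w. word_weight w = \<mu>}. word_vec w = 0"
  proof (rule nakayama[OF vs.vector_space_axioms finite_word_weight])
    fix w assume "w \<in> {w. word_weight w = \<mu>}"
    then have w: "word_weight w = \<mu>" by simp
    then obtain S c where S: "finite S" "\<forall>w\<in>S. at1 (c w) 0" "word_vec w = (\<Sum>w\<in>S. sc (c w) (word_vec w))"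
      using no unfolding A_max_iff by blast
    have "word_vec w = (\<Sum>u | u \<in> S \<and> word_weight u = \<mu>. sc (c u) (word_vec u))"
      using components[of "{\<mu>}" "\<lambda>_. word_vec w" S c \<mu>] S word_vec_W[of w] word_weight_P[of w] w by simp
    also have "\<dots> = (\<Sum>u\<in>{u. word_weight u = \<mu>}. sc (if u \<in> S then c u else 0) (word_vec u))"
      using finite_word_weight by (intro sum.mono_neutral_cong_left) auto
    finally show "\<exists>c. (\<forall>u\<in>{w. word_weight w = \<mu>}. at1 (c u) 0) \<and> word_vec w = (\<Sum>u\<in>{w. word_weight w = \<mu>}. sc (c u) (word_vec u))"
      using S(2) by (intro exI[of _ "\<lambda>u. if u \<in> S then c u else 0"]) simp
  qed
  then show False using Wt_word[OF assms] by blast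
qed

text \<open>For the inclusion into \<open>Wt\<close> the functional \<open>\<mu>\<close> is not
  known to be integral. Some weight component \<open>y \<nu>\<close> of a lift is nonzero modulo
  \<open>A_max\<close>; if \<open>\<mu>\<close> and \<open>\<nu>\<close> differed at h, the factor
  \<open>s \<nu>\<close> would be a unit of the local ring and would force this component into
  \<open>A_max\<close>.\<close>

lemma spec_weights_Wt: "spec_weights D M v = Wt"
proof (intro equalityI subsetI)
  fix \<mu> assume mu: "\<mu> \<in> Wt"
  then have muP: "\<mu> \<in> P" by (simp add: Wt_def)
  obtain w where w: "word_weight w = \<mu>" "word_vec w \<notin> A_max" using word_not_A_max[OF mu] by blast
  have "hop h (word_vec w) - sc (ratfun_const (\<mu> h)) (word_vec w) \<in> A_max" if h: "h \<in> L" for h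
  proof -
    have "hop h (word_vec w) - sc (ratfun_const (\<mu> h)) (word_vec w) = sc (hval (\<mu> h) - ratfun_const (\<mu> h)) (word_vec w)"
      using hop_W[OF h word_vec_W, of w] w(1) by (simp add: vs.scale_left_diff_distrib)
    moreover have "at1 (hval (\<mu> h) - ratfun_const (\<mu> h)) 0"
      using at1_diff[OF at1_hval at1_const, of "\<mu> h" "\<mu> h"] P_int[OF muP h] by simp
    ultimately show ?thesis using scale_A_max word_vec_A by simp
  qed
  then show "\<mu> \<in> spec_weights D M v"
    unfolding spec_weights_iff using P_hdual[OF muP] w(2) word_vec_A by blast
next
  fix \<mu> assume "\<mu> \<in> spec_weights D M v"
  then obtain x where mu: "\<mu> \<in> hdual D" and x: "x \<in> A" "x \<notin> A_max"
    "\<And>h. h \<in> L \<Longrightarrow> hop h x - sc (ratfun_const (\<mu> h)) x \<in> A_max"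
    unfolding spec_weights_iff by blast
  obtain S c where S: "finite S" "\<forall>w\<in>S. c w \<in> regular_at_1" "x = (\<Sum>w\<in>S. sc (c w) (word_vec w))"
    using x(1) unfolding A_iff by blast
  define y where "y \<nu> = (\<Sum>w | w \<in> S \<and> word_weight w = \<nu>. sc (c w) (word_vec w))" for \<nu>
  have xy: "x = (\<Sum>\<nu>\<in>word_weight ` S. y \<nu>)"
    unfolding S(3) y_def by (rule sum.group[symmetric]) (use S(1) in auto)
  have yA: "y \<nu> \<in> A" for \<nu>
    unfolding y_def using S(2) by (intro A_sum A_scale word_vec_A) simp
  have yW: "y \<nu> \<in> W \<nu>" for \<nu>
    unfolding y_def
  proof (intro vs.subspace_sum[OF W_subspace] vs.subspace_scale[OF W_subspace])
    show "word_vec w \<in> W \<nu>" if "w \<in> {w \<in> S. word_weight w = \<nu>}" for w using that word_vec_W[of w] by auto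
  qed
  obtain \<nu> where nu: "\<nu> \<in> word_weight ` S" "y \<nu> \<notin> A_max"
    using x(2) A_max_sum[of "word_weight ` S" y] xy by auto
  have "\<mu> h = \<nu> h" if h: "h \<in> L" for h
  proof (rule ccontr)
    assume ne: "\<mu> h \<noteq> \<nu> h"
    define s where "s \<kappa> = hval (\<kappa> h) - ratfun_const (\<mu> h)" for \<kappa>
    have "hop h x - sc (ratfun_const (\<mu> h)) x = (\<Sum>\<kappa>\<in>word_weight ` S. sc (s \<kappa>) (y \<kappa>))"
      unfolding xy linear_sum[OF hop_linear[OF h]] vs.scale_sum_right sum_subtractf[symmetric] s_def
      by (intro sum.cong) (auto simp: hop_W[OF h yW] vs.scale_left_diff_distrib)
    then obtain S' c' where S': "finite S'" "\<forall>w\<in>S'. at1 (c' w) 0"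
      "(\<Sum>\<kappa>\<in>word_weight ` S. sc (s \<kappa>) (y \<kappa>)) = (\<Sum>w\<in>S'. sc (c' w) (word_vec w))"
      using x(3)[OF h] unfolding A_max_iff by auto
    have "sc (s \<nu>) (y \<nu>) = (\<Sum>w | w \<in> S' \<and> word_weight w = \<nu>. sc (c' w) (word_vec w))"
    proof (rule components[OF _ _ _ S'(1,3) nu(1)])
      show "finite (word_weight ` S)" using S(1) by simp
      show "word_weight ` S \<subseteq> P" using word_weight_P by blast
      show "sc (s \<kappa>) (y \<kappa>) \<in> W \<kappa>" for \<kappa> using vs.subspace_scale[OF W_subspace yW] .
    qed
    also have "\<dots> \<in> A_max" using S'(2) by (intro A_max_sum scale_A_max word_vec_A) simp
    finally have sy: "sc (s \<nu>) (y \<nu>) \<in> A_max" .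
    have "\<nu> h \<in> \<int>" using nu(1) P_int[OF word_weight_P h] by blast
    then have "at1 (s \<nu>) (\<nu> h - \<mu> h)" unfolding s_def by (intro at1_diff at1_hval at1_const)
    moreover have "\<nu> h - \<mu> h \<noteq> 0" using ne by simp
    ultimately have inv: "inverse (s \<nu>) \<in> regular_at_1" "s \<nu> \<noteq> 0"
      using at1_inverse at1_nonzero unfolding regular_iff by blast+
    have "y \<nu> = sc (inverse (s \<nu>)) (sc (s \<nu>) (y \<nu>))" using inv(2) by simp
    then show False using nu(2) A_max_scale[OF inv(1) sy] by simp
  qed
  moreover have nuP: "\<nu> \<in> P" using nu(1) word_weight_P by blast
  ultimately have "\<mu> = \<nu>" using hdual_eqI[OF mu P_hdual] by blast
  moreover have "y \<nu> \<noteq> 0" using nu(2) A_max_0 by auto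
  ultimately show "\<mu> \<in> Wt" using Wt_I[OF nuP yW] by simp
qed

section \<open>Weights in convex sets stable under the reflections of J\<close>

lemma low_fun_upd: "low (n(i := n i + m)) = (\<lambda>h. low n h - of_nat m * \<alpha> i h)"
proof -
  have "n(i := n i + m) = (\<lambda>k. n k + (if k = i then m else 0))" by auto
  then show ?thesis by (simp only: low_add)
qed

lemma low_coroot:
  assumes "\<Lambda> (\<alpha>v j) = of_int l"
  shows "low n (\<alpha>v j) = of_int (l - (\<Sum>i\<in>UNIV. int (n i) * a j i))"
  using assms by (simp add: low_def rsum_coroot)

text \<open>A \<open>J\<close>-dominant weight is reached inside \<open>X\<close> from its projection modulo the span of the
  \<open>\<alpha> j\<close>, \<open>j \<in> J\<close>: if the ascent stops early at \<open>\<beta>\<close>, then pairing the missing part with \<open>\<beta>\<close> by the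
  symmetrized Cartan matrix shows that the missing letters are disconnected from everything else.\<close>

lemma dominant_in_convex:
  fixes X :: "('h \<Rightarrow> complex) set"
  assumes X: "convex X" and refl: "\<And>j \<mu>. j \<in> J \<Longrightarrow> \<mu> \<in> X \<Longrightarrow> srefl j \<mu> \<in> X"
    and base: "\<And>n. (\<And>j. j \<in> J \<Longrightarrow> n j = 0) \<Longrightarrow> low n \<in> X"
    and Wt: "low n \<in> Wt"
    and dom: "\<And>j m. j \<in> J \<Longrightarrow> low n (\<alpha>v j) = of_int m \<Longrightarrow> m \<ge> 0"
  shows "low n \<in> X"
proof -
  define n0 where "n0 j = (if j \<in> J then 0 else n j)" for j
  define k where "k j = (if j \<in> J then n j else 0)" for j
  have nk: "n = (\<lambda>j. n0 j + k j)" unfolding n0_def k_def by auto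
  \<comment> \<open>\<open>\<beta>\<close> measures how much of the J-part \<open>k\<close> has been
    reached inside \<open>X\<close>; the bound by \<open>k\<close> makes a choice of maximal total
    possible.\<close>
  define Bs where "Bs = {\<beta>. (\<forall>j. \<beta> j \<le> k j) \<and> low (\<lambda>j. n0 j + \<beta> j) \<in> X}"
  have "finite (PiE UNIV (\<lambda>j. {..k j}))" by (intro finite_PiE) auto
  moreover have "Bs \<subseteq> PiE UNIV (\<lambda>j. {..k j})" unfolding Bs_def by (auto simp: PiE_def)
  ultimately have finB: "finite Bs" by (rule rev_finite_subset)
  have "low (\<lambda>j. n0 j + (\<lambda>_. 0) j) \<in> X" using base[of n0] unfolding n0_def by simp
  then have "(\<lambda>_. 0) \<in> Bs" unfolding Bs_def by simp
  then have "Max ((\<lambda>\<beta>. sum \<beta> UNIV) ` Bs) \<in> (\<lambda>\<beta>. sum \<beta> UNIV) ` Bs"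
    using finB by (intro Max_in) auto
  then obtain \<beta> where \<beta>1: "\<beta> \<in> Bs" "Max ((\<lambda>\<beta>. sum \<beta> UNIV) ` Bs) = sum \<beta> UNIV" by blast
  have \<beta>: "\<beta> \<in> Bs" "\<And>\<gamma>. \<gamma> \<in> Bs \<Longrightarrow> sum \<gamma> UNIV \<le> sum \<beta> UNIV"
    using \<beta>1 finB by (auto simp flip: \<beta>1(2))
  have bk: "\<beta> j \<le> k j" and bX: "low (\<lambda>j. n0 j + \<beta> j) \<in> X" for j
    using \<beta>(1) unfolding Bs_def by auto
  obtain l where l: "\<And>j. \<Lambda> (\<alpha>v j) = of_int (l j)" using P_pairing[OF Lam] by metis
  define c where "c g j = l j - (\<Sum>i\<in>UNIV. int (g i) * a j i)" for g :: "'i \<Rightarrow> nat" and j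
  have low_c: "low g (\<alpha>v j) = of_int (c g j)" for g j
    unfolding c_def by (rule low_coroot[OF l])
  have l_nonneg: "l j \<ge> 0" if "j \<in> J" for j
    using J_pairing[OF that] l[of j] by (metis of_int_of_nat_eq of_int_eq_iff of_nat_0_le_iff)
  define T where "T = {j. \<beta> j < k j}"
  have TJ: "T \<subseteq> J" unfolding T_def k_def by auto
  \<comment> \<open>If the pairing p were positive, \<open>\<kappa> - \<alpha> j\<close> would lie
    on the segment from \<open>\<kappa>\<close> to \<open>srefl j \<kappa>\<close> at parameter 1/p,
    and \<open>\<beta>\<close> could grow.\<close>
  have c_T: "c (\<lambda>j. n0 j + \<beta> j) j \<le> 0" if j: "j \<in> T" for j
  proof (rule ccontr)
    define \<kappa> where "\<kappa> = low (\<lambda>j. n0 j + \<beta> j)"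
    define p where "p = real_of_int (c (\<lambda>j. n0 j + \<beta> j) j)"
    assume "\<not> ?thesis"
    then have p: "p \<ge> 1" unfolding p_def by simp
    have "srefl j \<kappa> = (\<lambda>h. \<kappa> h - of_real p * \<alpha> j h)"
      unfolding simple_reflection_def \<kappa>_def p_def low_c by simp
    then have "(1 - 1 / p) *\<^sub>R \<kappa> + (1 / p) *\<^sub>R srefl j \<kappa> = (\<lambda>h. \<kappa> h - \<alpha> j h)"
      using p by (simp add: fun_eq_iff scaleR_fun_def scaleR_conv_of_real field_simps)
    moreover have "(1 - 1 / p) *\<^sub>R \<kappa> + (1 / p) *\<^sub>R srefl j \<kappa> \<in> X"
      using p bX refl[of j \<kappa>] TJ j unfolding \<kappa>_def
      by (intro convexD[OF X]) (auto simp: field_simps)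
    moreover have "(\<lambda>h. \<kappa> h - \<alpha> j h) = low (\<lambda>i. n0 i + (\<beta>(j := \<beta> j + 1)) i)"
    proof -
      have "(\<lambda>i. n0 i + (\<beta>(j := \<beta> j + 1)) i) = (\<lambda>i. (n0 i + \<beta> i) + (if i = j then 1 else 0))" by auto
      then show ?thesis unfolding \<kappa>_def by (simp only: low_add) simp
    qed
    ultimately have "\<beta>(j := \<beta> j + 1) \<in> Bs" using bk j unfolding Bs_def T_def by auto
    then have "sum (\<beta>(j := \<beta> j + 1)) UNIV \<le> sum \<beta> UNIV" by (rule \<beta>(2))
    moreover have "sum \<beta> UNIV < sum (\<beta>(j := \<beta> j + 1)) UNIV"
      by (rule sum_strict_mono_ex1) auto
    ultimately show False by simp
  qed
  have "T = {}"
  proof (rule ccontr)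
    assume Tne: "T \<noteq> {}"
    define w where "w j = int (k j) - int (\<beta> j)" for j
    have w_nonneg: "w j \<ge> 0" for j unfolding w_def using bk[of j] by simp
    have w_pos: "w j > 0" if "j \<in> T" for j using that unfolding w_def T_def by simp
    have w_0: "w j = 0" if "j \<notin> T" for j using that bk[of j] unfolding w_def T_def by simp
    have c_n: "c n j \<ge> 0" if "j \<in> J" for j using dom[OF that low_c] .
    \<comment> \<open>This is the pairing at \<open>\<beta>\<close>, nonpositive by
      \<open>c_T\<close>, minus the pairing at n, nonnegative by dominance.\<close>
    have wA: "(\<Sum>i\<in>T. w i * a j i) \<le> 0" if j: "j \<in> T" for j
    proof -
      have "(\<Sum>i\<in>T. w i * a j i) = (\<Sum>i\<in>UNIV. w i * a j i)"
        using w_0 by (intro sum.mono_neutral_left) auto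
      also have "\<dots> = c (\<lambda>j. n0 j + \<beta> j) j - c n j"
        unfolding c_def w_def nk by (simp add: algebra_simps sum.distrib sum_subtractf)
      also have "\<dots> \<le> 0" using c_T[OF j] c_n[of j] TJ j by auto
      finally show ?thesis .
    qed
    \<comment> \<open>The pairing with the j-th coroot of \<open>\<Lambda>\<close> lowered by the
      letters outside \<open>T\<close> only. There \<open>\<beta>\<close> agrees with
      \<open>k\<close>, so these letters count in full.\<close>
    define R where "R j = l j + (\<Sum>i\<in>-T. int (n i) * (- a j i))" for j
    have terms: "int (n i) * (- a j i) \<ge> 0" if "j \<in> T" "i \<in> - T" for i j
    proof -
      have "i \<noteq> j" using that by auto
      then have "- a j i \<ge> 0" using cartan_offdiag[of j i] by auto
      then show ?thesis by (intro mult_nonneg_nonneg) simp_all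
    qed
    have R_nonneg: "R j \<ge> 0" if "j \<in> T" for j
      unfolding R_def using l_nonneg[of j] TJ that terms by (intro add_nonneg_nonneg sum_nonneg) auto
    have bR: "(\<Sum>i\<in>T. int (\<beta> i) * a j i) \<ge> R j" if j: "j \<in> T" for j
    proof -
      have "(\<Sum>i\<in>UNIV. int (n0 i + \<beta> i) * a j i)
          = (\<Sum>i\<in>T. int (n0 i + \<beta> i) * a j i) + (\<Sum>i\<in>-T. int (n0 i + \<beta> i) * a j i)"
        using sum.union_disjoint[of T "-T" "\<lambda>i. int (n0 i + \<beta> i) * a j i"] by simp
      also have "(\<Sum>i\<in>T. int (n0 i + \<beta> i) * a j i) = (\<Sum>i\<in>T. int (\<beta> i) * a j i)"
        using TJ unfolding n0_def by (intro sum.cong) auto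
      also have "(\<Sum>i\<in>-T. int (n0 i + \<beta> i) * a j i) = (\<Sum>i\<in>-T. int (n i) * a j i)"
        by (intro sum.cong) (use bk in \<open>auto simp: nk T_def not_less intro: le_antisym\<close>)
      finally show ?thesis using c_T[OF j] unfolding c_def R_def by (simp add: sum_negf)
    qed
    define d where "d = symmetrizer D"
    \<comment> \<open>The symmetrized form of \<open>w\<close> and \<open>\<beta>\<close> on
      \<open>T\<close>. Summed against \<open>\<beta>\<close> it is at least the nonnegative sum of
      the \<open>w j * d j * R j\<close>; by symmetry, summed against \<open>w\<close>, it is at
      most 0. Hence every \<open>R j\<close> on \<open>T\<close> vanishes.\<close>
    define S where "S = (\<Sum>j\<in>T. \<Sum>i\<in>T. w j * d j * (int (\<beta> i) * a j i))"
    have S1: "S \<ge> (\<Sum>j\<in>T. w j * d j * R j)"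
      unfolding S_def sum_distrib_left[symmetric]
      using bR w_nonneg symm_pos by (intro sum_mono mult_left_mono) (auto simp: d_def less_imp_le)
    have "S = (\<Sum>i\<in>T. \<Sum>j\<in>T. w j * d j * (int (\<beta> i) * a j i))"
      unfolding S_def by (rule sum.swap)
    also have "\<dots> = (\<Sum>i\<in>T. \<Sum>j\<in>T. int (\<beta> i) * d i * (w j * a i j))"
    proof (intro sum.cong HOL.refl)
      fix i j
      have "w j * d j * (int (\<beta> i) * a j i) = w j * int (\<beta> i) * (d j * a j i)" by (simp only: ac_simps)
      also have "\<dots> = w j * int (\<beta> i) * (d i * a i j)" unfolding d_def by (simp only: symm[of j i])
      finally show "w j * d j * (int (\<beta> i) * a j i) = int (\<beta> i) * d i * (w j * a i j)" by (simp only: ac_simps)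
    qed
    also have "\<dots> \<le> 0"
      unfolding sum_distrib_left[symmetric]
      using symm_pos wA
      by (intro sum_nonpos) (rule mult_nonneg_nonpos, auto simp: d_def less_imp_le)
    finally have "(\<Sum>j\<in>T. w j * d j * R j) \<le> 0" using S1 by simp
    moreover have nn: "w j * d j * R j \<ge> 0" if "j \<in> T" for j
      using w_nonneg[of j] symm_pos[of j] R_nonneg[OF that] by (simp add: d_def)
    ultimately have "\<forall>j\<in>T. w j * d j * R j = 0"
      using sum_nonneg_eq_0_iff[of T "\<lambda>j. w j * d j * R j"] sum_nonneg[of T "\<lambda>j. w j * d j * R j"] by fastforce
    then have R0: "R j = 0" if "j \<in> T" for j
      using that w_pos[OF that] symm_pos[of j] unfolding d_def by auto
    have l0: "l j = 0" and n_a: "\<And>i. i \<in> - T \<Longrightarrow> int (n i) * (- a j i) = 0" if j: "j \<in> T" for j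
    proof -
      have nn: "(\<Sum>i\<in>-T. int (n i) * (- a j i)) \<ge> 0" using terms[OF j] by (rule sum_nonneg)
      then show "l j = 0" using R0[OF j] l_nonneg[of j] TJ j unfolding R_def by auto
      then have "(\<Sum>i\<in>-T. int (n i) * (- a j i)) = 0" using R0[OF j] unfolding R_def by simp
      then show "\<And>i. i \<in> - T \<Longrightarrow> int (n i) * (- a j i) = 0"
        using sum_nonneg_eq_0_iff[of "-T" "\<lambda>i. int (n i) * (- a j i)"] terms[OF j] by simp
    qed
    obtain u where u: "word_vec u \<noteq> 0" "word_weight u = low n" using Wt_word[OF Wt] by blast
    then have cnt: "count_list u = n" unfolding word_weight_def low_inj by simp
    have set_u: "i \<in> set u \<longleftrightarrow> n i > 0" for i
      using count_list_0_iff[of u i] unfolding cnt by auto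
    have "word_vec u = 0"
    proof (rule nondegenerate[OF TJ])
      show "\<Lambda> (\<alpha>v j) = 0" if "j \<in> T" for j using l l0[OF that] by simp
      show "set u \<inter> T \<noteq> {}" using Tne set_u unfolding T_def k_def by (fastforce split: if_splits)
      show "a j i = 0" if "j \<in> T" "i \<in> set u - T" for j i
        using n_a[OF that(1), of i] that(2) set_u by auto
    qed
    then show False using u by simp
  qed
  have "\<beta> j = k j" for j using bk[of j] \<open>T = {}\<close> unfolding T_def by (auto simp: not_less intro: le_antisym)
  then have "\<beta> = k" by blast
  then show ?thesis using bX nk by simp
qed

text \<open>Induction on the height below \<open>\<Lambda>\<close>: a negative pairing lets a
  reflection produce a weight of smaller height, and stability of \<open>X\<close> brings it back.
  The weights without negative pairings are covered by \<open>dominant_in_convex\<close>.\<close>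

lemma Wt_subset_convex:
  fixes X :: "('h \<Rightarrow> complex) set"
  assumes X: "convex X" and refl: "\<And>j \<mu>. j \<in> J \<Longrightarrow> \<mu> \<in> X \<Longrightarrow> srefl j \<mu> \<in> X"
    and base: "\<And>n. (\<And>j. j \<in> J \<Longrightarrow> n j = 0) \<Longrightarrow> low n \<in> X"
  shows "Wt \<subseteq> X"
proof -
  have "low n \<in> Wt \<Longrightarrow> low n \<in> X" for n
  proof (induction "sum n UNIV" arbitrary: n rule: less_induct)
    case less
    show ?case
    proof (cases "\<exists>j m. j \<in> J \<and> low n (\<alpha>v j) = of_int m \<and> m < 0")
      case True
      then obtain j m where jm: "j \<in> J" "low n (\<alpha>v j) = of_int m" "m < 0" by blast
      have "srefl j (low n) \<in> Wt" using refl_Wt[OF jm(1)] less.prems by simp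
      then obtain n' where n': "srefl j (low n) = low n'" using Wt_low by blast
      have "low n = (\<lambda>h. low n' h - of_nat (nat (- m)) * \<alpha> j h)"
        unfolding n'[symmetric] simple_reflection_def jm(2) using jm(3) by simp
      then have "n = n'(j := n' j + nat (- m))" unfolding low_fun_upd[symmetric] low_inj .
      then have "sum n' UNIV < sum n UNIV"
        using jm(3) by (intro sum_strict_mono_ex1) auto
      then have "low n' \<in> X"
        using less.hyps \<open>srefl j (low n) \<in> Wt\<close> unfolding n' by blast
      then have "srefl j (low n') \<in> X" using refl[OF jm(1)] by blast
      then show ?thesis unfolding n'[symmetric] by simp
    next
      case False
      show ?thesis
        by (rule dominant_in_convex[OF X refl base less.prems]) (use False in \<open>auto simp: not_less[symmetric]\<close>)
    qed
  qed
  then show ?thesis using Wt_low by blast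
qed

section \<open>Convex hull and stabilizer\<close>

definition H :: "('h \<Rightarrow> complex) set"
  where "H = convex hull Wt"

lemma refl_H: "j \<in> J \<Longrightarrow> \<mu> \<in> H \<Longrightarrow> srefl j \<mu> \<in> H"
proof -
  assume j: "j \<in> J" and mu: "\<mu> \<in> H"
  have "H \<subseteq> {\<mu>. srefl j \<mu> \<in> H}"
    unfolding H_def
  proof (rule hull_minimal)
    show "Wt \<subseteq> {\<mu>. srefl j \<mu> \<in> convex hull Wt}" using refl_Wt[OF j] by (auto intro: hull_inc)
    show "convex {\<mu>. srefl j \<mu> \<in> convex hull Wt}"
    proof (rule convexI)
      fix x y :: "'h \<Rightarrow> complex" and s t :: real
      assume *: "x \<in> {\<mu>. srefl j \<mu> \<in> convex hull Wt}" "y \<in> {\<mu>. srefl j \<mu> \<in> convex hull Wt}"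
        "s \<ge> 0" "t \<ge> 0" "s + t = 1"
      have "srefl j (s *\<^sub>R x + t *\<^sub>R y) = s *\<^sub>R srefl j x + t *\<^sub>R srefl j y"
        by (simp add: simple_reflection_def fun_eq_iff scaleR_fun_def scaleR_conv_of_real algebra_simps)
      moreover have "s *\<^sub>R srefl j x + t *\<^sub>R srefl j y \<in> convex hull Wt"
        using * by (intro convexD[OF convex_convex_hull]) auto
      ultimately show "s *\<^sub>R x + t *\<^sub>R y \<in> {\<mu>. srefl j \<mu> \<in> convex hull Wt}" by simp
    qed
  qed
  then show "srefl j \<mu> \<in> H" using mu by blast
qed

text \<open>The point is the average over all i of \<open>\<Lambda>\<close> lowered by N times
  \<open>n i\<close> copies of \<open>\<alpha> i\<close>, N being the number of simple roots. These
  are weights on the rays outside J, and \<open>\<Lambda>\<close> itself for i in J.\<close>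

lemma low_H:
  assumes "\<And>j. j \<in> J \<Longrightarrow> n j = 0"
  shows "low n \<in> H"
proof -
  define N where "N = CARD('i)"
  have N: "N > 0" unfolding N_def by simp
  define y where "y i = (\<lambda>h. \<Lambda> h - of_nat (N * n i) * \<alpha> i h)" for i
  have y: "y i \<in> Wt" for i
  proof (cases "i \<in> J")
    case True
    then show ?thesis unfolding y_def using assms[OF True] Lam_Wt by simp
  next
    case False
    then show ?thesis unfolding y_def by (rule not_J_Wt)
  qed
  have "(\<Sum>i\<in>UNIV. (1 / real N) *\<^sub>R y i) \<in> H"
    unfolding H_def by (rule convex_sum) (auto simp: N_def intro: hull_inc y)
  moreover have "(\<Sum>i\<in>UNIV. (1 / real N) *\<^sub>R y i) = low n"
  proof
    fix h
    have sf: "(\<Sum>i\<in>B. g i) h = (\<Sum>i\<in>B. g i h)" for B :: "'i set" and g :: "'i \<Rightarrow> 'h \<Rightarrow> complex"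
      by (induction B rule: infinite_finite_induct) auto
    have "(\<Sum>i\<in>UNIV. (1 / real N) *\<^sub>R y i) h = (\<Sum>i\<in>UNIV. \<Lambda> h / of_nat N - of_nat (n i) * \<alpha> i h)"
      unfolding sf using N
      by (intro sum.cong) (simp_all add: y_def scaleR_fun_def scaleR_conv_of_real field_simps)
    also have "\<dots> = low n h"
      using N unfolding low_def rsum_def by (simp add: sum_subtractf N_def)
    finally show "(\<Sum>i\<in>UNIV. (1 / real N) *\<^sub>R y i) h = low n h" .
  qed
  ultimately show ?thesis by simp
qed

text \<open>The cone below \<open>\<Lambda>\<close> with real coefficients is convex and contains
  all weights.\<close>

lemma H_bound: "\<mu> \<in> H \<Longrightarrow> \<exists>x. (\<forall>k. x k \<ge> 0) \<and> \<mu> = (\<lambda>h. \<Lambda> h - rsum x h)"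
proof -
  let ?C = "{\<mu>. \<exists>x. (\<forall>k. x k \<ge> 0) \<and> \<mu> = (\<lambda>h. \<Lambda> h - rsum x h)}"
  have "H \<subseteq> ?C"
    unfolding H_def
  proof (rule hull_minimal)
    show "Wt \<subseteq> ?C"
    proof
      fix \<mu> assume "\<mu> \<in> Wt"
      then obtain n where "\<mu> = low n" using Wt_low by blast
      then show "\<mu> \<in> ?C" unfolding low_def by (intro CollectI exI[of _ "\<lambda>i. real (n i)"]) simp
    qed
    show "convex ?C"
    proof (rule convexI)
      fix \<mu> \<nu> :: "'h \<Rightarrow> complex" and s t :: real
      assume "\<mu> \<in> ?C" "\<nu> \<in> ?C" and st: "s \<ge> 0" "t \<ge> 0" "s + t = 1"
      then obtain x y where x: "\<forall>k. x k \<ge> 0" "\<mu> = (\<lambda>h. \<Lambda> h - rsum x h)"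
        and y: "\<forall>k. y k \<ge> 0" "\<nu> = (\<lambda>h. \<Lambda> h - rsum y h)" by blast
      have "s *\<^sub>R \<mu> + t *\<^sub>R \<nu> = (\<lambda>h. \<Lambda> h - rsum (\<lambda>k. s * x k + t * y k) h)"
      proof
        fix h
        have "of_real (s + t) * \<Lambda> h = \<Lambda> h" unfolding st(3) by simp
        then have "of_real s * \<Lambda> h + of_real t * \<Lambda> h = \<Lambda> h" by (simp add: distrib_right)
        then show "(s *\<^sub>R \<mu> + t *\<^sub>R \<nu>) h = \<Lambda> h - rsum (\<lambda>k. s * x k + t * y k) h"
          unfolding x(2) y(2) rsum_simps
          by (simp add: scaleR_fun_def scaleR_conv_of_real right_diff_distrib)
      qed
      then show "s *\<^sub>R \<mu> + t *\<^sub>R \<nu> \<in> ?C"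
        using x(1) y(1) st by (intro CollectI exI[of _ "\<lambda>k. s * x k + t * y k"]) auto
    qed
  qed
  then show "\<mu> \<in> H \<Longrightarrow> \<exists>x. (\<forall>k. x k \<ge> 0) \<and> \<mu> = (\<lambda>h. \<Lambda> h - rsum x h)" by blast
qed

lemma H_ray: "(\<lambda>h. \<Lambda> h - of_int c * \<alpha> i h) \<in> H \<Longrightarrow> c \<ge> 0"
proof -
  assume "(\<lambda>h. \<Lambda> h - of_int c * \<alpha> i h) \<in> H"
  then obtain x where x: "\<forall>k. x k \<ge> 0" "(\<lambda>h. \<Lambda> h - of_int c * \<alpha> i h) = (\<lambda>h. \<Lambda> h - rsum x h)"
    using H_bound by blast
  have "rsum x = rsum (\<lambda>k. if k = i then real_of_int c else 0)"
    using x(2) by (simp add: fun_eq_iff rsum_unit)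
  then have "x i = real_of_int c" unfolding rsum_inj by simp
  then show "c \<ge> 0" using x(1) by (metis of_int_0_le_iff)
qed

lemma Wt_H: "\<mu> \<in> Wt \<Longrightarrow> \<mu> \<in> H"
  unfolding H_def by (rule hull_inc)

lemma refl_ray:
  "\<Lambda> (\<alpha>v i) = of_int l \<Longrightarrow>
    srefl i (\<lambda>h. \<Lambda> h - of_nat n * \<alpha> i h) = (\<lambda>h. \<Lambda> h - of_int (l - int n) * \<alpha> i h)"
  by (simp add: simple_reflection_def fun_eq_iff algebra_simps)

lemma J_iff_H: "i \<in> J \<longleftrightarrow> (\<exists>n::nat. (\<lambda>h. \<Lambda> h - of_nat n * \<alpha> i h) \<notin> H)"
proof
  assume i: "i \<in> J"
  obtain l where l: "\<Lambda> (\<alpha>v i) = of_int l" using P_pairing[OF Lam] by blast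
  \<comment> \<open>For l >= 0 the reflection of this point is \<open>\<Lambda>\<close> raised by
    one \<open>\<alpha> i\<close>, which \<open>H_ray\<close> excludes.\<close>
  have "(\<lambda>h. \<Lambda> h - of_nat (nat (l + 1)) * \<alpha> i h) \<notin> H"
  proof
    assume "(\<lambda>h. \<Lambda> h - of_nat (nat (l + 1)) * \<alpha> i h) \<in> H"
    from refl_H[OF i this] have "l - int (nat (l + 1)) \<ge> 0" unfolding refl_ray[OF l] by (rule H_ray)
    then show False by arith
  qed
  then show "\<exists>n::nat. (\<lambda>h. \<Lambda> h - of_nat n * \<alpha> i h) \<notin> H" by blast
next
  assume "\<exists>n::nat. (\<lambda>h. \<Lambda> h - of_nat n * \<alpha> i h) \<notin> H"
  then show "i \<in> J" using not_J_Wt Wt_H by blast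
qed

abbreviation "ch \<equiv> character D M"

section \<open>The stabilizer of the character\<close>

lemma stabilizer_iff: "w \<in> char_stabilizer D M \<longleftrightarrow> (\<exists>xs. w = refl_word xs) \<and> ch \<circ> w = ch"
proof -
  have "ch \<circ> inv (refl_word xs) = ch \<longleftrightarrow> ch \<circ> refl_word xs = ch" for xs
  proof
    assume "ch \<circ> inv (refl_word xs) = ch"
    then have "ch \<circ> refl_word xs = (ch \<circ> inv (refl_word xs)) \<circ> refl_word xs" by simp
    also have "\<dots> = ch" by (simp add: comp_assoc inv_o_cancel[OF bij_is_inj[OF bij_refl_word]])
    finally show "ch \<circ> refl_word xs = ch" .
  next
    assume "ch \<circ> refl_word xs = ch"
    then have "ch \<circ> inv (refl_word xs) = (ch \<circ> refl_word xs) \<circ> inv (refl_word xs)" by simp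
    also have "\<dots> = ch" by (simp add: comp_assoc surj_iff[THEN iffD1, OF bij_is_surj[OF bij_refl_word]])
    finally show "ch \<circ> inv (refl_word xs) = ch" .
  qed
  then show ?thesis unfolding char_stabilizer_def weyl_group_refl_word by auto
qed

lemma ch_refl_word_J: "set xs \<subseteq> J \<Longrightarrow> ch \<circ> refl_word xs = ch"
  by (induction xs) (auto simp: fun_eq_iff character_refl)

text \<open>Recovers J from the stabilizer by testing the simple reflections alone.\<close>

lemma refl_stabilizer: "srefl i \<in> char_stabilizer D M \<longleftrightarrow> i \<in> J"
proof
  assume "i \<in> J"
  then have "ch \<circ> srefl i = ch" using ch_refl_word_J[of "[i]"] by simp
  moreover have "srefl i = refl_word [i]" by simp
  ultimately show "srefl i \<in> char_stabilizer D M" unfolding stabilizer_iff by blast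
next
  assume "srefl i \<in> char_stabilizer D M"
  then have ch: "ch (srefl i \<mu>) = ch \<mu>" for \<mu> unfolding stabilizer_iff by (metis comp_apply)
  show "i \<in> J"
  proof (rule ccontr)
    assume i: "i \<notin> J"
    obtain l where l: "\<Lambda> (\<alpha>v i) = of_int l" using P_pairing[OF Lam] by blast
    \<comment> \<open>Here l may be negative; \<open>nat\<close> then gives 0 and the reflected
      point has the negative coefficient l, so \<open>H_ray\<close> applies in every case.\<close>
    have "srefl i (\<lambda>h. \<Lambda> h - of_nat (nat (l + 1)) * \<alpha> i h) \<in> Wt"
      using not_J_Wt[OF i, of "nat (l + 1)"] unfolding character_Wt[symmetric] ch .
    then have "(\<lambda>h. \<Lambda> h - of_int (l - int (nat (l + 1))) * \<alpha> i h) \<in> H"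
      unfolding refl_ray[OF l] by (rule Wt_H)
    then have "l - int (nat (l + 1)) \<ge> 0" by (rule H_ray)
    then show False by arith
  qed
qed

text \<open>An element of the stabilizer of minimal length in its coset modulo \<open>W\<^sub>J\<close>, if not the
  identity, sends some \<open>\<alpha> i\<close> with \<open>i \<notin> J\<close> to a negative root; this contradicts that all
  \<open>\<Lambda> - n \<alpha> i\<close> are weights.\<close>

lemma stabilizer_eq: "char_stabilizer D M = {refl_word xs | xs. set xs \<subseteq> J}"
proof (intro equalityI subsetI)
  fix w assume "w \<in> {refl_word xs | xs. set xs \<subseteq> J}"
  then show "w \<in> char_stabilizer D M" unfolding stabilizer_iff using ch_refl_word_J by blast
next
  fix w assume "w \<in> char_stabilizer D M"
  then obtain xs where xs: "w = refl_word xs" "ch \<circ> refl_word xs = ch" unfolding stabilizer_iff by blast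
  define us where "us = arg_min (\<lambda>us. weyl_length (refl_word (xs @ us))) (\<lambda>us. set us \<subseteq> J)"
  have "set us \<subseteq> J \<and> (\<forall>ys. set ys \<subseteq> J \<longrightarrow> weyl_length (refl_word (xs @ us)) \<le> weyl_length (refl_word (xs @ ys)))"
    unfolding us_def by (rule arg_min_nat_lemma[of _ "[]"]) simp
  then have us: "set us \<subseteq> J" "\<And>ys. set ys \<subseteq> J \<Longrightarrow> weyl_length (refl_word (xs @ us)) \<le> weyl_length (refl_word (xs @ ys))"
    by simp_all
  obtain ys where ys: "length ys = weyl_length (refl_word (xs @ us))" "refl_word (xs @ us) = refl_word ys"
    using weyl_length_ex by blast
  have ch_ys: "ch \<circ> refl_word ys = ch"
  proof -
    have "ch \<circ> refl_word ys = (ch \<circ> refl_word xs) \<circ> refl_word us" by (simp only: ys(2)[symmetric] refl_word_append comp_assoc)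
    then show ?thesis using xs(2) ch_refl_word_J[OF us(1)] by simp
  qed
  show "w \<in> {refl_word xs | xs. set xs \<subseteq> J}"
  proof (cases ys rule: rev_cases)
    case Nil
    then have "refl_word xs \<circ> refl_word us = id" using ys(2) by (simp add: refl_word_append)
    then have "refl_word xs \<circ> (refl_word us \<circ> refl_word (rev us)) = refl_word (rev us)" by (simp add: comp_assoc[symmetric])
    then have "w = refl_word (rev us)" unfolding refl_word_rev xs(1) by simp
    moreover have "set (rev us) \<subseteq> J" using us(1) by simp
    ultimately show ?thesis by blast
  next
    case (snoc zs i)
    \<comment> \<open>A last letter i of a shortest word can be removed by appending i, so
      minimality in the coset excludes \<open>i \<in> J\<close>.\<close>
    have refl: "refl_word (xs @ us @ [i]) = refl_word zs"
    proof -
      have "refl_word (xs @ us @ [i]) = refl_word (xs @ us) \<circ> srefl i" by (simp add: refl_word_append comp_assoc)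
      also have "\<dots> = refl_word zs" unfolding ys(2) snoc by (simp add: refl_word_append comp_assoc)
      finally show ?thesis .
    qed
    have len: "weyl_length (refl_word zs) < weyl_length (refl_word ys)"
      using weyl_length_le[of zs] ys snoc by simp
    have i: "i \<notin> J"
    proof
      assume "i \<in> J"
      then have "weyl_length (refl_word (xs @ us)) \<le> weyl_length (refl_word (xs @ us @ [i]))" using us by auto
      then show False using len refl ys(2) by simp
    qed
    have "nonneg (refl_word zs (\<alpha> i))" using len snoc by (intro nonneg_root) simp
    then obtain y where y: "\<forall>k. y k \<ge> 0" "refl_word zs (\<alpha> i) = rsum y" unfolding nonneg_def by blast
    have rw0: "refl_word xs (\<lambda>_. 0) = (\<lambda>_. 0)" for xs
      using refl_word_diff[of xs "\<lambda>_. 0" 1 "\<lambda>_. 0"] by simp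
    have "y \<noteq> (\<lambda>_. 0)"
    proof
      assume y0: "y = (\<lambda>_. 0)"
      have "rsum y = (\<lambda>_. 0)" unfolding y0 by (rule ext) (rule rsum_simps(4))
      then have "refl_word zs (\<alpha> i) = refl_word zs (\<lambda>_. 0)" using y(2) rw0 by simp
      then have "\<alpha> i = (\<lambda>_. 0)" using bij_is_inj[OF bij_refl_word] by (metis injD)
      then have "\<alpha> i (\<alpha>v i) = 0" by simp
      then show False by simp
    qed
    then obtain k where "y k \<noteq> 0" by (auto simp: fun_eq_iff)
    then have k: "y k > 0" using y(1) by (metis less_eq_real_def)
    have neg: "refl_word ys (\<alpha> i) = (\<lambda>h. - rsum y h)"
    proof -
      have "refl_word ys (\<alpha> i) = refl_word zs (\<lambda>h. (\<lambda>_. 0) h - 1 * \<alpha> i h)" unfolding snoc by (simp add: refl_word_append)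
      also have "\<dots> = (\<lambda>h. refl_word zs (\<lambda>_. 0) h - 1 * refl_word zs (\<alpha> i) h)" by (rule refl_word_diff)
      finally show ?thesis unfolding rw0 y(2) by simp
    qed
    have img: "(\<lambda>h. refl_word ys \<Lambda> h + of_nat n * rsum y h) \<in> Wt" for n
    proof -
      have "refl_word ys (\<lambda>h. \<Lambda> h - of_nat n * \<alpha> i h) \<in> Wt"
        using not_J_Wt[OF i, of n] ch_ys unfolding character_Wt[symmetric] by (metis comp_apply)
      then show ?thesis unfolding refl_word_diff neg by simp
    qed
    obtain n0 where n0: "refl_word ys \<Lambda> = low n0" using img[of 0] Wt_low by auto
    \<comment> \<open>With this n, the image of \<open>\<Lambda>\<close> lowered by n times
      \<open>\<alpha> i\<close> has a negative k-th coordinate below \<open>\<Lambda>\<close>, which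
      no weight has.\<close>
    obtain n where n: "real (n0 k) < real n * y k" using reals_Archimedean3[OF k] by blast
    obtain n' where n': "(\<lambda>h. low n0 h + of_nat n * rsum y h) = low n'"
      using img[of n] Wt_low unfolding n0 by blast
    have "rsum (\<lambda>j. real (n0 j) - real n * y j) = rsum (\<lambda>j. real (n' j))"
    proof
      fix h
      have "\<Lambda> h - rsum (\<lambda>i. real (n0 i)) h + of_nat n * rsum y h = \<Lambda> h - rsum (\<lambda>i. real (n' i)) h"
        using fun_cong[OF n', of h] unfolding low_def .
      then show "rsum (\<lambda>j. real (n0 j) - real n * y j) h = rsum (\<lambda>j. real (n' j)) h"
        unfolding rsum_simps by (simp add: algebra_simps)
    qed
    then have "(\<lambda>j. real (n0 j) - real n * y j) = (\<lambda>j. real (n' j))" unfolding rsum_inj .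
    then have "real (n0 k) - real n * y k = real (n' k)" by (rule fun_cong)
    then show ?thesis using n by simp
  qed
qed

end

text \<open>The hypotheses on the convex set in \<open>Wt_subset_convex\<close> mention only
  \<open>D\<close>, \<open>\<Lambda>\<close> and J, so the hull of one module can be used for the
  weights of the other.\<close>

lemma H_subset:
  fixes D :: "('i::finite, 'h::ab_group_add) km_datum"
  assumes "highest_weight_rep D M \<Lambda> v" "highest_weight_rep D M' \<Lambda> v'" "highest_weight_rep.J M v = highest_weight_rep.J M' v'"
  shows "highest_weight_rep.H D M \<subseteq> highest_weight_rep.H D M'"
proof -
  interpret A: highest_weight_rep D M \<Lambda> v by fact
  interpret B: highest_weight_rep D M' \<Lambda> v' by fact
  have "A.Wt \<subseteq> B.H"
  proof (rule A.Wt_subset_convex)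
    show "convex B.H" unfolding B.H_def by (rule convex_convex_hull)
    show "\<And>j \<mu>. j \<in> A.J \<Longrightarrow> \<mu> \<in> B.H \<Longrightarrow> simple_reflection D j \<mu> \<in> B.H"
      using B.refl_H assms(3) by simp
    show "A.low n \<in> B.H" if "\<And>j. j \<in> A.J \<Longrightarrow> n j = 0" for n
      using B.low_H[of n] assms(3) that by simp
  qed
  then show ?thesis unfolding A.H_def
    by (rule hull_minimal) (simp add: B.H_def convex_convex_hull)
qed

theorem theorem9p4:
  fixes D :: "('i::finite, 'h::ab_group_add) km_datum"
    and \<phi> :: "('h \<Rightarrow>\<^sub>0 ratfun) \<Rightarrow> ratfun"
    and V :: "('i, 'h, 'v::ab_group_add) uq_rep" and v :: 'v
    and V' :: "('i, 'h, 'w::ab_group_add) uq_rep" and v' :: 'w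
  assumes "km_datum D"
    and "integral_weight D \<phi>"
    and "highest_weight_module D V \<phi>" and "highest_weight_vector D V \<phi> v"
    and "highest_weight_module D V' \<phi>" and "highest_weight_vector D V' \<phi> v'"
  shows "(integrability D V \<phi> = integrability D V' \<phi> \<longleftrightarrow>
            convex hull (spec_weights D V v) = convex hull (spec_weights D V' v')) \<and>
         (convex hull (spec_weights D V v) = convex hull (spec_weights D V' v') \<longleftrightarrow>
            char_stabilizer D V = char_stabilizer D V')"
proof -
  obtain \<Lambda> where Lam: "\<Lambda> \<in> weight_lattice D" "\<forall>x\<in>coweight_algebra D. \<phi> x = q_weight \<Lambda> x"
    using assms(2) unfolding integral_weight_def by blast
  \<comment> \<open>\<open>\<phi>\<close> enters only through its values on the elements q^h, so it
    can be replaced by \<open>q_weight \<Lambda>\<close>.\<close>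
  have single: "\<phi> (Poly_Mapping.single h 1) = q_weight \<Lambda> (Poly_Mapping.single h 1)"
    if "h \<in> coweight_lattice D" for h
    using Lam(2) that by (simp add: coweight_algebra_def)
  have ws: "weight_space D V \<phi> = weight_space D V (q_weight \<Lambda>)"
    "weight_space D V' \<phi> = weight_space D V' (q_weight \<Lambda>)"
    unfolding weight_space_def using single by auto
  interpret A: highest_weight_rep D V \<Lambda> v
    using assms Lam(1) ws(1)
    by unfold_locales (auto simp: highest_weight_module_def highest_weight_vector_def)
  interpret B: highest_weight_rep D V' \<Lambda> v'
    using assms Lam(1) ws(2)
    by unfold_locales (auto simp: highest_weight_module_def highest_weight_vector_def)
  have I: "integrability D V \<phi> = A.J" "integrability D V' \<phi> = B.J"
    using A.integrability_J B.integrability_J unfolding integrability_def ws by simp_all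
  have hull: "convex hull (spec_weights D V v) = A.H" "convex hull (spec_weights D V' v') = B.H"
    unfolding A.spec_weights_Wt B.spec_weights_Wt A.H_def B.H_def by simp_all
  have "A.J = B.J \<longleftrightarrow> A.H = B.H"
  proof
    assume J: "A.J = B.J"
    show "A.H = B.H"
      using H_subset[OF A.highest_weight_rep_axioms B.highest_weight_rep_axioms J] H_subset[OF B.highest_weight_rep_axioms A.highest_weight_rep_axioms J[symmetric]]
      by (rule equalityI)
  next
    assume H: "A.H = B.H"
    show "A.J = B.J"
      by (rule set_eqI) (simp only: A.J_iff_H B.J_iff_H H)
  qed
  moreover have "A.J = B.J \<longleftrightarrow> char_stabilizer D V = char_stabilizer D V'"
  proof
    assume "A.J = B.J"
    then show "char_stabilizer D V = char_stabilizer D V'"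
      unfolding A.stabilizer_eq B.stabilizer_eq by simp
  next
    assume "char_stabilizer D V = char_stabilizer D V'"
    then show "A.J = B.J" using A.refl_stabilizer B.refl_stabilizer by blast
  qed
  ultimately show ?thesis unfolding I hull by blast
qed

end
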